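(* Let $\Omega$ be a locally compact Hausdorff space and $E,F$ Banach spaces. For every continuous linear operator $T\colon C_0(\Omega,E)\to F^*$ there exists a unique regular weak* i-measure $\mu\colon\mathfrak{B}(\Omega)\to\mathcal{L}(E,F^* )$ such that $$Tu=\int^{w*}_\Omega u\,\mathrm{d}\mu\qquad(u\in C_0(\Omega,E)).$$ Moreover, $\|T\|=\|\mu\|_\Omega$.
   Context: Banach spaces are over a fixed field $\mathbb{K}$ of real or complex numbers; $\mathcal{L}(E,G)$ is the Banach space of continuous linear operators $E\to G$; $C_0(\Omega,E)$ is the space of continuous functions $\Omega\to E$ vanishing at infinity with the sup-norm; $\mathfrak{B}(\Omega)$ is the Borel $\sigma$-algebra. For $T_n\in\mathcal{L}(E,G)$, $\sum_n T_n$ is independently convergent if $\sum_n T_nx_n$ converges in the norm of $G$ for every bounded sequence $(x_n)$ in $E$. For a $\sigma$-algebra $\mathfrak{M}$ on a set $Z$, $\nu\colon\mathfrak{M}\to\mathcal{L}(E,G)$ is an i-measure if for any pairwise disjoint $A_n\in\mathfrak{M}$, $\nu(\bigcup_n A_n)x=\sum_n\nu(A_n)x$ for each $x\in E$ and $\sum_n\nu(A_n)$ is independently convergent. An i-measure $\nu$ on $\mathfrak{B}(\Omega)$ is regular if every $A\in\mathfrak{B}(\Omega)$ includes a $\sigma$-compact set $K$ (a countable union of compact sets) such that $\nu$ vanishes on every Borel set contained in $A\setminus K$. A set function $\mu\colon\mathfrak{M}\to\mathcal{L}(E,F^* )$ is a weak* i-measure if for every $v\in F$ the set function $\mu_v\colon\mathfrak{M}\to\mathcal{L}(E,\mathbb{K})$,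 $\mu_v(A)x=(\mu(A)x)(v)$, is an i-measure; for $\mathfrak{M}=\mathfrak{B}(\Omega)$, $\mu$ is regular if each $\mu_v$ $(v\in F)$ is a regular i-measure. The total semivariation $\|\mu\|_Z$ is the supremum of $\|\sum_{n=1}^N\mu(A_n)x_n\|$ over finite $N$, pairwise disjoint $A_n\in\mathfrak{M}$, $x_n\in E$ with $\|x_n\|\le1$; it is known to be finite. $S_{\mathfrak{M}}(Z,E)$ is the set of bounded $f\colon Z\to E$ with $f(Z)$ countable and $f^{-1}(\{e\})\in\mathfrak{M}$ for all $e\in E$; for such $f$ the weak* integral $\int^{w*}_Z f\,\mathrm{d}\mu\in F^*$ is given by $(\int^{w*}_Z f\,\mathrm{d}\mu)(v)=\sum_{e\in E}(\mu(f^{-1}(\{e\}))e)(v)$, $v\in F$. It is linear and sup-norm continuous on $S_{\mathfrak{M}}(Z,E)$ with norm $\|\mu\|_Z$ and is extended by continuity to the uniform closure $M_{\mathfrak{M}}(Z,E)$ of $S_{\mathfrak{M}}(Z,E)$, which consists of all bounded $f\colon Z\to E$ with $f(Z)$ separable and $\psi\circ f$ $\mathfrak{M}$-measurable for every $\psi\in E^*$. Note $C_0(\Omega,E)\subset M_{\mathfrak{B}(\Omega)}(\Omega,E)$. *)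

theory Defs
  imports "HOL-Analysis.Analysis"
begin

text \<open>
  The class of scalar fields: types isometrically isomorphic, as real normed algebras,
  to the reals or to the complex numbers.
\<close>

class real_or_complex = real_normed_field + banach +
  assumes real_or_complex:
    "(\<exists>h :: 'a \<Rightarrow> real. bij h \<and> (\<forall>x y. h (x + y) = h x + h y) \<and> (\<forall>x y. h (x * y) = h x * h y) \<and>
        (\<forall>r x. h (r *\<^sub>R x) = r *\<^sub>R h x) \<and> (\<forall>x. norm (h x) = norm x)) \<or>
     (\<exists>h :: 'a \<Rightarrow> complex. bij h \<and> (\<forall>x y. h (x + y) = h x + h y) \<and> (\<forall>x y. h (x * y) = h x * h y) \<and>
        (\<forall>r x. h (r *\<^sub>R x) = r *\<^sub>R h x) \<and> (\<forall>x. norm (h x) = norm x))"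

instance real :: real_or_complex
  by standard (intro disjI1 exI[of _ id], auto)

instance complex :: real_or_complex
  by standard (intro disjI2 exI[of _ id], auto)

text \<open>
  A Banach space over the scalar field \<open>'k\<close>: a real Banach space with a scalar multiplication
  \<open>scale\<close> extending the real one and compatible with the norm.
\<close>

locale banach_over = vector_space scale
  for scale :: "'k::real_or_complex \<Rightarrow> 'e::banach \<Rightarrow> 'e" +
  assumes scale_of_real: "scale (of_real r) x = r *\<^sub>R x"
    and norm_scale: "norm (scale c x) = norm c * norm x"

text \<open>
  The type \<open>'e \<Rightarrow>\<^sub>L 'g\<close> of the library consists of the bounded real-linear operators;
  \<open>'k\<close>-linearity is imposed on top of it. The norm is the operator norm in either case.
\<close>

definition Lin :: "('k::real_or_complex \<Rightarrow> 'e::real_normed_vector \<Rightarrow> 'e) \<Rightarrow>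
    ('k \<Rightarrow> 'g::real_normed_vector \<Rightarrow> 'g) \<Rightarrow> ('e \<Rightarrow>\<^sub>L 'g) set" where
  "Lin sE sG = {A. \<forall>c x. blinfun_apply A (sE c x) = sG c (blinfun_apply A x)}"

definition dual :: "('k::real_or_complex \<Rightarrow> 'f::real_normed_vector \<Rightarrow> 'f) \<Rightarrow> ('f \<Rightarrow>\<^sub>L 'k) set" where
  "dual sF = Lin sF (*)"

definition scale_dual :: "'k::real_or_complex \<Rightarrow> ('f::real_normed_vector \<Rightarrow>\<^sub>L 'k) \<Rightarrow> ('f \<Rightarrow>\<^sub>L 'k)" where
  "scale_dual c \<phi> = Blinfun (\<lambda>v. c * blinfun_apply \<phi> v)"

definition independently_convergent ::
    "(nat \<Rightarrow> ('e::real_normed_vector \<Rightarrow>\<^sub>L 'g::real_normed_vector)) \<Rightarrow> bool" where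
  "independently_convergent T \<longleftrightarrow>
     (\<forall>x. bounded (range x) \<longrightarrow> summable (\<lambda>n. blinfun_apply (T n) (x n)))"

definition i_measure :: "('k::real_or_complex \<Rightarrow> 'e::real_normed_vector \<Rightarrow> 'e) \<Rightarrow>
    ('k \<Rightarrow> 'g::real_normed_vector \<Rightarrow> 'g) \<Rightarrow> 'a set set \<Rightarrow> ('a set \<Rightarrow> ('e \<Rightarrow>\<^sub>L 'g)) \<Rightarrow> bool" where
  "i_measure sE sG \<MM> \<nu> \<longleftrightarrow>
     (\<forall>A\<in>\<MM>. \<nu> A \<in> Lin sE sG) \<and>
     (\<forall>A::nat \<Rightarrow> 'a set. range A \<subseteq> \<MM> \<and> disjoint_family A \<longrightarrow>
        (\<forall>x. (\<lambda>n. blinfun_apply (\<nu> (A n)) x) sums blinfun_apply (\<nu> (\<Union>n. A n)) x) \<and>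
        independently_convergent (\<lambda>n. \<nu> (A n)))"

definition borel_sets :: "'a topology \<Rightarrow> 'a set set" where
  "borel_sets X = sigma_sets (topspace X) {U. openin X U}"

definition sigma_compactin :: "'a topology \<Rightarrow> 'a set \<Rightarrow> bool" where
  "sigma_compactin X K \<longleftrightarrow> (\<exists>C::nat \<Rightarrow> 'a set. (\<forall>n. compactin X (C n)) \<and> K = (\<Union>n. C n))"

definition regular_i_measure :: "('k::real_or_complex \<Rightarrow> 'e::real_normed_vector \<Rightarrow> 'e) \<Rightarrow>
    ('k \<Rightarrow> 'g::real_normed_vector \<Rightarrow> 'g) \<Rightarrow> 'a topology \<Rightarrow> ('a set \<Rightarrow> ('e \<Rightarrow>\<^sub>L 'g)) \<Rightarrow> bool" where
  "regular_i_measure sE sG X \<nu> \<longleftrightarrow>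
     i_measure sE sG (borel_sets X) \<nu> \<and>
     (\<forall>A\<in>borel_sets X. \<exists>K\<subseteq>A. sigma_compactin X K \<and>
        (\<forall>B\<in>borel_sets X. B \<subseteq> A - K \<longrightarrow> \<nu> B = 0))"

definition slice :: "('a set \<Rightarrow> ('e::real_normed_vector \<Rightarrow>\<^sub>L ('f::real_normed_vector \<Rightarrow>\<^sub>L 'k::real_or_complex))) \<Rightarrow>
    'f \<Rightarrow> 'a set \<Rightarrow> ('e \<Rightarrow>\<^sub>L 'k)" where
  "slice \<mu> v A = Blinfun (\<lambda>x. blinfun_apply (blinfun_apply (\<mu> A) x) v)"

definition dual_operator_valued :: "('k::real_or_complex \<Rightarrow> 'e::real_normed_vector \<Rightarrow> 'e) \<Rightarrow>
    ('k \<Rightarrow> 'f::real_normed_vector \<Rightarrow> 'f) \<Rightarrow> 'a set set \<Rightarrow> ('a set \<Rightarrow> ('e \<Rightarrow>\<^sub>L ('f \<Rightarrow>\<^sub>L 'k))) \<Rightarrow> bool" where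
  "dual_operator_valued sE sF \<MM> \<mu> \<longleftrightarrow>
     (\<forall>A\<in>\<MM>. \<mu> A \<in> Lin sE scale_dual \<and> (\<forall>x. blinfun_apply (\<mu> A) x \<in> dual sF))"

definition weak_star_i_measure :: "('k::real_or_complex \<Rightarrow> 'e::real_normed_vector \<Rightarrow> 'e) \<Rightarrow>
    ('k \<Rightarrow> 'f::real_normed_vector \<Rightarrow> 'f) \<Rightarrow> 'a set set \<Rightarrow> ('a set \<Rightarrow> ('e \<Rightarrow>\<^sub>L ('f \<Rightarrow>\<^sub>L 'k))) \<Rightarrow> bool" where
  "weak_star_i_measure sE sF \<MM> \<mu> \<longleftrightarrow>
     dual_operator_valued sE sF \<MM> \<mu> \<and> (\<forall>v. i_measure sE (*) \<MM> (slice \<mu> v))"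

definition regular_weak_star_i_measure :: "('k::real_or_complex \<Rightarrow> 'e::real_normed_vector \<Rightarrow> 'e) \<Rightarrow>
    ('k \<Rightarrow> 'f::real_normed_vector \<Rightarrow> 'f) \<Rightarrow> 'a topology \<Rightarrow> ('a set \<Rightarrow> ('e \<Rightarrow>\<^sub>L ('f \<Rightarrow>\<^sub>L 'k))) \<Rightarrow> bool" where
  "regular_weak_star_i_measure sE sF X \<mu> \<longleftrightarrow>
     weak_star_i_measure sE sF (borel_sets X) \<mu> \<and>
     (\<forall>v. regular_i_measure sE (*) X (slice \<mu> v))"

definition total_semivariation ::
    "'a set set \<Rightarrow> ('a set \<Rightarrow> ('e::real_normed_vector \<Rightarrow>\<^sub>L 'g::real_normed_vector)) \<Rightarrow> ennreal" where
  "total_semivariation \<MM> \<mu> =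
     Sup {ennreal (norm (\<Sum>n<N. blinfun_apply (\<mu> (A n)) (x n))) | (N::nat) A x.
       (\<forall>n<N. A n \<in> \<MM>) \<and> disjoint_family_on A {..<N} \<and> (\<forall>n<N. norm (x n) \<le> 1)}"

text \<open>
  Functions on a set \<open>Z\<close> are represented by total functions, of which only the values on \<open>Z\<close> matter.
\<close>

definition countably_valued :: "'a set \<Rightarrow> 'a set set \<Rightarrow> ('a \<Rightarrow> 'e::real_normed_vector) set" where
  "countably_valued Z \<MM> =
     {f. bounded (f ` Z) \<and> countable (f ` Z) \<and> (\<forall>e. f -` {e} \<inter> Z \<in> \<MM>)}"

definition weak_star_integral_countable ::
    "'a set \<Rightarrow> ('a set \<Rightarrow> ('e::real_normed_vector \<Rightarrow>\<^sub>L ('f::real_normed_vector \<Rightarrow>\<^sub>L 'k::real_or_complex))) \<Rightarrow>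
     ('a \<Rightarrow> 'e) \<Rightarrow> ('f \<Rightarrow>\<^sub>L 'k)" where
  "weak_star_integral_countable Z \<mu> f =
     Blinfun (\<lambda>v. \<Sum>\<^sub>\<infinity>e\<in>UNIV. blinfun_apply (blinfun_apply (\<mu> (f -` {e} \<inter> Z)) e) v)"

text \<open>
  Extension by continuity to uniform limits: the norm limit of the integrals of any sequence of
  countably valued functions converging to \<open>f\<close> uniformly on \<open>Z\<close>.
\<close>

definition weak_star_integral ::
    "'a set \<Rightarrow> 'a set set \<Rightarrow> ('a set \<Rightarrow> ('e::real_normed_vector \<Rightarrow>\<^sub>L ('f::real_normed_vector \<Rightarrow>\<^sub>L 'k::real_or_complex))) \<Rightarrow>
     ('a \<Rightarrow> 'e) \<Rightarrow> ('f \<Rightarrow>\<^sub>L 'k)" where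
  "weak_star_integral Z \<MM> \<mu> f =
     (THE \<phi>. \<exists>s::nat \<Rightarrow> 'a \<Rightarrow> 'e.
        (\<forall>n. s n \<in> countably_valued Z \<MM>) \<and> uniform_limit Z s f sequentially \<and>
        (\<lambda>n. weak_star_integral_countable Z \<mu> (s n)) \<longlonglongrightarrow> \<phi>)"

text \<open>
  A function on \<open>topspace X\<close> is represented by its extension by zero, so that distinct elements
  of \<open>C0 X\<close> are distinct functions on the space and the vector space operations are pointwise.
  This also makes \<open>sup_norm\<close> the supremum over \<open>topspace X\<close>, or zero if the space is empty.
\<close>

definition C0 :: "'a topology \<Rightarrow> ('a \<Rightarrow> 'e::real_normed_vector) set" where
  "C0 X = {u. continuous_map X euclidean u \<and>
     (\<forall>\<epsilon>>0. \<exists>K. compactin X K \<and> (\<forall>x\<in>topspace X - K. norm (u x) < \<epsilon>)) \<and>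
     (\<forall>x. x \<notin> topspace X \<longrightarrow> u x = 0)}"

definition sup_norm :: "('a \<Rightarrow> 'e::real_normed_vector) \<Rightarrow> real" where
  "sup_norm u = (SUP x. norm (u x))"

definition continuous_linear_on_C0 :: "('k::real_or_complex \<Rightarrow> 'e::real_normed_vector \<Rightarrow> 'e) \<Rightarrow>
    ('k \<Rightarrow> 'f::real_normed_vector \<Rightarrow> 'f) \<Rightarrow> 'a topology \<Rightarrow> (('a \<Rightarrow> 'e) \<Rightarrow> ('f \<Rightarrow>\<^sub>L 'k)) \<Rightarrow> bool" where
  "continuous_linear_on_C0 sE sF X T \<longleftrightarrow>
     (\<forall>u\<in>C0 X. T u \<in> dual sF) \<and>
     (\<forall>u\<in>C0 X. \<forall>w\<in>C0 X. T (\<lambda>x. u x + w x) = T u + T w) \<and>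
     (\<forall>u\<in>C0 X. \<forall>c. T (\<lambda>x. sE c (u x)) = scale_dual c (T u)) \<and>
     (\<forall>u\<in>C0 X. \<forall>\<epsilon>>0. \<exists>\<delta>>0. \<forall>w\<in>C0 X.
        sup_norm (\<lambda>x. w x - u x) < \<delta> \<longrightarrow> norm (T w - T u) < \<epsilon>)"

definition norm_on_C0 :: "'a topology \<Rightarrow>
    (('a \<Rightarrow> 'e::real_normed_vector) \<Rightarrow> 'g::real_normed_vector) \<Rightarrow> real" where
  "norm_on_C0 X T = Sup {norm (T u) | u. u \<in> C0 X \<and> sup_norm u \<le> 1}"

end

theory Submission
  imports Defs
begin

text \<open>
  For \<open>v\<close> in \<open>F\<close> put \<open>\<phi> u = T u v\<close>. The set function
  \<open>\<lambda>(U) = sup {\<bar>\<phi> u\<bar> : \<parallel>u\<parallel> \<le> 1, u = 0 off U}\<close> on open sets generates an outer measure for which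
  open sets are measurable, hence a finite Borel measure that is inner regular and of total mass at
  most \<open>\<parallel>\<phi>\<parallel>\<close>. If \<open>f\<close> runs through the functions with values in \<open>[0,1]\<close> that are \<open>1\<close> on larger and
  larger compact subsets of \<open>A\<close> and \<open>0\<close> on larger and larger compact subsets of its complement, then
  \<open>\<phi> (f x)\<close> converges to a limit \<open>\<nu> A x\<close> with \<open>\<bar>\<nu> A x\<bar> \<le> \<parallel>x\<parallel> \<lambda>(A)\<close>. The net does not depend on \<open>v\<close>, so
  the limits are linear in \<open>v\<close> and define \<open>\<mu> A\<close>; the bound yields countable additivity, regularity
  and \<open>\<parallel>\<mu>\<parallel> \<le> \<parallel>T\<parallel>\<close>. Conversely, every regular i-measure has finite variation, which is again an inner
  regular measure, so the same net recovers it from its integrals; this is uniqueness. Finite total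
  semivariation of an arbitrary weak* i-measure, needed to make sense of its integral, is uniform
  boundedness applied to the finite sums.
\<close>

subsection \<open>Functions vanishing at infinity\<close>

text \<open>The obstacle is that indicator functions lie in general outside the domain of T, so
  \<open>\<mu> A x\<close> can only be reached through continuous cutoffs. Nearly every estimate
  comes from one inequality for \<phi> u = T u v: if |u| \<le> c everywhere and |u| \<le> d off a
  Borel set B, then |\<phi> u| \<le> d M + c \<lambda>(B), where M bounds \<phi>. With d = 0 it
  makes the cutoffs converge and bounds their limit. With d the distance from u to a step function
  it compares \<phi> u with the integral of that step function; since M is a multiple of |v|, this
  is uniform in v and gives norm convergence in the dual of F. Functions in \<open>C0\<close> have
  relatively compact range, so finite partitions approximate them, although the integral admits
  countably many values. Scalars enter through phases: factors of modulus 1 turn norms into values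
  that add up, which is behind both the measurability of open sets and the absolute convergence of
  independently convergent series of functionals.\<close>

definition shrink :: "real \<Rightarrow> 'e::real_normed_vector \<Rightarrow> 'e" where
  "shrink \<delta> y = y - (\<delta> / max \<delta> (norm y)) *\<^sub>R y"

text \<open>The term subtracted in \<open>shrink\<close> is y pulled radially into the ball of
  radius \<delta>, so shrinking is a continuous map that moves each point by at most \<delta> and
  sends that ball to 0.\<close>

lemma norm_diff_shrink_le: "\<delta> > 0 \<Longrightarrow> norm (y - shrink \<delta> y) \<le> \<delta>"
  by (simp add: shrink_def field_simps max_def)

lemma shrink_eq_0: "\<delta> > 0 \<Longrightarrow> norm y \<le> \<delta> \<Longrightarrow> shrink \<delta> y = 0"
  by (simp add: shrink_def max_def)

lemma norm_shrink_le:
  assumes "\<delta> > 0" shows "norm (shrink \<delta> y) \<le> norm y"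
proof -
  have "shrink \<delta> y = (1 - \<delta> / max \<delta> (norm y)) *\<^sub>R y"
    by (simp add: shrink_def scaleR_left_diff_distrib)
  moreover have "0 \<le> \<delta> / max \<delta> (norm y)" "\<delta> / max \<delta> (norm y) \<le> 1"
    using assms by (auto simp: divide_le_eq max_def)
  ultimately show ?thesis
    by (simp add: mult_left_le_one_le)
qed

lemma continuous_on_shrink: "\<delta> > 0 \<Longrightarrow> continuous_on UNIV (shrink \<delta>)"
  unfolding shrink_def by (intro continuous_intros) (auto simp: max_def)

lemma continuous_map_scaleR:
  fixes f :: "'a \<Rightarrow> real" and g :: "'a \<Rightarrow> 'b::real_normed_vector"
  shows "continuous_map X euclidean f \<Longrightarrow> continuous_map X euclidean g
    \<Longrightarrow> continuous_map X euclidean (\<lambda>x. f x *\<^sub>R g x)"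
  by (simp add: continuous_map_atin tendsto_scaleR)

lemma continuous_map_comp_on_UNIV:
  "continuous_map X euclidean f \<Longrightarrow> continuous_on UNIV g \<Longrightarrow> continuous_map X euclidean (\<lambda>x. g (f x))"
  using continuous_map_compose[of X euclidean f euclidean g] by (simp add: o_def)

lemma closedin_norm_ge:
  "continuous_map X euclidean u \<Longrightarrow> closedin X {x\<in>topspace X. \<epsilon> \<le> norm (u x)}"
  using closedin_continuous_map_preimage[OF continuous_map_norm, of X u "{\<epsilon>..}"] by simp

lemma openin_norm_gt:
  "continuous_map X euclidean u \<Longrightarrow> openin X {x\<in>topspace X. norm (u x) > \<epsilon>}"
  using openin_continuous_map_preimage[OF continuous_map_norm, of X u "{\<epsilon><..}"] by simp

lemma C0_continuous: "u \<in> C0 X \<Longrightarrow> continuous_map X euclidean u"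
  and C0_outside: "u \<in> C0 X \<Longrightarrow> x \<notin> topspace X \<Longrightarrow> u x = 0"
  by (auto simp: C0_def)

lemma C0_compactin:
  assumes "u \<in> C0 X" "\<epsilon> > 0" shows "compactin X {x\<in>topspace X. \<epsilon> \<le> norm (u x)}"
proof -
  obtain K where K: "compactin X K" "\<forall>x\<in>topspace X - K. norm (u x) < \<epsilon>"
    using assms unfolding C0_def by blast
  have "{x\<in>topspace X. \<epsilon> \<le> norm (u x)} \<subseteq> K" using K by force
  then show ?thesis
    using closed_compactin[OF K(1)] closedin_norm_ge[OF C0_continuous[OF assms(1)]] by blast
qed

lemma C0I:
  assumes "continuous_map X euclidean u" "\<And>\<epsilon>. \<epsilon> > 0 \<Longrightarrow> compactin X {x\<in>topspace X. \<epsilon> \<le> norm (u x)}"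
    "\<And>x. x \<notin> topspace X \<Longrightarrow> u x = 0"
  shows "u \<in> C0 X"
  unfolding C0_def
proof (intro CollectI conjI allI impI)
  fix \<epsilon> :: real assume "\<epsilon> > 0"
  then show "\<exists>K. compactin X K \<and> (\<forall>x\<in>topspace X - K. norm (u x) < \<epsilon>)"
    by (intro exI[of _ "{x\<in>topspace X. \<epsilon> \<le> norm (u x)}"]) (auto simp: assms)
qed (use assms in auto)

text \<open>Scaling, cutting off and shrinking all reduce to this comparison: the superlevel sets of
  w are closed subsets of compact superlevel sets of u.\<close>

lemma C0_dominated:
  assumes "u \<in> C0 X" "continuous_map X euclidean w" "\<And>x. norm (w x) \<le> c * norm (u x)"
  shows "w \<in> C0 X"
proof (rule C0I)
  show "w x = 0" if "x \<notin> topspace X" for x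
    using assms(3)[of x] C0_outside[OF assms(1) that] by simp
  fix \<epsilon> :: real assume e: "\<epsilon> > 0"
  \<comment> \<open>c may be 0 or negative, while the level \<epsilon> / d needs a positive
    divisor.\<close>
  define d where "d = \<bar>c\<bar> + 1"
  have d: "d > 0" "norm (w x) \<le> d * norm (u x)" for x
    using order_trans[OF assms(3)[of x] mult_right_mono[OF _ norm_ge_zero, of c d "u x"]] by (auto simp: d_def)
  have "{x\<in>topspace X. \<epsilon> \<le> norm (w x)} \<subseteq> {x\<in>topspace X. \<epsilon> / d \<le> norm (u x)}"
    using d by (auto simp: field_simps intro: order_trans)
  then show "compactin X {x\<in>topspace X. \<epsilon> \<le> norm (w x)}"
    using closed_compactin[OF C0_compactin[OF assms(1), of "\<epsilon> / d"]] closedin_norm_ge[OF assms(2)] e d(1)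
    by simp
qed (use assms in auto)

lemma C0_zero: "(\<lambda>x. 0) \<in> C0 X"
  by (rule C0I) auto

lemma C0_add:
  assumes "u \<in> C0 X" "w \<in> C0 X" shows "(\<lambda>x. u x + w x) \<in> C0 X"
proof (rule C0I)
  fix \<epsilon> :: real assume "\<epsilon> > 0"
  then have c: "compactin X ({x\<in>topspace X. \<epsilon>/2 \<le> norm (u x)} \<union> {x\<in>topspace X. \<epsilon>/2 \<le> norm (w x)})"
    using assms by (intro compactin_Un C0_compactin) auto
  have "\<epsilon>/2 \<le> norm (u x) \<or> \<epsilon>/2 \<le> norm (w x)" if "\<epsilon> \<le> norm (u x + w x)" for x
    using norm_triangle_ineq[of "u x" "w x"] that by argo
  then have "{x\<in>topspace X. \<epsilon> \<le> norm (u x + w x)} \<subseteq>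
      {x\<in>topspace X. \<epsilon>/2 \<le> norm (u x)} \<union> {x\<in>topspace X. \<epsilon>/2 \<le> norm (w x)}"
    by blast
  then show "compactin X {x\<in>topspace X. \<epsilon> \<le> norm (u x + w x)}"
    using closed_compactin[OF c] closedin_norm_ge[OF continuous_map_add[OF assms[THEN C0_continuous]]] by blast
qed (use assms in \<open>auto simp: C0_outside intro: continuous_map_add C0_continuous\<close>)

lemma C0_scaleR: "u \<in> C0 X \<Longrightarrow> (\<lambda>x. c *\<^sub>R u x) \<in> C0 X"
  by (rule C0_dominated[where c = "\<bar>c\<bar>"]) (auto intro: continuous_map_scaleR C0_continuous)

lemma C0_diff: "u \<in> C0 X \<Longrightarrow> w \<in> C0 X \<Longrightarrow> (\<lambda>x. u x - w x) \<in> C0 X"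
  using C0_add[of u X "\<lambda>x. (-1) *\<^sub>R w x"] C0_scaleR[of w X "-1"] by simp

lemma C0_sum: "(\<And>i. i \<in> I \<Longrightarrow> u i \<in> C0 X) \<Longrightarrow> (\<lambda>x. \<Sum>i\<in>I. u i x) \<in> C0 X"
  by (induction I rule: infinite_finite_induct) (auto simp: C0_zero C0_add)

lemma C0_shrink: "u \<in> C0 X \<Longrightarrow> \<delta> > 0 \<Longrightarrow> (\<lambda>x. shrink \<delta> (u x)) \<in> C0 X"
  by (rule C0_dominated[where c = 1])
    (auto simp: norm_shrink_le intro: continuous_map_comp_on_UNIV[OF C0_continuous] continuous_on_shrink)

lemma C0_mult_bounded:
  assumes "u \<in> C0 X" "continuous_map X euclideanreal f" "\<And>x. x \<in> topspace X \<Longrightarrow> \<bar>f x\<bar> \<le> 1"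
  shows "(\<lambda>x. f x *\<^sub>R u x) \<in> C0 X"
proof (rule C0_dominated[OF assms(1), where c = 1])
  show "norm (f x *\<^sub>R u x) \<le> 1 * norm (u x)" for x
    using assms(3)[of x] C0_outside[OF assms(1), of x]
    by (cases "x \<in> topspace X") (auto intro: mult_left_le_one_le)
qed (use assms in \<open>auto intro: continuous_map_scaleR C0_continuous\<close>)

lemma C0_scaleR_const:
  fixes f :: "'a \<Rightarrow> real" assumes "f \<in> C0 X" shows "(\<lambda>x. f x *\<^sub>R y) \<in> C0 X"
  by (rule C0_dominated[OF assms, where c = "norm y"])
    (auto intro: continuous_map_scaleR C0_continuous[OF assms])

lemma (in banach_over) bounded_linear_scale: "bounded_linear (scale c)"
  by (rule bounded_linear_intro[where K = "norm c"])
    (auto simp: scale_right_distrib norm_scale scale_of_real[symmetric] scale_left_commute)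

lemma (in banach_over) C0_scale: "u \<in> C0 X \<Longrightarrow> (\<lambda>x. scale c (u x)) \<in> C0 X"
  by (rule C0_dominated[where c = "norm c"])
    (auto simp: norm_scale intro: continuous_map_comp_on_UNIV[OF C0_continuous]
      linear_continuous_on bounded_linear_scale)

text \<open>The superlevel set at height 1 is compact, so u is bounded on it; everywhere else,
  including outside the space, the norm is below 1.\<close>

lemma C0_bounded:
  assumes "u \<in> C0 X" obtains b where "b > 0" "\<And>x. norm (u x) \<le> b"
proof -
  have "compact (u ` {x\<in>topspace X. 1 \<le> norm (u x)})"
    using image_compactin[OF C0_compactin[OF assms, of 1] C0_continuous[OF assms]] by simp
  then obtain b where b: "\<forall>y\<in>u ` {x\<in>topspace X. 1 \<le> norm (u x)}. norm y \<le> b"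
    using compact_imp_bounded bounded_iff by metis
  have "norm (u x) \<le> max 1 b" for x
    using b C0_outside[OF assms, of x]
    by (cases "x \<in> topspace X \<and> 1 \<le> norm (u x)") (auto simp: max_def)
  then show thesis using that[of "max 1 b"] by simp
qed

lemma norm_le_sup_norm: "u \<in> C0 X \<Longrightarrow> norm (u x) \<le> sup_norm u"
  unfolding sup_norm_def by (rule cSUP_upper) (auto intro: bdd_aboveI2 elim!: C0_bounded)

lemma sup_norm_le: "(\<And>x. norm (u x) \<le> b) \<Longrightarrow> sup_norm u \<le> b"
  unfolding sup_norm_def by (rule cSUP_least) auto

text \<open>Separating C from S alone would give no decay at infinity. The complement of an open U
  with C \<subseteq> U \<subseteq> L, L compact, is therefore added to the closed set, which
  confines the function to L.\<close>

lemma C0_Urysohn: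
  assumes X: "locally_compact_space X" "Hausdorff_space X"
    and "compactin X C" "closedin X S" "C \<inter> S = {}"
  obtains f :: "'a \<Rightarrow> real" where "f \<in> C0 X" "\<And>x. 0 \<le> f x" "\<And>x. f x \<le> 1"
    "\<And>x. x \<in> C \<Longrightarrow> f x = 1" "\<And>x. x \<in> S \<Longrightarrow> f x = 0"
proof -
  obtain U L where UL: "openin X U" "compactin X L" "closedin X L" "C \<subseteq> U" "U \<subseteq> L"
    using locally_compact_space_compact_closed_compact[of X] X assms(3) by blast
  have "closedin X (S \<union> (topspace X - U))" "disjnt C (S \<union> (topspace X - U))"
    using assms UL by (auto simp: disjnt_def)
  moreover have "completely_regular_space X"
    by (simp add: X locally_compact_Hausdorff_imp_regular_space locally_compact_regular_imp_completely_regular_space)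
  ultimately obtain g where g: "continuous_map X (top_of_set {0..1::real}) g"
      "g ` (S \<union> (topspace X - U)) \<subseteq> {0}" "g ` C \<subseteq> {1}"
    using Urysohn_completely_regular_compact_closed[of 0 1 X C] assms(3) by force
  define f where "f x = (if x \<in> topspace X then g x else 0)" for x
  have gc: "continuous_map X euclideanreal g" and g01: "\<And>x. x \<in> topspace X \<Longrightarrow> g x \<in> {0..1}"
    using g(1) by (auto simp: continuous_map_in_subtopology)
  have fc: "continuous_map X euclideanreal f"
    by (rule continuous_map_eq[OF gc]) (simp add: f_def)
  have "f \<in> C0 X"
  proof (rule C0I[OF fc])
    fix \<epsilon> :: real assume "\<epsilon> > 0"
    then have "{x \<in> topspace X. \<epsilon> \<le> norm (f x)} \<subseteq> L"
      using g(2) UL(5) by (force simp: f_def)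
    then show "compactin X {x \<in> topspace X. \<epsilon> \<le> norm (f x)}"
      using closed_compactin[OF UL(2)] closedin_norm_ge[OF fc] by blast
  qed (simp add: f_def)
  moreover have "C \<subseteq> topspace X" using assms(3) compactin_subset_topspace by blast
  moreover have "0 \<le> f x" "f x \<le> 1" for x
    using g01[of x] by (auto simp: f_def)
  moreover have "f x = 0" if "x \<in> S" for x
    using g(2) that by (auto simp: f_def)
  moreover have "f x = 1" if "x \<in> C" for x
    using g(3) that \<open>C \<subseteq> topspace X\<close> by (auto simp: f_def)
  ultimately show thesis
    using that by blast
qed

subsection \<open>The dominating measure of a functional\<close>

text \<open>This replaces a supremum inside a sum by its approximants from below. There are none
  when a = 0, and this case rests on b \<le> c.\<close>

lemma ennreal_add_le_dense:
  fixes a b c :: ennreal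
  assumes "b \<le> c" "\<And>t. t < a \<Longrightarrow> t + b \<le> c" shows "a + b \<le> c"
proof (cases "b = top")
  case True then show ?thesis using assms(1) by (simp add: top_unique)
next
  case False
  have "a \<le> c - b"
  proof (rule dense_le)
    fix t assume "t < a"
    then have "(t + b) - b \<le> c - b" by (intro ennreal_minus_mono assms) auto
    then show "t \<le> c - b" using False by simp
  qed
  then have "a + b \<le> c - b + b" by (rule add_right_mono)
  also have "\<dots> = c" using assms(1) by (rule diff_add_cancel_ennreal)
  finally show ?thesis .
qed

lemma sigma_algebra_borel_sets: "sigma_algebra (topspace X) (borel_sets X)"
  unfolding borel_sets_def by (rule sigma_algebra_sigma_sets) (auto dest: openin_subset)

lemma borel_sets_openin: "openin X U \<Longrightarrow> U \<in> borel_sets X"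
  unfolding borel_sets_def by auto

lemma borel_sets_closedin: 
  assumes "closedin X C" shows "C \<in> borel_sets X"
proof -
  interpret sigma_algebra "topspace X" "borel_sets X" by (rule sigma_algebra_borel_sets)
  have "topspace X - (topspace X - C) \<in> borel_sets X"
    using assms by (intro compl_sets borel_sets_openin) (auto simp: closedin_def)
  then show ?thesis using closedin_subset[OF assms] by (simp add: double_diff)
qed

lemma borel_sets_subset: "A \<in> borel_sets X \<Longrightarrow> A \<subseteq> topspace X"
  unfolding borel_sets_def by (rule sigma_sets_into_sp) (auto dest: openin_subset)

text \<open>Inner regularity is phrased with sigma-compact sets to match regularity of i-measures;
  as the measure is finite, approximation by compact sets follows in
  \<open>radon_compact_approx\<close>.\<close>

definition radon :: "'a topology \<Rightarrow> 'a measure \<Rightarrow> bool" where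
  "radon X N \<longleftrightarrow> finite_measure N \<and> space N = topspace X \<and> sets N = borel_sets X \<and>
     (\<forall>A\<in>borel_sets X. \<exists>K\<subseteq>A. sigma_compactin X K \<and> emeasure N (A - K) = 0)"

lemma ex_unit_phase:
  fixes z :: "'k::real_normed_field"
  obtains c where "norm c = 1" "c * z = of_real (norm z)"
proof (cases "z = 0")
  case True then show ?thesis using that[of 1] by simp
next
  case False
  then show ?thesis using that[of "of_real (norm z) / z"] by (simp add: norm_divide)
qed

text \<open>Here \<open>\<phi>\<close> stands for u \<mapsto> T u v with v fixed, and
  \<open>M\<close> for the norm of T times the norm of v.\<close>

locale C0_functional = banach_over scale
  for scale :: "'k::real_or_complex \<Rightarrow> 'e::banach \<Rightarrow> 'e" +
  fixes X :: "'a topology" and \<phi> :: "('a \<Rightarrow> 'e) \<Rightarrow> 'k" and M :: real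
  assumes locally_compact: "locally_compact_space X" and Hausdorff: "Hausdorff_space X"
    and add: "u \<in> C0 X \<Longrightarrow> w \<in> C0 X \<Longrightarrow> \<phi> (\<lambda>x. u x + w x) = \<phi> u + \<phi> w"
    and homogeneous: "u \<in> C0 X \<Longrightarrow> \<phi> (\<lambda>x. scale c (u x)) = c * \<phi> u"
    and bound: "u \<in> C0 X \<Longrightarrow> (\<And>x. norm (u x) \<le> b) \<Longrightarrow> norm (\<phi> u) \<le> M * b"
begin

lemma zero: "\<phi> (\<lambda>x. 0) = 0"
  using homogeneous[OF C0_zero, of 0] by simp

lemma M_nonneg: "M \<ge> 0"
  using bound[OF C0_zero, of 1] by (simp add: zero)

lemma scaleR: "u \<in> C0 X \<Longrightarrow> \<phi> (\<lambda>x. r *\<^sub>R u x) = r *\<^sub>R \<phi> u"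
  using homogeneous[of u "of_real r"] by (simp add: scale_of_real scaleR_conv_of_real)

lemma diff: "u \<in> C0 X \<Longrightarrow> w \<in> C0 X \<Longrightarrow> \<phi> (\<lambda>x. u x - w x) = \<phi> u - \<phi> w"
  using add[of u "\<lambda>x. (-1) *\<^sub>R w x"] scaleR[of w "-1"] C0_scaleR[of w X "-1"] by simp

lemma sum: "(\<And>i. i \<in> I \<Longrightarrow> u i \<in> C0 X) \<Longrightarrow> \<phi> (\<lambda>x. \<Sum>i\<in>I. u i x) = (\<Sum>i\<in>I. \<phi> (u i))"
  by (induction I rule: infinite_finite_induct) (auto simp: zero add C0_sum)

section \<open>Test functions and the variation of the functional on open sets\<close>

definition tests :: "'a set \<Rightarrow> ('a \<Rightarrow> 'e) set" where
  "tests U = {u\<in>C0 X. (\<forall>x. norm (u x) \<le> 1) \<and> (\<forall>x. x \<notin> U \<longrightarrow> u x = 0)}"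

text \<open>For open U this is the total variation of \<phi> on U. Test functions only have to
  vanish off U; compact support inside U is restored by \<open>lam_approx\<close>.\<close>

definition lam :: "'a set \<Rightarrow> ennreal" where
  "lam U = (SUP u\<in>tests U. ennreal (norm (\<phi> u)))"

definition outer :: "'a set \<Rightarrow> ennreal" where
  "outer A = (INF U\<in>{U. openin X U \<and> A \<subseteq> U}. lam U)"

lemma tests_nonempty: "tests U \<noteq> {}"
  using C0_zero by (force simp: tests_def)

lemma tests_mono: "U \<subseteq> W \<Longrightarrow> tests U \<subseteq> tests W"
  by (auto simp: tests_def)

lemma lam_mono: "U \<subseteq> W \<Longrightarrow> lam U \<le> lam W"
  unfolding lam_def by (rule SUP_subset_mono[OF tests_mono]) auto

lemma lam_upper: "u \<in> tests U \<Longrightarrow> ennreal (norm (\<phi> u)) \<le> lam U"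
  unfolding lam_def by (rule SUP_upper)

lemma lam_le: "lam U \<le> ennreal M"
  unfolding lam_def using bound[of _ 1] by (intro SUP_least ennreal_leI) (auto simp: tests_def)

lemma lam_empty: "lam {} = 0"
proof -
  have "tests {} = {\<lambda>x. 0}" using C0_zero by (auto simp: tests_def)
  then show ?thesis by (simp add: lam_def zero)
qed

lemma lam_bound:
  assumes "u \<in> C0 X" "\<And>x. norm (u x) \<le> b" "\<And>x. x \<notin> U \<Longrightarrow> u x = 0"
  shows "ennreal (norm (\<phi> u)) \<le> ennreal b * lam U"
proof (cases "b = 0")
  case True
  then have "u = (\<lambda>x. 0)" using assms(2) by auto
  then show ?thesis by (simp add: zero)
next
  case False
  then have b: "b > 0" using assms(2)[of undefined] norm_ge_zero[of "u undefined"] by linarith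
  have "(\<lambda>x. (1/b) *\<^sub>R u x) \<in> tests U"
    using assms b C0_scaleR[OF assms(1), of "1/b"] by (auto simp: tests_def field_simps)
  then have "ennreal (norm (\<phi> (\<lambda>x. (1/b) *\<^sub>R u x))) \<le> lam U" by (rule lam_upper)
  then have "ennreal b * ennreal (norm (\<phi> u) / b) \<le> ennreal b * lam U"
    using b by (intro mult_left_mono) (simp_all add: scaleR[OF assms(1)] field_simps)
  then show ?thesis using b by (simp flip: ennreal_mult)
qed

text \<open>Shrinking a test function costs little and makes its support compact.\<close>

lemma lam_approx:
  assumes "t < lam U" "U \<subseteq> topspace X"
  obtains u K where "u \<in> tests K" "compactin X K" "K \<subseteq> U" "t < ennreal (norm (\<phi> u))"
proof -
  obtain w where w: "w \<in> tests U" "t < ennreal (norm (\<phi> w))"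
    using assms(1) unfolding lam_def less_SUP_iff by blast
  have wC: "w \<in> C0 X" using w by (auto simp: tests_def)
  obtain r where r: "t = ennreal r" "r \<ge> 0" using w(2) by (cases t) auto
  then have lt: "r < norm (\<phi> w)" using w(2) by (simp add: ennreal_less_iff)
  \<comment> \<open>Replacing w by its shrunken version changes \<phi> by at most M * \<delta>,
    which is at most half of the gap between r and the norm of \<phi> w. The summand 1 keeps the
    divisor positive when M = 0.\<close>
  define \<delta> where "\<delta> = (norm (\<phi> w) - r) / (2 * (M + 1))"
  have d: "\<delta> > 0" using lt M_nonneg by (simp add: \<delta>_def)
  have "M * \<delta> \<le> (M + 1) * \<delta>" using d by simp
  also have "\<dots> = (norm (\<phi> w) - r) / 2" using M_nonneg by (simp add: \<delta>_def field_simps)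
  finally have Md: "M * \<delta> \<le> (norm (\<phi> w) - r) / 2" .
  define u where "u x = shrink \<delta> (w x)" for x
  have uC: "u \<in> C0 X" unfolding u_def by (rule C0_shrink[OF wC d])
  have "norm (\<phi> (\<lambda>x. w x - u x)) \<le> M * \<delta>"
    by (rule bound[OF C0_diff[OF wC uC]]) (simp add: u_def norm_diff_shrink_le[OF d])
  then have "norm (\<phi> w - \<phi> u) \<le> M * \<delta>" by (simp add: diff wC uC)
  then have *: "r < norm (\<phi> u)" using Md lt norm_triangle_sub[of "\<phi> w" "\<phi> u"] by argo
  define K where "K = {x\<in>topspace X. \<delta> \<le> norm (w x)}"
  have uK: "u \<in> tests K"
    unfolding tests_def
  proof (intro CollectI conjI allI impI uC)
    show "norm (u x) \<le> 1" for x
      using norm_shrink_le[OF d, of "w x"] w(1) by (auto simp: u_def tests_def intro: order_trans)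
    show "u x = 0" if "x \<notin> K" for x
      using that C0_outside[OF wC, of x] d by (auto simp: u_def K_def intro!: shrink_eq_0)
  qed
  have KU: "K \<subseteq> U"
  proof
    fix x assume "x \<in> K"
    then have "w x \<noteq> 0" using d by (auto simp: K_def)
    then show "x \<in> U" using w(1) by (auto simp: tests_def)
  qed
  show thesis
    using that[OF uK _ KU] * r C0_compactin[OF wC d] by (auto simp: K_def ennreal_less_iff)
qed

text \<open>Since K \<subseteq> U \<union> W, the closed sets K - W and K - U are disjoint. A
  function f that is 1 on the first and 0 on the second splits u into f u, which vanishes off U, and
  (1 - f) u, which vanishes off W.\<close>

lemma lam_Un:
  assumes "openin X U" "openin X W" shows "lam (U \<union> W) \<le> lam U + lam W"
proof (rule dense_le)
  fix t assume "t < lam (U \<union> W)"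
  then obtain u K where u: "u \<in> tests K" "compactin X K" "K \<subseteq> U \<union> W" "t < ennreal (norm (\<phi> u))"
    using lam_approx[of t "U \<union> W"] assms[THEN openin_subset] by auto
  have Kc: "closedin X K" using compactin_imp_closedin[OF Hausdorff u(2)] .
  have cl: "closedin X (K - W)" "closedin X (K - U)" using Kc assms by (auto intro: closedin_diff)
  have "compactin X (K - W)" using closed_compactin[OF u(2) _ cl(1)] by blast
  then obtain f :: "'a \<Rightarrow> real" where f: "f \<in> C0 X" "\<And>x. 0 \<le> f x" "\<And>x. f x \<le> 1"
      "\<And>x. x \<in> K - W \<Longrightarrow> f x = 1" "\<And>x. x \<in> K - U \<Longrightarrow> f x = 0"
    using C0_Urysohn[OF locally_compact Hausdorff _ cl(2), of "K - W"] u(3) by blast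
  have uC: "u \<in> C0 X" and u1: "\<And>x. norm (u x) \<le> 1" and u0: "\<And>x. x \<notin> K \<Longrightarrow> u x = 0"
    using u(1) by (auto simp: tests_def)
  have fu: "(\<lambda>x. f x *\<^sub>R u x) \<in> C0 X"
    using f by (intro C0_mult_bounded[OF uC C0_continuous]) auto
  have gu: "(\<lambda>x. (1 - f x) *\<^sub>R u x) \<in> C0 X"
    using C0_diff[OF uC fu] by (simp add: scaleR_left_diff_distrib)
  have "f x *\<^sub>R u x = 0" if "x \<notin> U" for x
    using f(5)[of x] u0[of x] that by auto
  then have "(\<lambda>x. f x *\<^sub>R u x) \<in> tests U"
    using fu f(2,3) u1 by (auto simp: tests_def mult_le_one)
  moreover have "(1 - f x) *\<^sub>R u x = 0" if "x \<notin> W" for x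
    using f(4)[of x] u0[of x] that by auto
  then have "(\<lambda>x. (1 - f x) *\<^sub>R u x) \<in> tests W"
    using gu f(2,3) u1 by (auto simp: tests_def mult_le_one)
  moreover have "\<phi> u = \<phi> (\<lambda>x. f x *\<^sub>R u x) + \<phi> (\<lambda>x. (1 - f x) *\<^sub>R u x)"
    using add[OF fu gu] by (simp flip: scaleR_left_distrib)
  then have "ennreal (norm (\<phi> u)) \<le>
      ennreal (norm (\<phi> (\<lambda>x. f x *\<^sub>R u x))) + ennreal (norm (\<phi> (\<lambda>x. (1 - f x) *\<^sub>R u x)))"
    by (simp add: norm_triangle_ineq ennreal_leI flip: ennreal_plus)
  ultimately show "t \<le> lam U + lam W"
    using lam_upper add_mono u(4) by (meson less_imp_le order_trans)
qed

lemma lam_UN_finite: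
  fixes U :: "nat \<Rightarrow> 'a set"
  assumes "\<And>i. openin X (U i)" shows "lam (\<Union>i<n. U i) \<le> (\<Sum>i<n. lam (U i))"
proof (induction n)
  case 0 show ?case by (simp add: lam_empty)
next
  case (Suc n)
  have "lam (\<Union>i<Suc n. U i) = lam ((\<Union>i<n. U i) \<union> U n)" by (simp add: lessThan_Suc Un_commute)
  also have "\<dots> \<le> lam (\<Union>i<n. U i) + lam (U n)" using assms by (intro lam_Un) auto
  also have "\<dots> \<le> (\<Sum>i<Suc n. lam (U i))" using Suc by (simp add: add_right_mono)
  finally show ?case .
qed

text \<open>Finitely many of the open sets already cover the compact set K carrying an almost
  optimal test function, so the finite case bounds each approximant of the supremum.\<close>

lemma lam_UN:
  fixes U :: "nat \<Rightarrow> 'a set"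
  assumes "\<And>i. openin X (U i)" shows "lam (\<Union>i. U i) \<le> (\<Sum>i. lam (U i))"
proof (rule dense_le)
  fix t assume "t < lam (\<Union>i. U i)"
  then obtain u K where u: "u \<in> tests K" "compactin X K" "K \<subseteq> (\<Union>i. U i)" "t < ennreal (norm (\<phi> u))"
    by (rule lam_approx) (use assms[THEN openin_subset] in blast)
  obtain F where F: "finite F" "F \<subseteq> range U" "K \<subseteq> \<Union>F"
    using compactinD[OF u(2), of "range U"] u(3) assms by auto
  then obtain J where J: "finite J" "F = U ` J" using finite_subset_image by metis
  then obtain n where n: "J \<subseteq> {..<n}" using finite_nat_iff_bounded by blast
  have "K \<subseteq> (\<Union>i<n. U i)" using F(3) J(2) n by auto
  then have "u \<in> tests (\<Union>i<n. U i)" using u(1) tests_mono by blast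
  then have "t \<le> lam (\<Union>i<n. U i)" using lam_upper u(4) by (meson less_imp_le order_trans)
  also have "\<dots> \<le> (\<Sum>i<n. lam (U i))" by (rule lam_UN_finite[OF assms])
  also have "\<dots> \<le> (\<Sum>i. lam (U i))" by (intro sum_le_suminf) auto
  finally show "t \<le> (\<Sum>i. lam (U i))" .
qed

text \<open>At each point at most one of u and w is nonzero, so both can be rotated by their own
  phases and added without leaving the unit ball; the two norms then add up in a single value of
  \<phi>.\<close>

lemma lam_disjoint:
  assumes "u \<in> tests K" "K \<subseteq> U"
  shows "ennreal (norm (\<phi> u)) + lam (U - K) \<le> lam U"
proof -
  have "ennreal (norm (\<phi> u)) + ennreal (norm (\<phi> w)) \<le> lam U" if w: "w \<in> tests (U - K)" for w
  proof -
    obtain c d :: 'k where c: "norm c = 1" "c * \<phi> u = of_real (norm (\<phi> u))"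
      and d: "norm d = 1" "d * \<phi> w = of_real (norm (\<phi> w))"
      using ex_unit_phase by metis
    have uC: "u \<in> C0 X" and wC: "w \<in> C0 X" using assms w by (auto simp: tests_def)
    define v where "v x = scale c (u x) + scale d (w x)" for x
    have vC: "v \<in> C0 X" unfolding v_def by (intro C0_add C0_scale uC wC)
    have "norm (v x) \<le> 1" for x
    proof (cases "x \<in> K")
      case True
      then have "v x = scale c (u x)" using w by (simp add: v_def tests_def)
      then show ?thesis using assms(1) by (simp add: norm_scale c tests_def)
    next
      case False
      then have "v x = scale d (w x)" using assms(1) by (simp add: v_def tests_def)
      then show ?thesis using w by (simp add: norm_scale d tests_def)
    qed
    moreover have "v x = 0" if "x \<notin> U" for x
      using that assms w by (auto simp: v_def tests_def subset_iff)
    ultimately have "v \<in> tests U" using vC by (simp add: tests_def)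
    moreover have "\<phi> v = of_real (norm (\<phi> u) + norm (\<phi> w))"
      unfolding v_def by (simp add: add homogeneous C0_scale uC wC c d)
    then have "norm (\<phi> v) = norm (\<phi> u) + norm (\<phi> w)"
      by (metis abs_of_nonneg add_nonneg_nonneg norm_ge_zero norm_of_real)
    ultimately show ?thesis using lam_upper[of v U] by simp
  qed
  then have "(SUP w\<in>tests (U - K). ennreal (norm (\<phi> w)) + ennreal (norm (\<phi> u))) \<le> lam U"
    by (intro SUP_least) (simp add: add.commute)
  then show ?thesis
    by (simp add: lam_def ennreal_SUP_add_left tests_nonempty add.commute)
qed

section \<open>The outer measure and the measurability of Borel sets\<close>

lemma outer_open: "openin X U \<Longrightarrow> outer U = lam U"
  unfolding outer_def by (intro antisym INF_lower INF_greatest) (auto intro: lam_mono)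

lemma outer_le: "openin X U \<Longrightarrow> A \<subseteq> U \<Longrightarrow> outer A \<le> lam U"
  unfolding outer_def by (intro INF_lower) auto

lemma outer_mono: "A \<subseteq> B \<Longrightarrow> outer A \<le> outer B"
  unfolding outer_def by (rule INF_superset_mono) auto

lemma outer_top: "A \<subseteq> topspace X \<Longrightarrow> outer A \<le> ennreal M"
  using outer_le[of "topspace X" A] lam_le by (meson openin_topspace order_trans)

lemma outer_approx:
  assumes "A \<subseteq> topspace X" "e > 0"
  obtains U where "openin X U" "A \<subseteq> U" "lam U \<le> outer A + ennreal e"
proof -
  have "outer A \<noteq> top"
    using outer_top[OF assms(1)] by (auto simp: top_unique)
  then have "outer A < outer A + ennreal e"
    using assms(2) by (simp add: ennreal_less_iff less_top)
  then show thesis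
    using that unfolding outer_def INF_less_iff by (auto intro: less_imp_le)
qed

lemma outer_measure_space_outer: "outer_measure_space (Pow (topspace X)) outer"
  unfolding outer_measure_space_def
proof (intro conjI)
  show "positive (Pow (topspace X)) outer"
    by (simp add: positive_def outer_open lam_empty)
  show "increasing (Pow (topspace X)) outer"
    by (simp add: increasing_def outer_mono)
  show "countably_subadditive (Pow (topspace X)) outer"
    unfolding countably_subadditive_def
  proof (intro allI impI)
    fix A :: "nat \<Rightarrow> 'a set" assume A: "range A \<subseteq> Pow (topspace X)"
    show "outer (\<Union>i. A i) \<le> (\<Sum>i. outer (A i))"
    proof (rule ennreal_le_epsilon)
      fix e :: real assume e: "e > 0"
      have "\<exists>U. openin X U \<and> A i \<subseteq> U \<and> lam U \<le> outer (A i) + ennreal (e * (1/2) ^ Suc i)" for i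
        by (rule outer_approx[of "A i" "e * (1/2) ^ Suc i"]) (use A e in auto)
      then obtain U where U: "\<And>i. openin X (U i)" "\<And>i. A i \<subseteq> U i"
          "\<And>i. lam (U i) \<le> outer (A i) + ennreal (e * (1/2) ^ Suc i)"
        by metis
      have "outer (\<Union>i. A i) \<le> lam (\<Union>i. U i)" using U by (intro outer_le) auto
      also have "\<dots> \<le> (\<Sum>i. lam (U i))" by (rule lam_UN[OF U(1)])
      also have "\<dots> \<le> (\<Sum>i. outer (A i) + ennreal (e * (1/2) ^ Suc i))"
        by (intro suminf_le U(3)) auto
      also have "\<dots> = (\<Sum>i. outer (A i)) + (\<Sum>i. ennreal (e * (1/2) ^ Suc i))"
        by (rule suminf_add[symmetric]) auto
      also have "(\<Sum>i. ennreal (e * (1/2) ^ Suc i)) = ennreal e"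
        using e sums_mult[OF power_half_series, of e] by (intro suminf_ennreal_eq) auto
      finally show "outer (\<Union>i. A i) \<le> (\<Sum>i. outer (A i)) + ennreal e" .
    qed
  qed
qed

text \<open>This is Caratheodory's criterion. Its nontrivial half enlarges A to an open U and
  exhausts \<open>lam (U \<inter> W)\<close> by test functions living on compact sets, to which
  \<open>lam_disjoint\<close> applies.\<close>

lemma openin_lambda_system:
  assumes W: "openin X W" shows "W \<in> lambda_system (topspace X) (Pow (topspace X)) outer"
proof -
  interpret P: sigma_algebra "topspace X" "Pow (topspace X)" by (rule sigma_algebra_Pow)
  have le: "outer (A \<inter> W) + outer (A - W) \<le> outer A" if A: "A \<subseteq> topspace X" for A
    unfolding outer_def[of A]
  proof (rule INF_greatest, clarsimp)
    fix U assume U: "openin X U" "A \<subseteq> U"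
    have UW: "openin X (U \<inter> W)" using U W by blast
    have "lam (U \<inter> W) + outer (U - W) \<le> lam U"
    proof (rule ennreal_add_le_dense)
      show "outer (U - W) \<le> lam U" by (rule outer_le[OF U(1)]) auto
      fix t assume "t < lam (U \<inter> W)"
      then obtain u K where u: "u \<in> tests K" "compactin X K" "K \<subseteq> U \<inter> W" "t < ennreal (norm (\<phi> u))"
        using lam_approx[of t "U \<inter> W"] openin_subset[OF UW] by blast
      \<comment> \<open>U - W need not be open, but U - K is, since compact sets are closed here,
        and it contains U - W.\<close>
      have "openin X (U - K)" using U(1) compactin_imp_closedin[OF Hausdorff u(2)] by blast
      then have "outer (U - W) \<le> lam (U - K)" using u(3) by (intro outer_le) auto
      then have "t + outer (U - W) \<le> ennreal (norm (\<phi> u)) + lam (U - K)"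
        using u(4) by (intro add_mono) auto
      also have "\<dots> \<le> lam U" by (rule lam_disjoint[OF u(1)]) (use u in auto)
      finally show "t + outer (U - W) \<le> lam U" .
    qed
    moreover have "outer (A \<inter> W) \<le> lam (U \<inter> W)" using U by (intro outer_le UW) auto
    moreover have "outer (A - W) \<le> outer (U - W)" using U by (intro outer_mono) auto
    ultimately show "outer (A \<inter> W) + outer (A - W) \<le> lam U"
      by (meson add_mono order_trans)
  qed
  have ge: "outer A \<le> outer (A \<inter> W) + outer (A - W)" if A: "A \<subseteq> topspace X" for A
  proof (rule ennreal_le_epsilon)
    fix e :: real assume e: "e > 0"
    obtain U where U: "openin X U" "A \<inter> W \<subseteq> U" "lam U \<le> outer (A \<inter> W) + ennreal (e/2)"
      by (rule outer_approx[of "A \<inter> W" "e/2"]) (use A e in auto)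
    obtain V where V: "openin X V" "A - W \<subseteq> V" "lam V \<le> outer (A - W) + ennreal (e/2)"
      by (rule outer_approx[of "A - W" "e/2"]) (use A e in auto)
    have "outer A \<le> lam (U \<union> V)" using U V by (intro outer_le) auto
    also have "\<dots> \<le> lam U + lam V" using U V by (intro lam_Un)
    also have "\<dots> \<le> (outer (A \<inter> W) + ennreal (e/2)) + (outer (A - W) + ennreal (e/2))"
      using U V by (intro add_mono)
    also have "\<dots> = outer (A \<inter> W) + outer (A - W) + (ennreal (e/2) + ennreal (e/2))"
      by (simp add: ac_simps)
    also have "ennreal (e/2) + ennreal (e/2) = ennreal e" using e by (simp flip: ennreal_plus)
    finally show "outer A \<le> outer (A \<inter> W) + outer (A - W) + ennreal e" .
  qed
  show ?thesis
    unfolding P.lambda_system_eq using openin_subset[OF W] le ge by (auto intro: antisym)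
qed

definition dominating_measure :: "'a measure" where
  "dominating_measure = measure_of (topspace X) (borel_sets X) outer"

lemma dominating_measure:
  shows space_dominating: "space dominating_measure = topspace X"
    and sets_dominating: "sets dominating_measure = borel_sets X"
    and emeasure_dominating: "A \<in> borel_sets X \<Longrightarrow> emeasure dominating_measure A = outer A"
proof -
  let ?L = "lambda_system (topspace X) (Pow (topspace X)) outer"
  interpret P: sigma_algebra "topspace X" "Pow (topspace X)" by (rule sigma_algebra_Pow)
  interpret B: sigma_algebra "topspace X" "borel_sets X" by (rule sigma_algebra_borel_sets)
  have L: "measure_space (topspace X) ?L outer"
    by (rule P.caratheodory_lemma[OF outer_measure_space_outer])
  then interpret L: sigma_algebra "topspace X" ?L by (simp add: measure_space_def)
  have sub: "borel_sets X \<subseteq> ?L"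
    unfolding borel_sets_def by (rule L.sigma_sets_subset) (auto intro: openin_lambda_system)
  have "countably_additive (borel_sets X) outer"
    using L sub by (auto simp: measure_space_def countably_additive_def)
  moreover have "positive (borel_sets X) outer"
    using L by (simp add: measure_space_def positive_def)
  moreover have "borel_sets X \<subseteq> Pow (topspace X)" using B.space_closed .
  ultimately show "space dominating_measure = topspace X" "sets dominating_measure = borel_sets X"
      "A \<in> borel_sets X \<Longrightarrow> emeasure dominating_measure A = outer A"
    unfolding dominating_measure_def
    by (simp_all add: space_measure_of sets_measure_of B.sigma_sets_eq B.sigma_algebra_axioms
        emeasure_measure_of_sigma)
qed

section \<open>Finiteness and inner regularity of the dominating measure\<close>

lemma emeasure_dominating_le: "emeasure dominating_measure (topspace X) \<le> ennreal M"
  using emeasure_dominating[of "topspace X"] outer_top[of "topspace X"]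
  by (simp add: borel_sets_openin)

lemma finite_measure_dominating: "finite_measure dominating_measure"
  using emeasure_dominating_le by (intro finite_measureI) (auto simp: space_dominating top_unique)

text \<open>A single test function on a compact K attains nearly the whole mass, and by
  \<open>lam_disjoint\<close> little is left for the complement of K.\<close>

lemma compact_exhaustion:
  assumes "e > 0" obtains K where "compactin X K" "outer (topspace X - K) \<le> ennreal e"
proof (cases "lam (topspace X) = 0")
  \<comment> \<open>If the mass is 0, nothing lies strictly below it to approximate from, and the
    empty set serves.\<close>
  case True
  then show ?thesis using that[of "{}"] by (simp add: outer_open)
next
  case False
  let ?a = "lam (topspace X)"
  have fin: "?a < top" using lam_le[of "topspace X"] by (auto simp: less_top[symmetric] top_unique)
  have "?a - ennreal e < ?a"
    using False assms fin by (intro ennreal_between) (auto simp: zero_less_iff_neq_zero)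
  then obtain u K where u: "u \<in> tests K" "compactin X K" "K \<subseteq> topspace X" "?a - ennreal e < ennreal (norm (\<phi> u))"
    by (rule lam_approx) auto
  have "openin X (topspace X - K)" using compactin_imp_closedin[OF Hausdorff u(2)] by blast
  then have *: "outer (topspace X - K) = lam (topspace X - K)" by (rule outer_open)
  have "ennreal (norm (\<phi> u)) + lam (topspace X - K) \<le> ?a" by (rule lam_disjoint[OF u(1,3)])
  also have "?a \<le> (?a - ennreal e) + ennreal e" by (auto simp: diff_add_self_ennreal)
  also have "\<dots> \<le> ennreal (norm (\<phi> u)) + ennreal e" using u(4) by (intro add_right_mono) auto
  finally have "lam (topspace X - K) \<le> ennreal e"
    by (simp add: ennreal_add_left_cancel_le)
  then show ?thesis using that[OF u(2)] * by simp
qed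

text \<open>Outer regularity of the complement of A gives an open U that barely exceeds it, and some
  compact L carries nearly all the mass. Then L - U is compact, lies in A, and misses only the
  excess of U and the mass off L.\<close>

lemma radon_dominating: "radon X dominating_measure"
  unfolding radon_def
proof (intro conjI ballI finite_measure_dominating space_dominating sets_dominating)
  interpret finite_measure dominating_measure by (rule finite_measure_dominating)
  interpret B: sigma_algebra "topspace X" "borel_sets X" by (rule sigma_algebra_borel_sets)
  let ?N = dominating_measure
  fix A assume A: "A \<in> borel_sets X"
  have cpt: "\<exists>K. compactin X K \<and> K \<subseteq> A \<and> emeasure ?N (A - K) \<le> ennreal e" if e: "e > 0" for e :: real
  proof -
    have Ac: "topspace X - A \<in> borel_sets X" using A by blast
    obtain U where U: "openin X U" "topspace X - A \<subseteq> U" "lam U \<le> outer (topspace X - A) + ennreal (e/2)"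
      using outer_approx[of "topspace X - A" "e/2"] e by auto
    obtain L where L: "compactin X L" "outer (topspace X - L) \<le> ennreal (e/2)"
      using compact_exhaustion[of "e/2"] e by auto
    define K where "K = L - U"
    have clL: "closedin X L" by (rule compactin_imp_closedin[OF Hausdorff L(1)])
    have Kc: "compactin X K" using closed_compactin[OF L(1)] clL U(1) by (auto simp: K_def)
    have KA: "K \<subseteq> A" using U(2) compactin_subset_topspace[OF L(1)] by (auto simp: K_def)
    have UB: "U \<in> borel_sets X" "topspace X - L \<in> borel_sets X"
      using U(1) clL by (auto intro!: borel_sets_openin)
    have "emeasure ?N (U - (topspace X - A)) = emeasure ?N U - emeasure ?N (topspace X - A)"
      using UB Ac U(2) by (intro emeasure_Diff) (auto simp: sets_dominating)
    also have "\<dots> \<le> ennreal (e/2)"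
      using U UB Ac outer_top[of "topspace X - A"]
      by (auto simp: emeasure_dominating outer_open ennreal_minus_le_iff top_unique)
    finally have 1: "emeasure ?N (U - (topspace X - A)) \<le> ennreal (e/2)" .
    have "A - K \<subseteq> (U - (topspace X - A)) \<union> (topspace X - L)"
      using borel_sets_subset[OF A] by (auto simp: K_def)
    then have "emeasure ?N (A - K) \<le> emeasure ?N ((U - (topspace X - A)) \<union> (topspace X - L))"
      using UB Ac by (intro emeasure_mono) (auto simp: sets_dominating)
    also have "\<dots> \<le> emeasure ?N (U - (topspace X - A)) + emeasure ?N (topspace X - L)"
      using UB Ac by (intro emeasure_subadditive) (auto simp: sets_dominating)
    also have "\<dots> \<le> ennreal (e/2) + ennreal (e/2)"
      using 1 L(2) UB by (intro add_mono) (auto simp: emeasure_dominating)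
    also have "\<dots> = ennreal e" using e by (simp flip: ennreal_plus)
    finally show ?thesis using Kc KA by blast
  qed
  have "\<exists>K. compactin X K \<and> K \<subseteq> A \<and> emeasure ?N (A - K) \<le> ennreal (1 / Suc n)" for n :: nat
    using cpt[of "1 / Suc n"] by simp
  then obtain C :: "nat \<Rightarrow> 'a set" where C: "\<And>n. compactin X (C n)" "\<And>n. C n \<subseteq> A"
      "\<And>n. emeasure ?N (A - C n) \<le> ennreal (1 / Suc n)"
    by metis
  have CB: "C n \<in> borel_sets X" for n
    by (rule borel_sets_closedin[OF compactin_imp_closedin[OF Hausdorff C(1)]])
  show "\<exists>K\<subseteq>A. sigma_compactin X K \<and> emeasure ?N (A - K) = 0"
  proof (intro exI[of _ "\<Union>n. C n"] conjI)
    show "sigma_compactin X (\<Union>n. C n)" using C(1) by (auto simp: sigma_compactin_def)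
    have "emeasure ?N (A - (\<Union>n. C n)) \<le> 0"
    proof (rule ennreal_le_epsilon)
      fix e :: real assume "e > 0"
      then obtain n where n: "1 / real (Suc n) < e" using nat_approx_posE by blast
      have "emeasure ?N (A - (\<Union>n. C n)) \<le> emeasure ?N (A - C n)"
        using A CB by (intro emeasure_mono) (auto simp: sets_dominating)
      also have "\<dots> \<le> ennreal e" using C(3)[of n] n by (meson ennreal_leI less_imp_le order_trans)
      finally show "emeasure ?N (A - (\<Union>n. C n)) \<le> 0 + ennreal e" by simp
    qed
    then show "emeasure ?N (A - (\<Union>n. C n)) = 0" by simp
  qed (use C in auto)
qed

end

subsection \<open>The vector measure representing a functional\<close>

definition cutoffs :: "'a topology \<Rightarrow> 'a set \<Rightarrow> 'a set \<Rightarrow> ('a \<Rightarrow> real) set" where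
  "cutoffs X C D = {f\<in>C0 X. (\<forall>x. 0 \<le> f x \<and> f x \<le> 1) \<and> (\<forall>x\<in>C. f x = 1) \<and> (\<forall>x\<in>D. f x = 0)}"

text \<open>
  The filter does not refer to any measure: the same net of functions approximates the indicator
  function of \<open>A\<close> with respect to all Radon measures at once.
\<close>

definition cutoff_filter :: "'a topology \<Rightarrow> 'a set \<Rightarrow> ('a \<Rightarrow> real) filter" where
  "cutoff_filter X A =
     (INF P\<in>{P. compactin X (fst P) \<and> fst P \<subseteq> A \<and> compactin X (snd P) \<and> snd P \<inter> A = {}}.
        principal (cutoffs X (fst P) (snd P)))"

text \<open>The pairs of compact sets are directed under componentwise union, so the principal
  filters form a base.\<close>

lemma eventually_cutoff_filter:
  "eventually P (cutoff_filter X A) \<longleftrightarrow>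
     (\<exists>C D. compactin X C \<and> C \<subseteq> A \<and> compactin X D \<and> D \<inter> A = {} \<and> (\<forall>f\<in>cutoffs X C D. P f))"
proof -
  let ?I = "{P. compactin X (fst P) \<and> fst P \<subseteq> A \<and> compactin X (snd P) \<and> snd P \<inter> A = {}}"
  have "eventually P (cutoff_filter X A) \<longleftrightarrow> (\<exists>b\<in>?I. eventually P (principal (cutoffs X (fst b) (snd b))))"
    unfolding cutoff_filter_def
  proof (rule eventually_INF_base)
    have "({}, {}) \<in> ?I" by simp
    then show "?I \<noteq> {}" by blast
    fix a b assume "a \<in> ?I" "b \<in> ?I"
    then have "(fst a \<union> fst b, snd a \<union> snd b) \<in> ?I" by (auto intro: compactin_Un)
    then show "\<exists>x\<in>?I. principal (cutoffs X (fst x) (snd x)) \<le>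
        inf (principal (cutoffs X (fst a) (snd a))) (principal (cutoffs X (fst b) (snd b)))"
      by (rule bexI[rotated]) (auto simp: cutoffs_def)
  qed
  then show ?thesis by (force simp: eventually_principal)
qed

text \<open>Urysohn's lemma inhabits every basic set. Uniqueness of limits along the filter depends
  on this.\<close>

lemma cutoff_filter_not_bot:
  assumes "locally_compact_space X" "Hausdorff_space X" shows "cutoff_filter X A \<noteq> bot"
proof
  assume "cutoff_filter X A = bot"
  then have "eventually (\<lambda>_. False) (cutoff_filter X A)" by simp
  then obtain C D where "compactin X C" "C \<subseteq> A" "compactin X D" "D \<inter> A = {}"
    and empty: "cutoffs X C D = {}"
    unfolding eventually_cutoff_filter by blast
  then obtain f :: "'a \<Rightarrow> real" where "f \<in> C0 X" "\<And>x. 0 \<le> f x" "\<And>x. f x \<le> 1"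
      "\<And>x. x \<in> C \<Longrightarrow> f x = 1" "\<And>x. x \<in> D \<Longrightarrow> f x = 0"
    using C0_Urysohn[OF assms, of C D] compactin_imp_closedin[OF assms(2), of D] by blast
  then have "f \<in> cutoffs X C D" by (simp add: cutoffs_def)
  then show False using empty by blast
qed

lemma eventually_cutoff_C0:
  "eventually (\<lambda>f. f \<in> C0 X \<and> (\<forall>x. 0 \<le> f x \<and> f x \<le> 1)) (cutoff_filter X A)"
  unfolding eventually_cutoff_filter by (intro exI[of _ "{}"]) (auto simp: cutoffs_def)

text \<open>The remainders of A after removing finite unions of the compact pieces of K decrease to
  the null set A - K, and a finite measure is continuous from above.\<close>

lemma radon_compact_approx:
  assumes "radon X N" "Hausdorff_space X" "A \<in> borel_sets X" "e > 0"
  obtains C where "compactin X C" "C \<subseteq> A" "measure N (A - C) < e"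
proof -
  interpret finite_measure N using assms(1) by (simp add: radon_def)
  have sets: "sets N = borel_sets X" using assms(1) by (simp add: radon_def)
  obtain K where K: "K \<subseteq> A" "sigma_compactin X K" "emeasure N (A - K) = 0"
    using assms(1,3) unfolding radon_def by blast
  then obtain C :: "nat \<Rightarrow> 'a set" where C: "\<And>n. compactin X (C n)" "K = (\<Union>n. C n)"
    by (auto simp: sigma_compactin_def)
  have CB: "C n \<in> sets N" for n
    unfolding sets by (rule borel_sets_closedin[OF compactin_imp_closedin[OF assms(2) C(1)]])
  define R where "R n = A - (\<Union>i<n. C i)" for n
  have "range R \<subseteq> sets N" using CB assms(3) by (auto simp: R_def sets[symmetric])
  moreover have "decseq R" unfolding R_def decseq_def by (auto dest: less_le_trans)
  ultimately have "(\<lambda>n. measure N (R n)) \<longlonglongrightarrow> measure N (\<Inter>n. R n)"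
    by (rule finite_Lim_measure_decseq)
  moreover have "(\<Inter>n. R n) = A - K" by (force simp: R_def C(2))
  moreover have "measure N (A - K) = 0" using K(3) by (simp add: measure_def)
  ultimately have "eventually (\<lambda>n. measure N (R n) < e) sequentially"
    using assms(4) by (auto intro: order_tendstoD)
  then obtain n where n: "measure N (R n) < e" by (auto simp: eventually_sequentially)
  show thesis
  proof (rule that)
    show "compactin X (\<Union>i<n. C i)" using C(1) by (intro compactin_Union) auto
    show "(\<Union>i<n. C i) \<subseteq> A" using K(1) C(2) by auto
    show "measure N (A - (\<Union>i<n. C i)) < e" using n by (simp add: R_def)
  qed
qed

text \<open>Compact subsets of A and of its complement carry all but e of the mass, and every cutoff
  for this pair equals the indicator on both. Only the choice of the pair depends on the
  measure.\<close>

lemma eventually_cutoff_radon: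
  assumes "radon X N" "Hausdorff_space X" "A \<in> borel_sets X" "e > 0"
  shows "eventually (\<lambda>f. \<exists>B\<in>borel_sets X. measure N B < e \<and> (\<forall>x\<in>topspace X - B. f x = indicator A x))
    (cutoff_filter X A)"
proof -
  interpret finite_measure N using assms(1) by (simp add: radon_def)
  have sets: "sets N = borel_sets X" using assms(1) by (simp add: radon_def)
  interpret B: sigma_algebra "topspace X" "borel_sets X" by (rule sigma_algebra_borel_sets)
  let ?A' = "topspace X - A"
  obtain C where C: "compactin X C" "C \<subseteq> A" "measure N (A - C) < e/2"
    by (rule radon_compact_approx[OF assms(1-3), of "e/2"]) (use assms(4) in auto)
  obtain D where D: "compactin X D" "D \<subseteq> ?A'" "measure N (?A' - D) < e/2"
    by (rule radon_compact_approx[OF assms(1,2), of ?A' "e/2"]) (use assms(3,4) in auto)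
  have CD: "C \<in> borel_sets X" "D \<in> borel_sets X"
    using C(1) D(1) by (auto intro!: borel_sets_closedin compactin_imp_closedin assms(2))
  define B where "B = (A - C) \<union> (?A' - D)"
  have B: "B \<in> borel_sets X" using assms(3) CD by (auto simp: B_def)
  have "measure N B \<le> measure N (A - C) + measure N (?A' - D)"
    unfolding B_def using assms(3) CD by (intro measure_Un_le) (auto simp: sets)
  then have "measure N B < e" using C(3) D(3) by simp
  moreover have "f x = indicator A x" if "f \<in> cutoffs X C D" "x \<in> topspace X - B" for f x
    using that C(2) D(2) by (auto simp: cutoffs_def B_def indicator_def)
  ultimately show ?thesis
    unfolding eventually_cutoff_filter using C(1,2) D(1,2) B
    by (intro exI[of _ C] exI[of _ D]) auto
qed

section \<open>Limits along the cutoffs\<close>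

context C0_functional
begin

abbreviation N :: "'a measure" where "N \<equiv> dominating_measure"

sublocale N: finite_measure N
  by (rule finite_measure_dominating)

sublocale borel: sigma_algebra "topspace X" "borel_sets X"
  by (rule sigma_algebra_borel_sets)

lemma measure_N_le: "A \<in> borel_sets X \<Longrightarrow> measure N A \<le> M"
proof -
  assume A: "A \<in> borel_sets X"
  have "emeasure N A \<le> ennreal M"
    using emeasure_dominating[OF A] outer_top borel_sets_subset[OF A] by simp
  then show ?thesis by (simp add: N.emeasure_eq_measure M_nonneg)
qed

text \<open>Removing the part of u of norm at most d costs d M. The shrunken remainder vanishes off
  the open set where the norm of u exceeds d; this set lies in B, and there \<open>lam\<close>
  controls \<phi>.\<close>

lemma norm_le_measure:
  assumes u: "u \<in> C0 X" "\<And>x. norm (u x) \<le> c" and B: "B \<in> borel_sets X"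
    and d: "d \<ge> 0" "\<And>x. x \<in> topspace X - B \<Longrightarrow> norm (u x) \<le> d"
  shows "norm (\<phi> u) \<le> d * M + c * measure N B"
proof -
  have c: "c \<ge> 0" using u(2)[of undefined] norm_ge_zero order_trans by blast
  \<comment> \<open>\<open>shrink\<close> needs a positive radius, whereas the case d = 0 is wanted
    as well.\<close>
  have *: "norm (\<phi> u) \<le> (d + e) * M + c * measure N B" if e: "e > 0" for e
  proof -
    define w where "w x = shrink (d + e) (u x)" for x
    have de: "d + e > 0" using d e by simp
    have w: "w \<in> C0 X" unfolding w_def by (rule C0_shrink[OF u(1) de])
    define U where "U = {x\<in>topspace X. norm (u x) > d + e}"
    have U: "openin X U" unfolding U_def by (rule openin_norm_gt[OF C0_continuous[OF u(1)]])
    have UB: "U \<subseteq> B"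
    proof
      fix x assume "x \<in> U"
      then have "x \<in> topspace X" "\<not> norm (u x) \<le> d" using e by (auto simp: U_def)
      then show "x \<in> B" using d(2)[of x] by blast
    qed
    have "norm (\<phi> (\<lambda>x. u x - w x)) \<le> M * (d + e)"
      by (rule bound[OF C0_diff[OF u(1) w]]) (simp add: w_def norm_diff_shrink_le[OF de])
    then have 1: "norm (\<phi> u - \<phi> w) \<le> M * (d + e)" by (simp add: diff u(1) w)
    have "w x = 0" if "x \<notin> U" for x
      using that C0_outside[OF u(1), of x] de by (auto simp: w_def U_def intro!: shrink_eq_0)
    moreover have "norm (w x) \<le> c" for x
      using norm_shrink_le[OF de] u(2) order_trans unfolding w_def by blast
    ultimately have "ennreal (norm (\<phi> w)) \<le> ennreal c * lam U"
      using lam_bound[OF w] by blast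
    also have "lam U = ennreal (measure N U)"
      using emeasure_dominating[OF borel_sets_openin[OF U]] outer_open[OF U] N.emeasure_eq_measure by simp
    finally have "norm (\<phi> w) \<le> c * measure N U" using c by (simp flip: ennreal_mult)
    also have "\<dots> \<le> c * measure N B"
      using c UB B by (intro mult_left_mono N.finite_measure_mono) (auto simp: sets_dominating)
    finally show ?thesis using 1 norm_triangle_sub[of "\<phi> u" "\<phi> w"] by (simp add: mult.commute)
  qed
  show ?thesis
  proof (rule field_le_epsilon)
    fix e :: real assume e: "e > 0"
    have "norm (\<phi> u) \<le> (d + e / (M + 1)) * M + c * measure N B"
      using e M_nonneg by (intro *) auto
    also have "(e / (M + 1)) * M \<le> e" using e M_nonneg by (simp add: field_simps)
    then have "(d + e / (M + 1)) * M + c * measure N B \<le> d * M + c * measure N B + e"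
      by (simp add: distrib_right)
    finally show "norm (\<phi> u) \<le> d * M + c * measure N B + e" .
  qed
qed

definition nu :: "'a set \<Rightarrow> 'e \<Rightarrow> 'k" where
  "nu A x = Lim (cutoff_filter X A) (\<lambda>f. \<phi> (\<lambda>y. f y *\<^sub>R x))"

lemma cutoff_not_bot: "cutoff_filter X A \<noteq> bot"
  by (rule cutoff_filter_not_bot[OF locally_compact Hausdorff])

text \<open>Two late cutoffs differ only on a set of small measure, and there by at most the norm of
  x, so the values of \<phi> form a Cauchy filter in the complete field of scalars.\<close>

lemma nu_tendsto:
  assumes A: "A \<in> borel_sets X"
  shows "((\<lambda>f. \<phi> (\<lambda>y. f y *\<^sub>R x)) \<longlongrightarrow> nu A x) (cutoff_filter X A)"
proof -
  let ?F = "filtermap (\<lambda>f. \<phi> (\<lambda>y. f y *\<^sub>R x)) (cutoff_filter X A)"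
  have "cauchy_filter ?F"
    unfolding cauchy_filter_metric_filtermap
  proof (intro allI impI)
    fix e :: real assume e: "e > 0"
    \<comment> \<open>Two exceptional sets of measure below d, weighted by the norm of x, must stay
      below e together; the summand 1 admits x = 0.\<close>
    define d where "d = e / (2 * (norm x + 1))"
    have d: "d > 0" using e by (simp add: d_def add_nonneg_pos)
    let ?P = "\<lambda>f. (f \<in> C0 X \<and> (\<forall>x. 0 \<le> f x \<and> f x \<le> 1)) \<and>
      (\<exists>B\<in>borel_sets X. measure N B < d \<and> (\<forall>x\<in>topspace X - B. f x = indicator A x))"
    have "dist (\<phi> (\<lambda>y. f y *\<^sub>R x)) (\<phi> (\<lambda>y. g y *\<^sub>R x)) < e" if fg: "?P f" "?P g" for f g
    proof -
      obtain B where B: "B \<in> borel_sets X" "measure N B < d" "\<And>x. x \<in> topspace X - B \<Longrightarrow> f x = indicator A x"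
        using fg(1) by blast
      obtain B' where B': "B' \<in> borel_sets X" "measure N B' < d" "\<And>x. x \<in> topspace X - B' \<Longrightarrow> g x = indicator A x"
        using fg(2) by blast
      have fC: "(\<lambda>y. f y *\<^sub>R x) \<in> C0 X" and gC: "(\<lambda>y. g y *\<^sub>R x) \<in> C0 X"
        using fg by (auto intro: C0_scaleR_const)
      have b: "norm (f y *\<^sub>R x - g y *\<^sub>R x) \<le> norm x" for y
      proof -
        have "0 \<le> f y" "f y \<le> 1" "0 \<le> g y" "g y \<le> 1" using fg by auto
        then have "\<bar>f y - g y\<bar> \<le> 1" by linarith
        then show ?thesis
          by (simp add: mult_left_le_one_le flip: scaleR_left_diff_distrib)
      qed
      have "norm (\<phi> (\<lambda>y. f y *\<^sub>R x - g y *\<^sub>R x)) \<le> 0 * M + norm x * measure N (B \<union> B')"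
        using B B' b by (intro norm_le_measure C0_diff fC gC) auto
      also have "\<dots> \<le> norm x * (measure N B + measure N B')"
        using B B' measure_Un_le[of B N B'] by (auto intro!: mult_left_mono simp: sets_dominating)
      also have "\<dots> \<le> norm x * (d + d)" using B(2) B'(2) by (intro mult_left_mono add_mono) auto
      also have "\<dots> < (norm x + 1) * (d + d)" using d by (intro mult_strict_right_mono) auto
      also have "\<dots> = e" by (simp add: d_def field_simps add_nonneg_eq_0_iff)
      finally show ?thesis by (simp add: dist_norm diff fC gC)
    qed
    moreover have "eventually ?P (cutoff_filter X A)"
      by (intro eventually_conj eventually_cutoff_C0 eventually_cutoff_radon radon_dominating Hausdorff A d)
    ultimately show "\<exists>P. eventually P (cutoff_filter X A) \<and>
        (\<forall>f g. P f \<and> P g \<longrightarrow> dist (\<phi> (\<lambda>y. f y *\<^sub>R x)) (\<phi> (\<lambda>y. g y *\<^sub>R x)) < e)"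
      by (intro exI[of _ ?P] conjI) blast+
  qed
  moreover have "?F \<noteq> bot" by (simp add: filtermap_bot_iff cutoff_not_bot)
  ultimately obtain l where "?F \<le> nhds l"
    using complete_UNIV unfolding complete_uniform by auto
  then have "((\<lambda>f. \<phi> (\<lambda>y. f y *\<^sub>R x)) \<longlongrightarrow> l) (cutoff_filter X A)" by (simp add: filterlim_def)
  then show ?thesis
    unfolding nu_def using tendsto_Lim[OF cutoff_not_bot] by blast
qed

lemma nu_eqI: "A \<in> borel_sets X \<Longrightarrow> ((\<lambda>f. \<phi> (\<lambda>y. f y *\<^sub>R x)) \<longlongrightarrow> l) (cutoff_filter X A) \<Longrightarrow> nu A x = l"
  using tendsto_unique[OF cutoff_not_bot nu_tendsto] .

lemma nu_add: assumes "A \<in> borel_sets X" shows "nu A (x + y) = nu A x + nu A y"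
proof (rule nu_eqI[OF assms])
  have "((\<lambda>f. \<phi> (\<lambda>z. f z *\<^sub>R x) + \<phi> (\<lambda>z. f z *\<^sub>R y)) \<longlongrightarrow> nu A x + nu A y) (cutoff_filter X A)"
    by (intro tendsto_add nu_tendsto assms)
  then show "((\<lambda>f. \<phi> (\<lambda>z. f z *\<^sub>R (x + y))) \<longlongrightarrow> nu A x + nu A y) (cutoff_filter X A)"
    by (rule Lim_transform_eventually)
      (use eventually_cutoff_C0 in eventually_elim, simp add: add C0_scaleR_const scaleR_right_distrib)
qed

lemma scaleR_scale: "r *\<^sub>R scale c x = scale c (r *\<^sub>R x)"
  by (simp add: scale_of_real[symmetric] scale_left_commute)

lemma nu_scale: assumes "A \<in> borel_sets X" shows "nu A (scale c x) = c * nu A x"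
proof (rule nu_eqI[OF assms])
  have "((\<lambda>f. c * \<phi> (\<lambda>z. f z *\<^sub>R x)) \<longlongrightarrow> c * nu A x) (cutoff_filter X A)"
    by (intro tendsto_intros nu_tendsto assms)
  then show "((\<lambda>f. \<phi> (\<lambda>z. f z *\<^sub>R scale c x)) \<longlongrightarrow> c * nu A x) (cutoff_filter X A)"
    by (rule Lim_transform_eventually)
      (use eventually_cutoff_C0 in eventually_elim, simp add: homogeneous C0_scaleR_const scaleR_scale)
qed

text \<open>A late cutoff vanishes off A and a set of small measure, so the key estimate with d = 0
  passes to the limit.\<close>

lemma norm_nu_le:
  assumes A: "A \<in> borel_sets X" shows "norm (nu A x) \<le> norm x * measure N A"
proof (rule field_le_epsilon)
  fix e :: real assume e: "e > 0"
  define d where "d = e / (norm x + 1)"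
  have d: "d > 0" using e by (simp add: d_def add_nonneg_pos)
  have "eventually (\<lambda>f. norm (\<phi> (\<lambda>y. f y *\<^sub>R x)) \<le> norm x * measure N A + e) (cutoff_filter X A)"
    using eventually_cutoff_C0 eventually_cutoff_radon[OF radon_dominating Hausdorff A d]
  proof eventually_elim
    fix f :: "'a \<Rightarrow> real" assume f: "f \<in> C0 X \<and> (\<forall>x. 0 \<le> f x \<and> f x \<le> 1)"
      and "\<exists>B\<in>borel_sets X. measure N B < d \<and> (\<forall>x\<in>topspace X - B. f x = indicator A x)"
    then obtain B where B: "B \<in> borel_sets X" "measure N B < d" "\<And>x. x \<in> topspace X - B \<Longrightarrow> f x = indicator A x"
      by blast
    have "norm (\<phi> (\<lambda>y. f y *\<^sub>R x)) \<le> 0 * M + norm x * measure N (A \<union> B)"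
      using f A B by (intro norm_le_measure C0_scaleR_const) (auto simp: mult_left_le_one_le)
    also have "\<dots> \<le> norm x * (measure N A + measure N B)"
      using A B measure_Un_le[of A N B] by (auto intro!: mult_left_mono simp: sets_dominating)
    also have "\<dots> \<le> norm x * measure N A + norm x * d"
      using B(2) by (simp add: distrib_left mult_left_mono)
    also have "norm x * d \<le> (norm x + 1) * d" using d by simp
    also have "\<dots> = e" by (simp add: d_def add_nonneg_eq_0_iff)
    finally show "norm (\<phi> (\<lambda>y. f y *\<^sub>R x)) \<le> norm x * measure N A + e" by simp
  qed
  then show "norm (nu A x) \<le> norm x * measure N A + e"
    by (rule tendsto_upperbound[OF tendsto_norm[OF nu_tendsto[OF A]] _ cutoff_not_bot])
qed

text \<open>The step function is replaced by a combination of cutoffs that equals it off a small set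
  and whose value under \<phi> is close to the sum of the \<open>nu (A i) (e i)\<close>; the key
  estimate then applies to the difference with u. The sets may overlap, which \<open>nu_Un\<close>
  exploits.\<close>

lemma nu_approx:
  assumes I: "finite I" and A: "\<And>i. i \<in> I \<Longrightarrow> A i \<in> borel_sets X" and u: "u \<in> C0 X" and d: "d \<ge> 0"
    and le: "\<And>y. y \<in> topspace X \<Longrightarrow> norm (u y - (\<Sum>i\<in>I. indicator (A i) y *\<^sub>R e i)) \<le> d"
  shows "norm (\<phi> u - (\<Sum>i\<in>I. nu (A i) (e i))) \<le> d * M"
proof (rule field_le_epsilon)
  fix \<epsilon> :: real assume eps: "\<epsilon> > 0"
  obtain b where b: "b > 0" "\<And>x. norm (u x) \<le> b" using C0_bounded[OF u] by blast
  define c where "c = b + (\<Sum>i\<in>I. norm (e i))"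
  have c: "c > 0" using b(1) unfolding c_def by (intro add_pos_nonneg sum_nonneg) auto
  \<comment> \<open>The exceptional sets cost c * card I * \<eta>, and passing from \<phi> to
    \<open>nu\<close> costs card I * \<eta>. Enlarging card I by 1 avoids a zero divisor for empty
    I.\<close>
  define \<eta> where "\<eta> = \<epsilon> / ((c + 1) * (card I + 1))"
  have eta: "\<eta> > 0" using eps c by (simp add: \<eta>_def)
  \<comment> \<open>The three properties hold eventually along a proper filter, so one cutoff has
    all of them.\<close>
  have "\<exists>f. (f \<in> C0 X \<and> (\<forall>x. 0 \<le> f x \<and> f x \<le> 1)) \<and>
      (\<exists>B\<in>borel_sets X. measure N B < \<eta> \<and> (\<forall>x\<in>topspace X - B. f x = indicator (A i) x)) \<and>
      dist (\<phi> (\<lambda>y. f y *\<^sub>R e i)) (nu (A i) (e i)) < \<eta>" if "i \<in> I" for i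
    by (rule eventually_happens'[OF cutoff_not_bot[of "A i"]])
      (intro eventually_conj eventually_cutoff_C0 eventually_cutoff_radon radon_dominating Hausdorff
        A[OF that] eta tendstoD[OF nu_tendsto])
  then have "\<exists>f. \<forall>i\<in>I. (f i \<in> C0 X \<and> (\<forall>x. 0 \<le> f i x \<and> f i x \<le> 1)) \<and>
      (\<exists>B\<in>borel_sets X. measure N B < \<eta> \<and> (\<forall>x\<in>topspace X - B. f i x = indicator (A i) x)) \<and>
      dist (\<phi> (\<lambda>y. f i y *\<^sub>R e i)) (nu (A i) (e i)) < \<eta>"
    by (intro bchoice ballI)
  then obtain f where f': "\<forall>i\<in>I. (f i \<in> C0 X \<and> (\<forall>x. 0 \<le> f i x \<and> f i x \<le> 1)) \<and>
      (\<exists>B\<in>borel_sets X. measure N B < \<eta> \<and> (\<forall>x\<in>topspace X - B. f i x = indicator (A i) x)) \<and>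
      dist (\<phi> (\<lambda>y. f i y *\<^sub>R e i)) (nu (A i) (e i)) < \<eta>"
    by (rule exE)
  then have "\<forall>i\<in>I. \<exists>B. B \<in> borel_sets X \<and> measure N B < \<eta> \<and> (\<forall>x\<in>topspace X - B. f i x = indicator (A i) x)"
    by blast
  then obtain B where "\<forall>i\<in>I. B i \<in> borel_sets X \<and> measure N (B i) < \<eta> \<and>
      (\<forall>x\<in>topspace X - B i. f i x = indicator (A i) x)"
    by (rule bchoice[THEN exE])
  with f' have f: "\<And>i. i \<in> I \<Longrightarrow> f i \<in> C0 X" "\<And>i y. i \<in> I \<Longrightarrow> 0 \<le> f i y" "\<And>i y. i \<in> I \<Longrightarrow> f i y \<le> 1"
    and B: "\<And>i. i \<in> I \<Longrightarrow> B i \<in> borel_sets X" "\<And>i. i \<in> I \<Longrightarrow> measure N (B i) < \<eta>"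
      "\<And>i y. i \<in> I \<Longrightarrow> y \<in> topspace X - B i \<Longrightarrow> f i y = indicator (A i) y"
    and near: "\<And>i. i \<in> I \<Longrightarrow> dist (\<phi> (\<lambda>y. f i y *\<^sub>R e i)) (nu (A i) (e i)) < \<eta>"
    by auto
  let ?s = "\<lambda>y. \<Sum>i\<in>I. f i y *\<^sub>R e i"
  have sC: "?s \<in> C0 X" by (intro C0_sum C0_scaleR_const f)
  have bd: "norm (u y - ?s y) \<le> c" for y
  proof -
    have "norm (?s y) \<le> (\<Sum>i\<in>I. norm (e i))"
      using f by (intro sum_norm_le) (auto simp: mult_left_le_one_le)
    then show ?thesis using norm_triangle_ineq4[of "u y" "?s y"] b(2)[of y] by (simp add: c_def)
  qed
  have BB: "(\<Union>i\<in>I. B i) \<in> borel_sets X" using I B by auto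
  have "norm (\<phi> (\<lambda>y. u y - ?s y)) \<le> d * M + c * measure N (\<Union>i\<in>I. B i)"
  proof (rule norm_le_measure[OF C0_diff[OF u sC] bd BB d])
    fix y assume y: "y \<in> topspace X - (\<Union>i\<in>I. B i)"
    then have "?s y = (\<Sum>i\<in>I. indicator (A i) y *\<^sub>R e i)" using B(3) by (intro sum.cong) auto
    then show "norm (u y - ?s y) \<le> d" using le[of y] y by simp
  qed
  also have "measure N (\<Union>i\<in>I. B i) \<le> (\<Sum>i\<in>I. measure N (B i))"
    using I B by (intro N.finite_measure_subadditive_finite) (auto simp: sets_dominating)
  also have "\<dots> \<le> (\<Sum>i\<in>I. \<eta>)" using B(2) by (intro sum_mono) (auto intro: less_imp_le)
  finally have 1: "norm (\<phi> u - (\<Sum>i\<in>I. \<phi> (\<lambda>y. f i y *\<^sub>R e i))) \<le> d * M + c * (card I * \<eta>)"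
    using c f by (simp add: diff u sC sum C0_scaleR_const mult_left_mono)
  have "norm ((\<Sum>i\<in>I. \<phi> (\<lambda>y. f i y *\<^sub>R e i)) - (\<Sum>i\<in>I. nu (A i) (e i))) \<le> (\<Sum>i\<in>I. \<eta>)"
    unfolding sum_subtractf[symmetric] using near
    by (intro sum_norm_le) (auto simp: dist_norm intro: less_imp_le)
  then have "norm (\<phi> u - (\<Sum>i\<in>I. nu (A i) (e i))) \<le> d * M + c * (card I * \<eta>) + card I * \<eta>"
    using 1 norm_triangle_ineq[of "\<phi> u - (\<Sum>i\<in>I. \<phi> (\<lambda>y. f i y *\<^sub>R e i))"
        "(\<Sum>i\<in>I. \<phi> (\<lambda>y. f i y *\<^sub>R e i)) - (\<Sum>i\<in>I. nu (A i) (e i))"] by simp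
  also have "\<dots> = d * M + ((c + 1) * card I) * \<eta>" by (simp add: algebra_simps)
  also have "((c + 1) * card I) * \<eta> \<le> ((c + 1) * (card I + 1)) * \<eta>"
    using c eta by (intro mult_right_mono mult_left_mono) auto
  also have "\<dots> = \<epsilon>" using c by (simp add: \<eta>_def add_nonneg_eq_0_iff)
  finally show "norm (\<phi> u - (\<Sum>i\<in>I. nu (A i) (e i))) \<le> d * M + \<epsilon>" by simp
qed

text \<open>The combination of the indicators of A \<union> B, A and B with coefficients x, -x, -x
  is 0, hence at distance 0 from the zero function, and \<open>nu_approx\<close> is applied with d =
  0.\<close>

lemma nu_Un:
  assumes "A \<in> borel_sets X" "B \<in> borel_sets X" "A \<inter> B = {}"
  shows "nu (A \<union> B) x = nu A x + nu B x"
proof -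
  define C where "C i = [A \<union> B, A, B] ! i" for i :: nat
  define e where "e i = [x, - x, - x] ! i" for i :: nat
  have I: "{..<3::nat} = {0, 1, 2}" by auto
  have "norm (\<phi> (\<lambda>_. 0) - (\<Sum>i<3. nu (C i) (e i))) \<le> 0 * M"
  proof (rule nu_approx)
    fix y assume "y \<in> topspace X"
    show "norm (0 - (\<Sum>i<3. indicator (C i) y *\<^sub>R e i)) \<le> 0"
      using assms(3) unfolding I by (auto simp: C_def e_def indicator_def)
  qed (use assms in \<open>auto simp: I C_def C0_zero\<close>)
  moreover have "nu D (- x) = - nu D x" if "D \<in> borel_sets X" for D
    using nu_scale[OF that, of "-1" x] by simp
  ultimately show ?thesis using assms(1,2) by (simp add: zero I C_def e_def add.commute)
qed

text \<open>Finite additivity leaves the value on the tail union, and the tails decrease to the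
  empty set, so their dominating measure tends to 0.\<close>

lemma nu_sums:
  fixes A :: "nat \<Rightarrow> 'a set"
  assumes A: "range A \<subseteq> borel_sets X" "disjoint_family A"
  shows "(\<lambda>n. nu (A n) x) sums nu (\<Union>n. A n) x"
proof -
  define R where "R n = (\<Union>i. A i) - (\<Union>i<n. A i)" for n
  have AB: "A i \<in> borel_sets X" for i using A by auto
  have RB: "R n \<in> borel_sets X" for n using AB by (auto simp: R_def)
  have split: "nu (\<Union>i. A i) x = (\<Sum>i<n. nu (A i) x) + nu (R n) x" for n
  proof (induction n)
    case 0 show ?case by (simp add: R_def)
  next
    case (Suc n)
    have "R n = A n \<union> R (Suc n)"
      using A(2) by (auto simp: R_def disjoint_family_on_def lessThan_Suc dest: less_imp_neq)
    moreover have "A n \<inter> R (Suc n) = {}" by (auto simp: R_def)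
    ultimately show ?case using Suc nu_Un[OF AB[of n] RB[of "Suc n"]] by (simp add: add.assoc)
  qed
  have "range R \<subseteq> sets N" using RB by (auto simp: sets_dominating)
  moreover have "decseq R" unfolding R_def decseq_def by (auto dest: less_le_trans)
  ultimately have "(\<lambda>n. measure N (R n)) \<longlonglongrightarrow> measure N (\<Inter>n. R n)"
    by (rule N.finite_Lim_measure_decseq)
  moreover have "(\<Inter>n. R n) = {}" by (auto simp: R_def)
  ultimately have "(\<lambda>n. measure N (R n)) \<longlonglongrightarrow> 0" by simp
  then have "(\<lambda>n. norm x * measure N (R n)) \<longlonglongrightarrow> 0" by (rule tendsto_mult_right_zero)
  then have "(\<lambda>n. nu (R n) x) \<longlonglongrightarrow> 0"
    by (rule Lim_null_comparison[OF always_eventually, rotated]) (simp add: norm_nu_le RB)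
  then have "(\<lambda>n. nu (\<Union>i. A i) x - nu (R n) x) \<longlonglongrightarrow> nu (\<Union>i. A i) x - 0"
    by (intro tendsto_diff tendsto_const)
  moreover have "nu (\<Union>i. A i) x - nu (R n) x = (\<Sum>i<n. nu (A i) x)" for n
    using split[of n] by (simp add: algebra_simps)
  ultimately show ?thesis by (simp add: sums_def)
qed

text \<open>Here \<open>\<kappa>\<close> is any operator-valued version of \<open>nu\<close>, later
  a slice of \<open>\<mu>\<close>. Domination by N gives independent convergence by comparison with
  the series of measures, and regularity because N-null sets are
  \<open>\<kappa>\<close>-null.\<close>

lemma regular_i_measure_nu:
  assumes \<kappa>: "\<And>A x. A \<in> borel_sets X \<Longrightarrow> blinfun_apply (\<kappa> A) x = nu A x"
  shows "regular_i_measure scale (*) X \<kappa>"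
  unfolding regular_i_measure_def i_measure_def
proof (intro conjI ballI allI impI)
  fix A assume "A \<in> borel_sets X"
  then show "\<kappa> A \<in> Lin scale (*)" by (simp add: Lin_def \<kappa> nu_scale)
next
  fix A :: "nat \<Rightarrow> 'a set" and x :: 'e
  assume A: "range A \<subseteq> borel_sets X \<and> disjoint_family A"
  then have AB: "A n \<in> borel_sets X" for n by auto
  show "(\<lambda>n. blinfun_apply (\<kappa> (A n)) x) sums blinfun_apply (\<kappa> (\<Union>n. A n)) x"
    using nu_sums[of A x] A AB by (simp add: \<kappa> borel.countable_UN)
next
  fix A :: "nat \<Rightarrow> 'a set"
  assume A: "range A \<subseteq> borel_sets X \<and> disjoint_family A"
  then have AB: "A n \<in> borel_sets X" for n by auto
  show "independently_convergent (\<lambda>n. \<kappa> (A n))"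
    unfolding independently_convergent_def
  proof (intro allI impI)
    fix x :: "nat \<Rightarrow> 'e" assume "bounded (range x)"
    then obtain b where b: "\<And>n. norm (x n) \<le> b" by (auto simp: bounded_iff)
    have "summable (\<lambda>n. measure N (A n))"
      using A by (intro sums_summable[OF N.finite_measure_UNION]) (auto simp: sets_dominating)
    then have "summable (\<lambda>n. b * measure N (A n))" by (rule summable_mult)
    then show "summable (\<lambda>n. blinfun_apply (\<kappa> (A n)) (x n))"
    proof (rule summable_comparison_test'[where N = 0])
      fix n show "norm (blinfun_apply (\<kappa> (A n)) (x n)) \<le> b * measure N (A n)"
        using norm_nu_le[OF AB[of n], of "x n"] mult_right_mono[OF b[of n] measure_nonneg[of N "A n"]]
        by (simp add: \<kappa> AB)
    qed
  qed
next
  fix A assume A: "A \<in> borel_sets X"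
  obtain K where K: "K \<subseteq> A" "sigma_compactin X K" "emeasure N (A - K) = 0"
    using radon_dominating A unfolding radon_def by blast
  have "\<kappa> B = 0" if B: "B \<in> borel_sets X" "B \<subseteq> A - K" for B
  proof (rule blinfun_eqI)
    fix x
    obtain C :: "nat \<Rightarrow> 'a set" where C: "\<And>n. compactin X (C n)" "K = (\<Union>n. C n)"
      using K(2) by (auto simp: sigma_compactin_def)
    have "K \<in> borel_sets X"
      unfolding C(2) using borel_sets_closedin[OF compactin_imp_closedin[OF Hausdorff C(1)]]
      by (intro borel.countable_UN) auto
    then have "emeasure N B \<le> emeasure N (A - K)"
      using A B by (intro emeasure_mono) (auto simp: sets_dominating)
    then have "measure N B = 0" using K(3) by (simp add: measure_def)
    then show "blinfun_apply (\<kappa> B) x = blinfun_apply 0 x"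
      using norm_nu_le[OF B(1), of x] by (simp add: \<kappa> B)
  qed
  then show "\<exists>K\<subseteq>A. sigma_compactin X K \<and> (\<forall>B\<in>borel_sets X. B \<subseteq> A - K \<longrightarrow> \<kappa> B = 0)"
    using K by blast
qed

lemma norm_sum_nu_le:
  fixes m :: nat
  assumes A: "\<And>n. n < m \<Longrightarrow> A n \<in> borel_sets X" "disjoint_family_on A {..<m}"
    and x: "\<And>n. n < m \<Longrightarrow> norm (x n) \<le> 1"
  shows "norm (\<Sum>n<m. nu (A n) (x n)) \<le> M"
proof -
  have "norm (\<Sum>n<m. nu (A n) (x n)) \<le> (\<Sum>n<m. measure N (A n))"
  proof (rule sum_norm_le)
    fix n assume n: "n \<in> {..<m}"
    then have "norm (nu (A n) (x n)) \<le> norm (x n) * measure N (A n)" using A by (intro norm_nu_le) auto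
    also have "\<dots> \<le> measure N (A n)" using x n by (intro mult_left_le_one_le) auto
    finally show "norm (nu (A n) (x n)) \<le> measure N (A n)" .
  qed
  also have "\<dots> = measure N (\<Union>n<m. A n)"
    using A by (intro N.finite_measure_finite_Union[symmetric]) (auto simp: sets_dominating)
  also have "\<dots> \<le> M" using A by (intro measure_N_le borel.finite_UN) auto
  finally show ?thesis .
qed

end

subsection \<open>Variation and integrals of scalar i-measures\<close>

lemma norm_has_sum_le:
  assumes "(h has_sum l) A" "\<And>F. finite F \<Longrightarrow> F \<subseteq> A \<Longrightarrow> norm (sum h F) \<le> b"
  shows "norm l \<le> b"
proof -
  have "((\<lambda>F. norm (sum h F)) \<longlongrightarrow> norm l) (finite_subsets_at_top A)"
    using assms(1) unfolding has_sum_def by (rule tendsto_norm)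
  then show ?thesis
    by (rule tendsto_upperbound) (use assms(2) in \<open>auto intro: eventually_finite_subsets_at_top_weakI\<close>)
qed

section \<open>Absolute convergence for scalar i-measures\<close>

locale scalar_i_measure = banach_over scale + sigma_algebra Z \<MM>
  for scale :: "'k::real_or_complex \<Rightarrow> 'e::banach \<Rightarrow> 'e" and Z :: "'a set" and \<MM> +
  fixes \<kappa> :: "'a set \<Rightarrow> ('e \<Rightarrow>\<^sub>L 'k)"
  assumes i_measure: "i_measure scale (*) \<MM> \<kappa>"
begin

lemma sums:
  fixes A :: "nat \<Rightarrow> 'a set"
  shows "range A \<subseteq> \<MM> \<Longrightarrow> disjoint_family A \<Longrightarrow> (\<lambda>n. \<kappa> (A n) x) sums \<kappa> (\<Union>n. A n) x"
  using i_measure unfolding i_measure_def by blast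

lemma scale_apply: "A \<in> \<MM> \<Longrightarrow> \<kappa> A (scale c x) = c * \<kappa> A x"
  using i_measure unfolding i_measure_def Lin_def by blast

text \<open>The constant sequence of empty sets is disjoint, and a constant series converges only if
  its terms are 0.\<close>

lemma empty [simp]: "\<kappa> {} = 0"
proof (rule blinfun_eqI)
  fix x
  have "summable (\<lambda>n::nat. \<kappa> {} x)"
    using sums[of "\<lambda>_. {}" x] by (auto simp: sums_iff disjoint_family_on_def)
  then have "(\<lambda>n::nat. \<kappa> {} x) \<longlonglongrightarrow> 0" by (rule summable_LIMSEQ_zero)
  then show "\<kappa> {} x = blinfun_apply 0 x" by (simp add: LIMSEQ_const_iff)
qed

text \<open>Rotating the values to the positive axis turns independent into absolute convergence.\<close>

lemma summable_norm_measure: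
  fixes A :: "nat \<Rightarrow> 'a set"
  assumes A: "range A \<subseteq> \<MM>" "disjoint_family A"
  shows "summable (\<lambda>n. norm (\<kappa> (A n)))"
proof -
  have "\<exists>x. norm x \<le> 1 \<and> (\<exists>r. norm (\<kappa> (A n)) / 2 \<le> r \<and> \<kappa> (A n) x = of_real r)" for n
  proof -
    \<comment> \<open>The operator norm need not be attained on the unit ball, so only half of it is
      asked for.\<close>
    have "\<exists>x. norm x \<le> 1 \<and> norm (\<kappa> (A n)) / 2 \<le> norm (\<kappa> (A n) x)"
    proof (rule ccontr)
      assume "\<not> ?thesis"
      then have *: "norm x \<le> 1 \<Longrightarrow> norm (\<kappa> (A n) x) < norm (\<kappa> (A n)) / 2" for x by force
      have "norm (\<kappa> (A n)) \<le> norm (\<kappa> (A n)) / 2"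
      proof (rule norm_blinfun_bound)
        fix x
        show "norm (\<kappa> (A n) x) \<le> norm (\<kappa> (A n)) / 2 * norm x"
          using *[of "(1 / norm x) *\<^sub>R x"]
          by (cases "x = 0") (auto simp: blinfun.scaleR_right field_simps)
      qed simp
      then show False using *[of 0] by simp
    qed
    then obtain x where x: "norm x \<le> 1" "norm (\<kappa> (A n)) / 2 \<le> norm (\<kappa> (A n) x)" by blast
    obtain c where "norm c = 1" "c * \<kappa> (A n) x = of_real (norm (\<kappa> (A n) x))"
      by (rule ex_unit_phase)
    then show ?thesis
      using x A by (intro exI[of _ "scale c x"]) (auto simp: norm_scale scale_apply image_subset_iff)
  qed
  then obtain x r where x: "\<And>n. norm (x n) \<le> 1" "\<And>n. norm (\<kappa> (A n)) / 2 \<le> r n"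
      "\<And>n. \<kappa> (A n) (x n) = of_real (r n)"
    by metis
  have "bounded (range x)" using x(1) by (auto simp: bounded_iff)
  then have "summable (\<lambda>n. \<kappa> (A n) (x n))"
    using i_measure A unfolding i_measure_def independently_convergent_def by blast
  then have s: "summable (\<lambda>n. of_real (r n) :: 'k)" by (simp add: x(3))
  \<comment> \<open>The embedding of the reals into the scalars is isometric, so the Cauchy
    criterion carries convergence back.\<close>
  have "summable r"
    unfolding summable_Cauchy
  proof (intro allI impI)
    fix e :: real assume "e > 0"
    then obtain N where "\<And>m n. m \<ge> N \<Longrightarrow> norm (\<Sum>k = m..<n. of_real (r k) :: 'k) < e"
      using s unfolding summable_Cauchy by blast
    moreover have "norm (\<Sum>k = m..<n. of_real (r k) :: 'k) = norm (\<Sum>k = m..<n. r k)" for m n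
      by (metis norm_of_real of_real_sum real_norm_def)
    ultimately show "\<exists>N. \<forall>m\<ge>N. \<forall>n. norm (\<Sum>k = m..<n. r k) < e" by auto
  qed
  then have "summable (\<lambda>n. 2 * r n)" by (rule summable_mult)
  then show ?thesis
    by (rule summable_comparison_test'[where N = 0]) (use x(2) in \<open>simp add: field_simps\<close>)
qed

lemma summable_on_norm_measure:
  assumes P: "countable P" "P \<subseteq> \<MM>" "disjoint P"
  shows "(\<lambda>B. norm (\<kappa> B)) summable_on P"
proof (cases "finite P")
  case False
  have bij: "bij_betw (from_nat_into P) UNIV P" using bij_betw_from_nat_into[OF P(1) False] .
  have "disjoint_family (from_nat_into P)"
    unfolding disjoint_family_on_def
  proof (intro ballI impI)
    fix m n :: nat assume "m \<noteq> n"
    then have "from_nat_into P m \<noteq> from_nat_into P n" using bij by (auto simp: bij_betw_def inj_on_def)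
    moreover have "from_nat_into P m \<in> P" "from_nat_into P n \<in> P"
      using bij by (auto simp: bij_betw_def)
    ultimately show "from_nat_into P m \<inter> from_nat_into P n = {}" using disjointD[OF P(3)] by blast
  qed
  moreover have "range (from_nat_into P) \<subseteq> \<MM>" using bij P(2) by (simp add: bij_betw_def)
  ultimately have "(\<lambda>n. norm (\<kappa> (from_nat_into P n))) summable_on UNIV"
    using summable_norm_measure by (intro norm_summable_imp_summable_on) auto
  then show ?thesis using summable_on_reindex_bij_betw[OF bij] by blast
qed simp

lemma has_sum_UN:
  assumes J: "countable J" "\<And>i. i \<in> J \<Longrightarrow> B i \<in> \<MM>" "disjoint_family_on B J"
  shows "((\<lambda>i. \<kappa> (B i) x) has_sum \<kappa> (\<Union>i\<in>J. B i) x) J"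
proof -
  define h where "h = to_nat_on J"
  have inj: "inj_on h J" unfolding h_def using J(1) by (rule inj_on_to_nat_on)
  define A where "A n = (if n \<in> h ` J then B (the_inv_into J h n) else {})" for n
  have Ah: "A (h i) = B i" if "i \<in> J" for i
    using that by (simp add: A_def the_inv_into_f_f[OF inj])
  have A_out: "A n = {}" if "n \<notin> h ` J" for n using that by (simp add: A_def)
  have AM: "range A \<subseteq> \<MM>"
  proof (rule image_subsetI)
    fix n show "A n \<in> \<MM>"
      using J(2) Ah A_out[of n] by (cases "n \<in> h ` J") auto
  qed
  have dj: "disjoint_family A"
    unfolding disjoint_family_on_def
  proof (intro ballI impI)
    fix m n :: nat assume "m \<noteq> n"
    show "A m \<inter> A n = {}"
    proof (cases "m \<in> h ` J \<and> n \<in> h ` J")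
      case True
      then obtain i j where ij: "i \<in> J" "j \<in> J" "m = h i" "n = h j" by blast
      with \<open>m \<noteq> n\<close> have "i \<noteq> j" by blast
      then show ?thesis using ij J(3) by (auto simp: Ah disjoint_family_on_def)
    qed (auto simp: A_out)
  qed
  have UN: "(\<Union>n. A n) = (\<Union>i\<in>J. B i)"
  proof (intro equalityI subsetI)
    fix y assume "y \<in> (\<Union>n. A n)"
    then obtain n where n: "y \<in> A n" by blast
    then have "n \<in> h ` J" using A_out[of n] by blast
    then show "y \<in> (\<Union>i\<in>J. B i)" using n Ah by auto
  next
    fix y assume "y \<in> (\<Union>i\<in>J. B i)"
    then show "y \<in> (\<Union>n. A n)" using Ah by blast
  qed
  have "summable (\<lambda>n. norm (\<kappa> (A n) x))"
  proof (rule summable_comparison_test'[where N = 0])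
    show "summable (\<lambda>n. norm (\<kappa> (A n)) * norm x)"
      by (intro summable_mult2 summable_norm_measure AM dj)
  qed (simp add: norm_blinfun)
  then have "((\<lambda>n. \<kappa> (A n) x) has_sum \<kappa> (\<Union>i\<in>J. B i) x) UNIV"
    using sums[OF AM dj, of x] UN by (intro norm_summable_imp_has_sum) auto
  moreover have "((\<lambda>n. \<kappa> (A n) x) has_sum \<kappa> (\<Union>i\<in>J. B i) x) UNIV \<longleftrightarrow>
      ((\<lambda>n. \<kappa> (A n) x) has_sum \<kappa> (\<Union>i\<in>J. B i) x) (h ` J)"
    by (rule has_sum_cong_neutral) (auto simp: A_out)
  moreover have "((\<lambda>n. \<kappa> (A n) x) has_sum \<kappa> (\<Union>i\<in>J. B i) x) (h ` J) \<longleftrightarrow>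
      ((\<lambda>i. \<kappa> (B i) x) has_sum \<kappa> (\<Union>i\<in>J. B i) x) J"
    unfolding has_sum_reindex[OF inj] by (rule has_sum_cong) (simp add: Ah)
  ultimately show ?thesis by simp
qed

lemma finite_additive:
  "finite J \<Longrightarrow> (\<And>i. i \<in> J \<Longrightarrow> B i \<in> \<MM>) \<Longrightarrow> disjoint_family_on B J \<Longrightarrow> \<kappa> (\<Union>i\<in>J. B i) x = (\<Sum>i\<in>J. \<kappa> (B i) x)"
  using has_sum_UN[of J B x] has_sum_unique has_sum_finite countable_finite by metis

section \<open>The variation and its finiteness\<close>

definition fams :: "'a set \<Rightarrow> 'a set set set" where
  "fams A = {P. finite P \<and> P \<subseteq> \<MM> \<and> {} \<notin> P \<and> disjoint P \<and> \<Union>P \<subseteq> A}"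

definition variation :: "'a set \<Rightarrow> ennreal" where
  "variation A = (SUP P\<in>fams A. \<Sum>B\<in>P. ennreal (norm (\<kappa> B)))"

lemma empty_in_fams: "{} \<in> fams A"
  by (simp add: fams_def)

lemma variation_upper: "P \<in> fams A \<Longrightarrow> (\<Sum>B\<in>P. ennreal (norm (\<kappa> B))) \<le> variation A"
  unfolding variation_def by (rule SUP_upper)

text \<open>This passes from indexed families to sets of sets: after empty members are dropped,
  disjointness makes the indexing injective, so no term is lost.\<close>

lemma sum_le_variation:
  assumes J: "finite J" "\<And>i. i \<in> J \<Longrightarrow> B i \<in> \<MM>" "disjoint_family_on B J" "\<And>i. i \<in> J \<Longrightarrow> B i \<subseteq> A"
  shows "(\<Sum>i\<in>J. ennreal (norm (\<kappa> (B i)))) \<le> variation A"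
proof -
  define J' where "J' = {i\<in>J. B i \<noteq> {}}"
  have inj: "inj_on B J'"
    using J(3) by (auto simp: inj_on_def J'_def disjoint_family_on_def)
  have "(\<Sum>i\<in>J. ennreal (norm (\<kappa> (B i)))) = (\<Sum>i\<in>J'. ennreal (norm (\<kappa> (B i))))"
    using J(1) by (intro sum.mono_neutral_right) (auto simp: J'_def)
  also have "\<dots> = (\<Sum>C\<in>B ` J'. ennreal (norm (\<kappa> C)))" by (simp add: sum.reindex[OF inj])
  also have "B ` J' \<in> fams A"
    unfolding fams_def
  proof (intro CollectI conjI)
    show "disjoint (B ` J')"
      unfolding disjoint_def
    proof (intro ballI impI)
      fix C D assume "C \<in> B ` J'" "D \<in> B ` J'" "C \<noteq> D"
      then obtain i j where ij: "i \<in> J" "j \<in> J" "C = B i" "D = B j" by (auto simp: J'_def)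
      with \<open>C \<noteq> D\<close> have "i \<noteq> j" by blast
      then show "C \<inter> D = {}" using ij disjoint_family_onD[OF J(3)] by simp
    qed
  qed (use J in \<open>auto simp: J'_def\<close>)
  then have "(\<Sum>C\<in>B ` J'. ennreal (norm (\<kappa> C))) \<le> variation A" by (rule variation_upper)
  finally show ?thesis .
qed

lemma variation_superadditive:
  assumes "A \<inter> B = {}" shows "variation A + variation B \<le> variation (A \<union> B)"
proof -
  let ?s = "\<lambda>P. \<Sum>B\<in>P. ennreal (norm (\<kappa> B))"
  have le: "?s P + ?s Q \<le> variation (A \<union> B)" if P: "P \<in> fams A" and Q: "Q \<in> fams B" for P Q
  proof -
    \<comment> \<open>A common member would lie in A \<inter> B and be empty. This is why
      \<open>fams\<close> excludes the empty set.\<close>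
    have "P \<inter> Q = {}"
    proof (rule ccontr)
      assume "P \<inter> Q \<noteq> {}"
      then obtain C where "C \<in> P" "C \<in> Q" by blast
      then have "C \<subseteq> A \<inter> B" "C \<noteq> {}" using P Q by (auto simp: fams_def)
      then show False using assms by blast
    qed
    then have "?s P + ?s Q = ?s (P \<union> Q)"
      using P Q by (intro sum.union_disjoint[symmetric]) (auto simp: fams_def)
    also have "\<dots> \<le> variation (A \<union> B)"
    proof (rule variation_upper)
      have "\<Union>P \<subseteq> A" "\<Union>Q \<subseteq> B" using P Q by (auto simp: fams_def)
      then have "\<Union>P \<inter> \<Union>Q = {}" using assms by blast
      then show "P \<union> Q \<in> fams (A \<union> B)"
        using P Q by (auto simp: fams_def intro!: disjoint_union)
    qed
    finally show ?thesis .
  qed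
  have ne: "fams C \<noteq> {}" for C using empty_in_fams by blast
  have "variation A + variation B = (SUP P\<in>fams A. ?s P + variation B)"
    unfolding variation_def[of A] by (simp add: ennreal_SUP_add_left ne)
  also have "\<dots> \<le> variation (A \<union> B)"
  proof (rule SUP_least)
    fix P assume P: "P \<in> fams A"
    have "?s P + variation B = (SUP Q\<in>fams B. ?s Q + ?s P)"
      unfolding variation_def[of B] by (simp add: ennreal_SUP_add_left ne add.commute)
    also have "\<dots> \<le> variation (A \<union> B)"
      using le[OF P] by (intro SUP_least) (simp add: add.commute)
    finally show "?s P + variation B \<le> variation (A \<union> B)" .
  qed
  finally show ?thesis .
qed

lemma variation_mono: "A \<subseteq> B \<Longrightarrow> variation A \<le> variation B"
  unfolding variation_def by (rule SUP_subset_mono) (auto simp: fams_def)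

lemma variation_empty: "variation {} = 0"
proof -
  have "fams {} = {{}}" by (auto simp: fams_def)
  then show ?thesis by (simp add: variation_def)
qed

text \<open>One inequality is superadditivity on finite unions. For the other, each member B of a
  family is cut along the A n; countable additivity bounds the norm of \<open>\<kappa> B\<close> by
  the sum of the norms of the pieces, and the two sums are exchanged.\<close>

lemma countably_additive_variation: "countably_additive \<MM> variation"
  unfolding countably_additive_def
proof (intro allI impI antisym)
  fix A :: "nat \<Rightarrow> 'a set"
  assume A: "range A \<subseteq> \<MM>" "disjoint_family A" "(\<Union>n. A n) \<in> \<MM>"
  have fin: "(\<Sum>i<n. variation (A i)) \<le> variation (\<Union>i<n. A i)" for n
  proof (induction n)
    case (Suc n)
    have "(\<Union>i<n. A i) \<inter> A n = {}"
      using disjoint_family_onD[OF A(2), of _ n] by fastforce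
    then have "variation (\<Union>i<n. A i) + variation (A n) \<le> variation ((\<Union>i<n. A i) \<union> A n)"
      by (rule variation_superadditive)
    also have "(\<Union>i<n. A i) \<union> A n = (\<Union>i<Suc n. A i)" by (auto simp: lessThan_Suc)
    finally show ?case using Suc by (auto intro: order_trans add_right_mono)
  qed simp
  show "(\<Sum>i. variation (A i)) \<le> variation (\<Union>i. A i)"
  proof (rule suminf_le_const)
    fix n
    have "variation (\<Union>i<n. A i) \<le> variation (\<Union>i. A i)" by (intro variation_mono) auto
    then show "(\<Sum>i<n. variation (A i)) \<le> variation (\<Union>i. A i)" using fin[of n] by (rule order_trans[rotated])
  qed simp
  show "variation (\<Union>i. A i) \<le> (\<Sum>i. variation (A i))"
    unfolding variation_def[of "\<Union>i. A i"]
  proof (rule SUP_least)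
    fix P assume P: "P \<in> fams (\<Union>i. A i)"
    have "ennreal (norm (\<kappa> B)) \<le> (\<Sum>n. ennreal (norm (\<kappa> (B \<inter> A n))))" if B: "B \<in> P" for B
    proof -
      have BM: "range (\<lambda>n. B \<inter> A n) \<subseteq> \<MM>" "disjoint_family (\<lambda>n. B \<inter> A n)"
        using A(1,2) B P by (auto simp: fams_def disjoint_family_on_def image_subset_iff intro!: Int)
      have s: "summable (\<lambda>n. norm (\<kappa> (B \<inter> A n)))" by (rule summable_norm_measure[OF BM])
      have "B = (\<Union>n. B \<inter> A n)" using B P by (auto simp: fams_def)
      then have sm: "(\<lambda>n. \<kappa> (B \<inter> A n) x) sums \<kappa> B x" for x using sums[OF BM, of x] by simp
      have "norm (\<kappa> B) \<le> (\<Sum>n. norm (\<kappa> (B \<inter> A n)))"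
      proof (rule norm_blinfun_bound)
        show "0 \<le> (\<Sum>n. norm (\<kappa> (B \<inter> A n)))" by (rule suminf_nonneg[OF s]) simp
        fix x :: 'e
        have s2: "summable (\<lambda>n. norm (\<kappa> (B \<inter> A n)) * norm x)" by (rule summable_mult2[OF s])
        have s1: "summable (\<lambda>n. norm (\<kappa> (B \<inter> A n) x))"
          by (rule summable_comparison_test'[OF s2, where N = 0]) (simp add: norm_blinfun)
        have "norm (\<kappa> B x) \<le> (\<Sum>n. norm (\<kappa> (B \<inter> A n) x))"
          using summable_norm[OF s1] sm by (simp add: sums_iff)
        also have "\<dots> \<le> (\<Sum>n. norm (\<kappa> (B \<inter> A n)) * norm x)"
          by (intro suminf_le s1 s2 norm_blinfun)
        also have "\<dots> = (\<Sum>n. norm (\<kappa> (B \<inter> A n))) * norm x" by (rule suminf_mult2[OF s, symmetric])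
        finally show "norm (\<kappa> B x) \<le> (\<Sum>n. norm (\<kappa> (B \<inter> A n))) * norm x" .
      qed
      then show ?thesis by (simp add: suminf_ennreal2[OF _ s] ennreal_leI)
    qed
    then have "(\<Sum>B\<in>P. ennreal (norm (\<kappa> B))) \<le> (\<Sum>B\<in>P. \<Sum>n. ennreal (norm (\<kappa> (B \<inter> A n))))"
      by (rule sum_mono)
    also have "\<dots> = (\<Sum>n. \<Sum>B\<in>P. ennreal (norm (\<kappa> (B \<inter> A n))))"
      by (rule suminf_sum[symmetric]) simp
    also have "\<dots> \<le> (\<Sum>n. variation (A n))"
    proof (intro suminf_le sum_le_variation)
      show "disjoint_family_on (\<lambda>B. B \<inter> A n) P" for n
        using P unfolding fams_def disjoint_def disjoint_family_on_def by blast
    qed (use P A in \<open>auto simp: fams_def\<close>)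
    finally show "(\<Sum>B\<in>P. ennreal (norm (\<kappa> B))) \<le> (\<Sum>i. variation (A i))" .
  qed
qed

definition var_measure :: "'a measure" where
  "var_measure = measure_of Z \<MM> variation"

lemma space_var: "space var_measure = Z"
  and sets_var: "sets var_measure = \<MM>"
  and emeasure_var: "A \<in> \<MM> \<Longrightarrow> emeasure var_measure A = variation A"
  unfolding var_measure_def
  using space_closed countably_additive_variation
  by (simp_all add: space_measure_of sets_measure_of sigma_sets_eq sigma_algebra_axioms
      emeasure_measure_of_sigma positive_def variation_empty)

text \<open>
  If \<open>A\<close> has infinite variation, then so has a member \<open>A'\<close> of any finite partition of \<open>A\<close>. Since
  \<open>norm (\<kappa> A')\<close> is at most \<open>norm (\<kappa> A)\<close> plus the contribution of the other members, the latter is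
  large if the whole partition contributes much.
\<close>

lemma infinite_variation_step:
  assumes A: "A \<in> \<MM>" "variation A = top"
  shows "\<exists>A'. A' \<in> \<MM> \<and> variation A' = top \<and> A' \<subseteq> A \<and>
    (\<exists>Q. Q \<in> fams (A - A') \<and> 1 \<le> (\<Sum>B\<in>Q. norm (\<kappa> B)))"
proof -
  let ?s = "\<lambda>P. \<Sum>B\<in>P. norm (\<kappa> B)"
  \<comment> \<open>The contribution of A' is at most the norm of \<open>\<kappa> A\<close> plus
    that of Q, so Q is counted at most twice; the excess 2 therefore leaves at least 1 for
    Q.\<close>
  have "ennreal (norm (\<kappa> A) + 2) < variation A" using A by (simp add: less_top[symmetric])
  then obtain P0 where P0: "P0 \<in> fams A" "ennreal (norm (\<kappa> A) + 2) < (\<Sum>B\<in>P0. ennreal (norm (\<kappa> B)))"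
    unfolding variation_def less_SUP_iff by blast
  then have "ennreal (norm (\<kappa> A) + 2) < ennreal (?s P0)" by simp
  then have P0s: "norm (\<kappa> A) + 2 < ?s P0" by (subst (asm) ennreal_less_iff) auto
  define R where "R = A - \<Union>P0"
  \<comment> \<open>R completes the family to a partition of A, unless it is empty and thus barred
    from \<open>fams\<close>.\<close>
  define P where "P = (if R = {} then P0 else insert R P0)"
  have RM: "R \<in> \<MM>" using P0(1) A(1) by (auto simp: R_def fams_def intro!: Diff finite_Union)
  have UP: "\<Union>P = A" using P0(1) by (auto simp: P_def R_def fams_def)
  have fin: "finite P" using P0(1) by (simp add: P_def fams_def)
  have PM: "P \<subseteq> \<MM>" using P0(1) RM by (auto simp: P_def fams_def)
  have ne: "{} \<notin> P" using P0(1) by (auto simp: P_def fams_def)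
  have dj: "disjoint P"
    unfolding disjoint_def
  proof (intro ballI impI)
    fix B C assume BC: "B \<in> P" "C \<in> P" "B \<noteq> C"
    have RP: "R \<inter> D = {}" if "D \<in> P0" for D using that by (auto simp: R_def)
    have "disjoint P0" using P0(1) by (simp add: fams_def)
    then show "B \<inter> C = {}"
      using BC RP[of B] RP[of C] disjointD[of P0 B C] by (auto simp: P_def split: if_splits)
  qed
  have sP: "norm (\<kappa> A) + 2 < ?s P"
  proof -
    have "?s P0 \<le> ?s P" using fin by (intro sum_mono2) (auto simp: P_def)
    then show ?thesis using P0s by simp
  qed
  have djf: "disjoint_family_on (\<lambda>B. B) P"
    using dj by (auto simp: disjoint_def disjoint_family_on_def)
  have "variation A = emeasure var_measure (\<Union>B\<in>P. B)"
    using A(1) UP by (simp add: emeasure_var)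
  also have "\<dots> = (\<Sum>B\<in>P. emeasure var_measure B)"
    using fin PM djf by (intro sum_emeasure[symmetric]) (auto simp: sets_var)
  also have "\<dots> = (\<Sum>B\<in>P. variation B)" using PM by (intro sum.cong) (auto simp: emeasure_var)
  finally have "(\<Sum>B\<in>P. variation B) = top" using A(2) by simp
  then obtain A' where A': "A' \<in> P" "variation A' = top" using fin by auto
  define Q where "Q = P - {A'}"
  have "\<kappa> A x = \<kappa> A' x + (\<Sum>B\<in>Q. \<kappa> B x)" for x
    using finite_additive[OF fin _ djf, of x] PM UP fin A'(1) by (auto simp: Q_def sum.remove)
  then have "\<kappa> A' = \<kappa> A - (\<Sum>B\<in>Q. \<kappa> B)"
    by (intro blinfun_eqI) (simp add: blinfun.diff_left blinfun.sum_left)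
  then have "norm (\<kappa> A') \<le> norm (\<kappa> A) + ?s Q"
    using norm_triangle_ineq4[of "\<kappa> A" "\<Sum>B\<in>Q. \<kappa> B"] norm_sum[of \<kappa> Q] by simp
  moreover have "?s P = norm (\<kappa> A') + ?s Q" using fin A'(1) by (simp add: Q_def sum.remove)
  ultimately have "1 \<le> ?s Q" using sP by simp
  moreover have "Q \<in> fams (A - A')"
    using fin PM ne dj UP A'(1) by (auto simp: fams_def Q_def disjoint_def)
  ultimately show ?thesis using A' PM UP by blast
qed

text \<open>Repeating \<open>infinite_variation_step\<close> gives a decreasing sequence of sets
  whose successive differences contain finite families contributing at least 1 each. Their union is
  a countable disjoint family with divergent norms, against
  \<open>summable_on_norm_measure\<close>.\<close>

lemma finite_variation: "variation Z < top"
proof (rule ccontr)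
  assume "\<not> variation Z < top"
  then have Z: "Z \<in> \<MM> \<and> variation Z = top" by (simp add: less_top[symmetric])
  let ?s = "\<lambda>P. \<Sum>B\<in>P. norm (\<kappa> B)"
  have "\<exists>A. \<forall>n. (A n \<in> \<MM> \<and> variation (A n) = top) \<and>
      (A (Suc n) \<subseteq> A n \<and> (\<exists>Q. Q \<in> fams (A n - A (Suc n)) \<and> 1 \<le> ?s Q))"
  proof (rule dependent_nat_choice)
    show "\<exists>A. A \<in> \<MM> \<and> variation A = top" using Z by blast
    fix A n assume "A \<in> \<MM> \<and> variation A = top"
    then obtain B where "B \<in> \<MM>" "variation B = top" "B \<subseteq> A"
        "\<exists>Q. Q \<in> fams (A - B) \<and> 1 \<le> ?s Q"
      using infinite_variation_step[of A] by auto
    then show "\<exists>B. (B \<in> \<MM> \<and> variation B = top) \<and> B \<subseteq> A \<and> (\<exists>Q. Q \<in> fams (A - B) \<and> 1 \<le> ?s Q)"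
      by (intro exI[of _ B] conjI)
  qed
  then obtain A where A: "\<And>n. A (Suc n) \<subseteq> A n" "\<And>n. \<exists>Q. Q \<in> fams (A n - A (Suc n)) \<and> 1 \<le> ?s Q"
    by blast
  then obtain Q where Q: "\<And>n. Q n \<in> fams (A n - A (Suc n))" "\<And>n. 1 \<le> ?s (Q n)" by metis
  have anti: "m \<le> n \<Longrightarrow> A n \<subseteq> A m" for m n using A(1) by (rule lift_Suc_antimono_le)
  have sep: "B \<inter> C = {}" if "B \<in> Q m" "C \<in> Q n" "m < n" for B C m n
  proof -
    have "B \<inter> A (Suc m) = {}" "C \<subseteq> A n" using Q(1)[of m] Q(1)[of n] that by (auto simp: fams_def)
    then show ?thesis using anti[of "Suc m" n] that(3) by auto
  qed
  define P where "P = (\<Union>n. Q n)"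
  have "disjoint P"
    unfolding disjoint_def
  proof (intro ballI impI)
    fix B C assume "B \<in> P" "C \<in> P" "B \<noteq> C"
    then obtain m n where mn: "B \<in> Q m" "C \<in> Q n" by (auto simp: P_def)
    consider "m < n" | "m = n" | "n < m" by linarith
    then show "B \<inter> C = {}"
    proof cases
      case 2 then show ?thesis using mn Q(1)[of n] \<open>B \<noteq> C\<close> by (auto simp: fams_def disjoint_def)
    qed (use sep mn in blast)+
  qed
  moreover have "countable P" "P \<subseteq> \<MM>"
    using Q(1) by (auto simp: P_def fams_def intro: countable_finite)
  ultimately have sm: "(\<lambda>B. norm (\<kappa> B)) summable_on P" by (intro summable_on_norm_measure)
  have Qdj: "Q m \<inter> Q n = {}" if "m \<noteq> n" for m n
  proof (rule ccontr)
    assume "Q m \<inter> Q n \<noteq> {}"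
    then obtain B where B: "B \<in> Q m" "B \<in> Q n" by blast
    then have "B \<inter> B = {}" using sep[of B m B n] sep[of B n B m] that by (cases m n rule: linorder_cases) auto
    then show False using B Q(1)[of m] by (auto simp: fams_def)
  qed
  obtain n :: nat where n: "infsum (\<lambda>B. norm (\<kappa> B)) P < n" using reals_Archimedean2 by blast
  have finQ: "finite (Q i)" for i using Q(1)[of i] by (simp add: fams_def)
  have "real n = (\<Sum>i<n. 1)" by simp
  also have "\<dots> \<le> (\<Sum>i<n. ?s (Q i))" by (intro sum_mono Q(2))
  also have "\<dots> = ?s (\<Union>i<n. Q i)"
    using Qdj finQ by (intro sum.UNION_disjoint[symmetric]) auto
  also have "\<dots> \<le> infsum (\<lambda>B. norm (\<kappa> B)) P"
    using finQ by (intro finite_sum_le_infsum[OF sm]) (auto simp: P_def)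
  finally show False using n by simp
qed

sublocale V: finite_measure var_measure
  using finite_variation by (intro finite_measureI) (simp add: space_var emeasure_var)

lemma measure_var: "A \<in> \<MM> \<Longrightarrow> ennreal (measure var_measure A) = variation A"
  by (metis V.emeasure_eq_measure emeasure_var)

lemma sum_norm_le_measure:
  assumes J: "finite J" "\<And>i. i \<in> J \<Longrightarrow> B i \<in> \<MM>" "disjoint_family_on B J" "\<And>i. i \<in> J \<Longrightarrow> B i \<subseteq> A" "A \<in> \<MM>"
  shows "(\<Sum>i\<in>J. norm (\<kappa> (B i))) \<le> measure var_measure A"
proof -
  have "ennreal (\<Sum>i\<in>J. norm (\<kappa> (B i))) \<le> ennreal (measure var_measure A)"
    using sum_le_variation[OF J(1-4)] by (simp add: measure_var J(5))
  then show ?thesis by simp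
qed

section \<open>Integrals of countably valued functions against a scalar i-measure\<close>

definition integral :: "('a \<Rightarrow> 'e) \<Rightarrow> 'k" where
  "integral f = (\<Sum>\<^sub>\<infinity>e\<in>UNIV. \<kappa> (f -` {e} \<inter> Z) e)"

text \<open>Any countable partition into cells on which f is constant computes the integral: cells
  with the same value are grouped into level sets. Finite variation gives the absolute summability
  that permits the regrouping.\<close>

lemma integral_has_sum:
  assumes I: "countable I" "\<And>i. i \<in> I \<Longrightarrow> B i \<in> \<MM>" "disjoint_family_on B I" "(\<Union>i\<in>I. B i) = Z"
    and f: "\<And>i y. i \<in> I \<Longrightarrow> y \<in> B i \<Longrightarrow> f y = c i" and b: "\<And>i. i \<in> I \<Longrightarrow> norm (c i) \<le> b"
  shows "((\<lambda>i. \<kappa> (B i) (c i)) has_sum integral f) I"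
proof -
  have abs: "(\<lambda>i. \<kappa> (B i) (c i)) abs_summable_on I"
    unfolding abs_summable_iff_bdd_above
  proof (rule bdd_aboveI, clarify)
    fix F assume F: "F \<subseteq> I" "finite F"
    have "(\<Sum>i\<in>F. norm (\<kappa> (B i) (c i))) \<le> (\<Sum>i\<in>F. norm (\<kappa> (B i)) * \<bar>b\<bar>)"
    proof (intro sum_mono order_trans[OF norm_blinfun] mult_left_mono)
      fix i assume "i \<in> F"
      then show "norm (c i) \<le> \<bar>b\<bar>" using b[of i] F(1) by force
    qed simp
    also have "\<dots> = (\<Sum>i\<in>F. norm (\<kappa> (B i))) * \<bar>b\<bar>" by (simp add: sum_distrib_right)
    also have "\<dots> \<le> measure var_measure Z * \<bar>b\<bar>"
      using F I disjoint_family_on_mono[OF F(1) I(3)]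
      by (intro mult_right_mono sum_norm_le_measure) auto
    finally show "(\<Sum>i\<in>F. norm (\<kappa> (B i) (c i))) \<le> measure var_measure Z * \<bar>b\<bar>" .
  qed
  \<comment> \<open>Pairing each cell with its value makes the regrouping an iterated sum, the inner
    one running over all cells of a given value.\<close>
  let ?S = "Sigma UNIV (\<lambda>e. {i\<in>I. c i = e})"
  let ?g = "\<lambda>(e, i). \<kappa> (B i) e"
  have bij: "bij_betw (\<lambda>i. (c i, i)) I ?S"
    by (rule bij_betwI[where g = snd]) auto
  have sS: "?g summable_on ?S"
    using summable_on_reindex_bij_betw[OF bij, of ?g] abs_summable_summable[OF abs] by simp
  have "infsum (\<lambda>i. \<kappa> (B i) (c i)) I = infsum ?g ?S"
    using infsum_reindex_bij_betw[OF bij, of ?g] by simp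
  also have "\<dots> = (\<Sum>\<^sub>\<infinity>e\<in>UNIV. \<Sum>\<^sub>\<infinity>i\<in>{i\<in>I. c i = e}. \<kappa> (B i) e)"
    using infsum_Sigma'_banach[OF sS] by simp
  also have "\<dots> = integral f"
    unfolding integral_def
  proof (rule infsum_cong)
    fix e
    have "((\<lambda>i. \<kappa> (B i) e) has_sum \<kappa> (\<Union>i\<in>{i\<in>I. c i = e}. B i) e) {i\<in>I. c i = e}"
      using I by (intro has_sum_UN) (auto intro: disjoint_family_on_mono countable_subset)
    moreover have "(\<Union>i\<in>{i\<in>I. c i = e}. B i) = f -` {e} \<inter> Z"
      using I(4) f by fastforce
    ultimately show "(\<Sum>\<^sub>\<infinity>i\<in>{i\<in>I. c i = e}. \<kappa> (B i) e) = \<kappa> (f -` {e} \<inter> Z) e"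
      by (simp add: infsumI)
  qed
  finally show ?thesis
    using has_sum_infsum[OF abs_summable_summable[OF abs]] by simp
qed

lemma integral_finite:
  assumes I: "finite I" "\<And>i. i \<in> I \<Longrightarrow> B i \<in> \<MM>" "disjoint_family_on B I" "(\<Union>i\<in>I. B i) = Z"
    and f: "\<And>i y. i \<in> I \<Longrightarrow> y \<in> B i \<Longrightarrow> f y = c i"
  shows "integral f = (\<Sum>i\<in>I. \<kappa> (B i) (c i))"
proof -
  have "norm (c i) \<le> (\<Sum>i\<in>I. norm (c i))" if "i \<in> I" for i
    using I(1) that by (intro member_le_sum) auto
  then have "((\<lambda>i. \<kappa> (B i) (c i)) has_sum integral f) I"
    using I f by (intro integral_has_sum[where f = f and b = "\<Sum>i\<in>I. norm (c i)"] countable_finite)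
  then show ?thesis using has_sum_finite[OF I(1)] has_sum_unique by metis
qed

lemma integral_has_sum_values:
  assumes f: "f \<in> countably_valued Z \<MM>"
  shows "((\<lambda>e. \<kappa> (f -` {e} \<inter> Z) e) has_sum integral f) (f ` Z)"
proof -
  obtain b where "\<And>y. y \<in> Z \<Longrightarrow> norm (f y) \<le> b"
    using f by (auto simp: countably_valued_def bounded_iff)
  then show ?thesis
    using f by (intro integral_has_sum[where b = b]) (auto simp: countably_valued_def disjoint_family_on_def)
qed

text \<open>Both integrals are evaluated on the common refinement of the level sets of f and g, some
  of whose cells may be empty.\<close>

lemma integral_diff_has_sum:
  assumes f: "f \<in> countably_valued Z \<MM>" and g: "g \<in> countably_valued Z \<MM>"
  shows "((\<lambda>p. \<kappa> (f -` {fst p} \<inter> g -` {snd p} \<inter> Z) (fst p - snd p)) has_sum integral f - integral g)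
    (f ` Z \<times> g ` Z)"
proof -
  let ?B = "\<lambda>p. f -` {fst p} \<inter> g -` {snd p} \<inter> Z"
  obtain b where b: "\<And>y. y \<in> Z \<Longrightarrow> norm (f y) \<le> b"
    using f by (auto simp: countably_valued_def bounded_iff)
  obtain b' where b': "\<And>y. y \<in> Z \<Longrightarrow> norm (g y) \<le> b'"
    using g by (auto simp: countably_valued_def bounded_iff)
  have c: "countable (f ` Z \<times> g ` Z)" using f g by (auto simp: countably_valued_def)
  have M: "?B p \<in> \<MM>" for p
  proof -
    have "?B p = (f -` {fst p} \<inter> Z) \<inter> (g -` {snd p} \<inter> Z)" by auto
    then show ?thesis using f g by (auto simp: countably_valued_def)
  qed
  have d: "disjoint_family_on ?B (f ` Z \<times> g ` Z)" by (force simp: disjoint_family_on_def)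
  have U: "(\<Union>p\<in>f ` Z \<times> g ` Z. ?B p) = Z" by auto
  have "((\<lambda>p. \<kappa> (?B p) (fst p)) has_sum integral f) (f ` Z \<times> g ` Z)"
    using b by (intro integral_has_sum[where f = f and b = b] c M d U) auto
  moreover have "((\<lambda>p. \<kappa> (?B p) (snd p)) has_sum integral g) (f ` Z \<times> g ` Z)"
    using b' by (intro integral_has_sum[where f = g and b = b'] c M d U) auto
  ultimately have "((\<lambda>p. \<kappa> (?B p) (fst p) - \<kappa> (?B p) (snd p)) has_sum integral f - integral g) (f ` Z \<times> g ` Z)"
    using has_sum_add[where g = "\<lambda>p. - \<kappa> (?B p) (snd p)" and b = "- integral g"]
    by (fastforce simp: has_sum_uminus)
  then show ?thesis by (simp add: blinfun.diff_right)
qed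

lemma norm_integral_diff_le:
  assumes f: "f \<in> countably_valued Z \<MM>" and g: "g \<in> countably_valued Z \<MM>" and C: "C \<in> \<MM>"
    and eq: "\<And>y. y \<in> Z - C \<Longrightarrow> f y = g y" and le: "\<And>y. y \<in> C \<Longrightarrow> norm (f y - g y) \<le> c" and c: "c \<ge> 0"
  shows "norm (integral f - integral g) \<le> c * measure var_measure C"
proof (rule norm_has_sum_le[OF integral_diff_has_sum[OF f g]])
  fix F assume F: "finite F" "F \<subseteq> f ` Z \<times> g ` Z"
  let ?B = "\<lambda>p. f -` {fst p} \<inter> g -` {snd p} \<inter> Z"
  \<comment> \<open>Pairs with equal entries contribute 0, and the cells of all other pairs lie in
    C.\<close>
  define F' where "F' = {p\<in>F. fst p \<noteq> snd p}"
  have M: "?B p \<in> \<MM>" for p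
  proof -
    have "?B p = (f -` {fst p} \<inter> Z) \<inter> (g -` {snd p} \<inter> Z)" by auto
    then show ?thesis using f g by (auto simp: countably_valued_def)
  qed
  have "norm (\<Sum>p\<in>F. \<kappa> (?B p) (fst p - snd p)) = norm (\<Sum>p\<in>F'. \<kappa> (?B p) (fst p - snd p))"
    using F(1) by (intro arg_cong[of _ _ norm] sum.mono_neutral_right) (auto simp: F'_def)
  also have "\<dots> \<le> (\<Sum>p\<in>F'. c * norm (\<kappa> (?B p)))"
  proof (rule sum_norm_le)
    fix p assume p: "p \<in> F'"
    show "norm (\<kappa> (?B p) (fst p - snd p)) \<le> c * norm (\<kappa> (?B p))"
    proof (cases "?B p = {}")
      case True then show ?thesis by (simp add: True)
    next
      case False
      then obtain y where y: "y \<in> Z" "f y = fst p" "g y = snd p" by auto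
      then have "y \<in> C" using eq[of y] p by (auto simp: F'_def)
      then have "norm (fst p - snd p) \<le> c" using le[of y] y by simp
      then show ?thesis
        using order_trans[OF norm_blinfun mult_left_mono[OF _ norm_ge_zero]] by (simp add: mult.commute)
    qed
  qed
  also have "\<dots> = c * (\<Sum>p\<in>F'. norm (\<kappa> (?B p)))" by (simp add: sum_distrib_left)
  also have "\<dots> \<le> c * measure var_measure C"
  proof (intro mult_left_mono sum_norm_le_measure c C M)
    show "disjoint_family_on ?B F'"
      unfolding disjoint_family_on_def by (auto simp: prod_eq_iff)
    fix p assume p: "p \<in> F'"
    show "?B p \<subseteq> C"
    proof
      fix y assume "y \<in> ?B p"
      then have "y \<in> Z" "f y \<noteq> g y" using p by (auto simp: F'_def)
      then show "y \<in> C" using eq by blast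
    qed
  qed (use F in \<open>auto simp: F'_def\<close>)
  finally show "norm (\<Sum>p\<in>F. \<kappa> (?B p) (fst p - snd p)) \<le> c * measure var_measure C" .
qed

end

lemma radon_var_measure:
  assumes "regular_i_measure sE (*) X \<kappa>" "banach_over sE"
  shows "radon X (scalar_i_measure.var_measure (topspace X) (borel_sets X) \<kappa>)"
proof -
  interpret scalar_i_measure sE "topspace X" "borel_sets X" \<kappa>
    using assms sigma_algebra_borel_sets
    by (auto simp: scalar_i_measure_def scalar_i_measure_axioms_def regular_i_measure_def)
  show ?thesis
    unfolding radon_def
  proof (intro conjI ballI V.finite_measure_axioms space_var sets_var)
    fix A assume A: "A \<in> borel_sets X"
    then obtain K where K: "K \<subseteq> A" "sigma_compactin X K" "\<And>B. B \<in> borel_sets X \<Longrightarrow> B \<subseteq> A - K \<Longrightarrow> \<kappa> B = 0"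
      using assms(1) unfolding regular_i_measure_def by metis
    have "emeasure var_measure (A - K) = 0"
    \<comment> \<open>Compact sets are not known to be closed here, so K may fail to be Borel;
      \<open>emeasure\<close> is 0 by convention off the sigma-algebra.\<close>
    proof (cases "A - K \<in> borel_sets X")
      case True
      have "variation (A - K) \<le> 0"
        unfolding variation_def
      proof (rule SUP_least)
        fix P assume P: "P \<in> fams (A - K)"
        have "\<kappa> B = 0" if "B \<in> P" for B using P that by (intro K(3)) (auto simp: fams_def)
        then show "(\<Sum>B\<in>P. ennreal (norm (\<kappa> B))) \<le> 0" by simp
      qed
      then show ?thesis using True by (simp add: emeasure_var)
    qed (simp add: emeasure_notin_sets sets_var)
    then show "\<exists>K\<subseteq>A. sigma_compactin X K \<and> emeasure var_measure (A - K) = 0" using K by blast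
  qed
qed

subsection \<open>Weak* integrals\<close>

text \<open>By the pointwise bounds the closed sets G n exhaust the Banach space, so by Baire one of
  them contains a ball.\<close>

lemma uniform_boundedness:
  fixes F :: "('f::banach \<Rightarrow>\<^sub>L 'g::real_normed_vector) set"
  assumes "\<And>v. \<exists>b. \<forall>\<phi>\<in>F. norm (\<phi> v) \<le> b"
  obtains S where "S \<ge> 0" "\<And>\<phi>. \<phi> \<in> F \<Longrightarrow> norm \<phi> \<le> S"
proof -
  define G where "G n = (\<Inter>\<phi>\<in>F. {v. norm (blinfun_apply \<phi> v) \<le> real n})" for n :: nat
  have cl: "closed (G n)" for n
    unfolding G_def by (intro closed_INT ballI closed_Collect_le continuous_intros)
  have "\<exists>n. interior (G n) \<noteq> {}"
  proof (rule ccontr)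
    assume "\<not> ?thesis"
    then have "euclidean interior_of \<Union>(range G) = {}"
      using cl by (intro Baire_category_alt) (auto simp: completely_metrizable_space_euclidean)
    moreover have "\<Union>(range G) = UNIV"
    proof (intro equalityI subset_UNIV subsetI)
      fix v
      obtain b where b: "\<forall>\<phi>\<in>F. norm (\<phi> v) \<le> b" using assms by blast
      obtain n :: nat where "b \<le> n" using real_arch_simple by blast
      then have "v \<in> G n" using b by (auto simp: G_def intro: order_trans)
      then show "v \<in> \<Union>(range G)" by blast
    qed
    ultimately show False by simp
  qed
  then obtain n v0 where "v0 \<in> interior (G n)" by blast
  then obtain r where r: "r > 0" "ball v0 r \<subseteq> G n" by (auto simp: mem_interior)
  \<comment> \<open>A vector x of norm r / 2 is the difference of two points of G n, so \<phi> x has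
    norm at most 2 n; rescaling gives 4 n / r.\<close>
  have "norm \<phi> \<le> 4 * real n / r" if "\<phi> \<in> F" for \<phi>
  proof (rule norm_blinfun_bound)
    fix v
    show "norm (\<phi> v) \<le> 4 * real n / r * norm v"
    proof (cases "v = 0")
      case False
      define x where "x = (r / (2 * norm v)) *\<^sub>R v"
      have "norm x = r / 2" using False r(1) by (simp add: x_def)
      then have "v0 + x \<in> G n" "v0 \<in> G n" using r by (auto simp: dist_norm subset_iff)
      then have "norm (\<phi> (v0 + x)) \<le> n" "norm (\<phi> v0) \<le> n" using that by (auto simp: G_def)
      then have "norm (\<phi> x) \<le> 2 * n"
        using norm_triangle_ineq4[of "\<phi> (v0 + x)" "\<phi> v0"] by (simp add: blinfun.add_right)
      then show ?thesis using False r(1) by (simp add: x_def blinfun.scaleR_right field_simps)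
    qed simp
  qed (use r in simp)
  moreover have "4 * real n / r \<ge> 0" using r by simp
  ultimately show thesis by (rule that[rotated])
qed

section \<open>Slices and approximation by step functions\<close>

lemma bounded_linear_blinfun_slice: "bounded_linear (\<lambda>x. blinfun_apply (blinfun_apply B x) v)"
  by (rule bounded_linear_compose[OF blinfun.bounded_linear_left blinfun.bounded_linear_right])

lemma slice_apply: "blinfun_apply (slice \<mu> v A) x = blinfun_apply (blinfun_apply (\<mu> A) x) v"
  unfolding slice_def by (simp add: bounded_linear_Blinfun_apply bounded_linear_blinfun_slice)

lemma (in sigma_algebra) countably_valued_partition:
  fixes c :: "'i \<Rightarrow> 'e::real_normed_vector"
  assumes I: "finite I" "\<And>i. i \<in> I \<Longrightarrow> B i \<in> M" "disjoint_family_on B I" "(\<Union>i\<in>I. B i) = \<Omega>"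
  obtains s where "s \<in> countably_valued \<Omega> M" "\<And>i y. i \<in> I \<Longrightarrow> y \<in> B i \<Longrightarrow> s y = c i"
proof -
  define s where "s y = c (THE i. i \<in> I \<and> y \<in> B i)" for y
  have s: "s y = c i" if "i \<in> I" "y \<in> B i" for i y
  proof -
    have "(THE i. i \<in> I \<and> y \<in> B i) = i"
    proof (rule the_equality)
      fix j assume "j \<in> I \<and> y \<in> B j"
      then show "j = i" using disjoint_family_onD[OF I(3), of i j] that by blast
    qed (use that in simp)
    then show ?thesis by (simp add: s_def)
  qed
  have "s ` \<Omega> \<subseteq> c ` I" using I(4) s by auto
  then have "finite (s ` \<Omega>)" using I(1) finite_subset by blast
  moreover have "s -` {e} \<inter> \<Omega> \<in> M" for e
  proof -
    have "s -` {e} \<inter> \<Omega> = (\<Union>i\<in>{i\<in>I. c i = e}. B i)" using I(4) s by fastforce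
    also have "\<dots> \<in> M" using I by (intro finite_UN) auto
    finally show ?thesis .
  qed
  ultimately have "s \<in> countably_valued \<Omega> M"
    by (auto simp: countably_valued_def finite_imp_bounded countable_finite)
  then show thesis using that s by blast
qed

text \<open>The values of u of norm at least e form a compact set, which finitely many balls of
  radius e cover; their preimages, made disjoint, are the cells.\<close>

lemma C0_partition:
  assumes u: "u \<in> C0 X" and e: "e > 0"
  obtains n :: nat and A c where "\<And>i. i \<le> n \<Longrightarrow> A i \<in> borel_sets X" "disjoint_family_on A {..n}"
    "(\<Union>i\<le>n. A i) = topspace X" "\<And>i y. i \<le> n \<Longrightarrow> y \<in> A i \<Longrightarrow> norm (u y - c i) \<le> e"
proof -
  interpret B: sigma_algebra "topspace X" "borel_sets X" by (rule sigma_algebra_borel_sets)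
  let ?K = "{x\<in>topspace X. e \<le> norm (u x)}"
  have "compact (u ` ?K)" using image_compactin[OF C0_compactin[OF u e] C0_continuous[OF u]] by simp
  then obtain D where D: "finite D" "u ` ?K \<subseteq> (\<Union>z\<in>D. ball z e)"
    by (rule compactE_image[of "u ` ?K" "u ` ?K" "\<lambda>z. ball z e"]) (use e in auto)
  obtain z n where z: "D = z ` {i. i < (n::nat)}" using finite_imp_nat_seg_image_inj_on[OF D(1)] by metis
  define W where "W i = {y\<in>topspace X. norm (u y - z i) < e}" for i
  have WB: "W i \<in> borel_sets X" for i
  proof -
    have "openin X {y\<in>topspace X. u y \<in> ball (z i) e}"
      by (rule openin_continuous_map_preimage[OF C0_continuous[OF u]]) simp
    then show ?thesis
      by (auto simp: W_def dist_norm norm_minus_commute intro: borel_sets_openin)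
  qed
  \<comment> \<open>The extra cell with index n collects the points outside all balls; there u has
    norm below e and the value 0 serves.\<close>
  define A where "A i = (if i < n then W i - (\<Union>j<i. W j) else topspace X - (\<Union>j<n. W j))" for i
  define c where "c i = (if i < n then z i else 0)" for i
  show thesis
  proof (rule that[of n A c])
    show "A i \<in> borel_sets X" for i using WB by (auto simp: A_def)
    show "disjoint_family_on A {..n}"
      unfolding disjoint_family_on_def
    proof (intro ballI impI)
      fix i j assume "i \<in> {..n}" "j \<in> {..n}" "i \<noteq> j"
      then show "A i \<inter> A j = {}" by (cases i j rule: linorder_cases) (auto simp: A_def)
    qed
    show "(\<Union>i\<le>n. A i) = topspace X"
    proof (intro equalityI subsetI)
      fix y assume y: "y \<in> topspace X"
      show "y \<in> (\<Union>i\<le>n. A i)"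
      proof (cases "\<exists>j<n. y \<in> W j")
        case True
        define i where "i = (LEAST j. j < n \<and> y \<in> W j)"
        have i: "i < n \<and> y \<in> W i" unfolding i_def using True by (rule LeastI_ex)
        have "y \<notin> W j" if "j < i" for j
          using not_less_Least[of j "\<lambda>j. j < n \<and> y \<in> W j"] that i by (auto simp: i_def)
        then have "y \<in> A i" using i by (auto simp: A_def)
        then show ?thesis using i by force
      next
        case False
        then have "y \<in> A n" using y by (auto simp: A_def)
        then show ?thesis by blast
      qed
    qed (auto simp: A_def W_def split: if_splits)
    fix i y assume i: "i \<le> n" "y \<in> A i"
    show "norm (u y - c i) \<le> e"
    proof (cases "i < n")
      case True then show ?thesis using i by (auto simp: A_def c_def W_def)
    next
      case False
      have "y \<notin> ?K"
      proof
        assume yK: "y \<in> ?K"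
        then obtain j where "j < n" "u y \<in> ball (z j) e" using D(2) z by force
        then have "y \<in> W j" using yK by (simp add: W_def dist_norm norm_minus_commute)
        then show False using i False \<open>j < n\<close> by (auto simp: A_def)
      qed
      then show ?thesis using i False by (auto simp: A_def c_def)
    qed
  qed
qed

section \<open>Semivariation and the integral of a weak* i-measure\<close>

locale weak_star_measure = E: banach_over sE + sigma_algebra Z \<MM>
  for sE :: "'k::real_or_complex \<Rightarrow> 'e::banach \<Rightarrow> 'e" and Z :: "'a set" and \<MM> +
  fixes sF :: "'k \<Rightarrow> 'f::banach \<Rightarrow> 'f" and \<mu> :: "'a set \<Rightarrow> ('e \<Rightarrow>\<^sub>L ('f \<Rightarrow>\<^sub>L 'k))"
  assumes weak_star_i_measure: "weak_star_i_measure sE sF \<MM> \<mu>"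
begin

sublocale S: scalar_i_measure sE Z \<MM> "slice \<mu> v" for v
  using weak_star_i_measure by unfold_locales (simp add: weak_star_i_measure_def)

definition disjoint_sums :: "('f \<Rightarrow>\<^sub>L 'k) set" where
  "disjoint_sums = {(\<Sum>n<N. \<mu> (A n) (x n)) | (N::nat) A x.
       (\<forall>n<N. A n \<in> \<MM>) \<and> disjoint_family_on A {..<N} \<and> (\<forall>n<N. norm (x n) \<le> 1)}"

lemma total_semivariation_eq: "total_semivariation \<MM> \<mu> = (SUP \<phi>\<in>disjoint_sums. ennreal (norm \<phi>))"
  unfolding total_semivariation_def disjoint_sums_def by (rule arg_cong[where f = Sup]) blast

text \<open>At a fixed v all these sums are bounded by the variation of one slice; uniform
  boundedness on the Banach space F removes the dependence on v.\<close>

lemma disjoint_sums_bounded: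
  obtains S where "S \<ge> 0" "\<And>\<phi>. \<phi> \<in> disjoint_sums \<Longrightarrow> norm \<phi> \<le> S"
proof -
  have "\<exists>b. \<forall>\<phi>\<in>disjoint_sums. norm (\<phi> v) \<le> b" for v
  proof (intro exI[of _ "measure (S.var_measure v) Z"] ballI)
    fix \<phi> assume "\<phi> \<in> disjoint_sums"
    then obtain N :: nat and A x where A: "\<phi> = (\<Sum>n<N. \<mu> (A n) (x n))"
        "\<forall>n<N. A n \<in> \<MM>" "disjoint_family_on A {..<N}" "\<forall>n<N. norm (x n) \<le> 1"
      unfolding disjoint_sums_def by blast
    have "norm (\<phi> v) = norm (\<Sum>n<N. slice \<mu> v (A n) (x n))"
      by (simp add: A(1) blinfun.sum_left slice_apply)
    also have "\<dots> \<le> (\<Sum>n<N. norm (slice \<mu> v (A n)))"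
    proof (rule sum_norm_le)
      fix n assume "n \<in> {..<N}"
      then show "norm (slice \<mu> v (A n) (x n)) \<le> norm (slice \<mu> v (A n))"
        using order_trans[OF norm_blinfun mult_left_mono[OF _ norm_ge_zero]] A(4) by fastforce
    qed
    also have "\<dots> \<le> measure (S.var_measure v) Z"
      using A(2,3) sets_into_space by (intro S.sum_norm_le_measure) auto
    finally show "norm (\<phi> v) \<le> measure (S.var_measure v) Z" .
  qed
  then show thesis using uniform_boundedness[of disjoint_sums] that by blast
qed

text \<open>S is kept arbitrary because three bounds are used later: the norm of T, the total
  semivariation itself, and the bound from \<open>disjoint_sums_bounded\<close> for a competing
  measure.\<close>

context
  fixes S :: real
  assumes S: "\<And>\<phi>. \<phi> \<in> disjoint_sums \<Longrightarrow> norm \<phi> \<le> S"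
begin

lemma S_nonneg: "S \<ge> 0"
proof -
  have "(0 :: 'f \<Rightarrow>\<^sub>L 'k) \<in> disjoint_sums"
    unfolding disjoint_sums_def
    by (rule CollectI, intro exI[of _ 0] exI[of _ "\<lambda>_. {}"]) (auto simp: disjoint_family_on_def)
  then show ?thesis using S by force
qed

lemma norm_sum_le:
  assumes J: "finite J" "\<And>i. i \<in> J \<Longrightarrow> B i \<in> \<MM>" "disjoint_family_on B J"
    and x: "\<And>i. i \<in> J \<Longrightarrow> norm (x i) \<le> c" and c: "c \<ge> 0"
  shows "norm (\<Sum>i\<in>J. \<mu> (B i) (x i)) \<le> c * S"
proof (cases "c = 0")
  case True
  then show ?thesis using x by simp
next
  case False
  then have c: "c > 0" using c by simp
  obtain h where h: "bij_betw h {..<card J} J"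
    using ex_bij_betw_nat_finite[OF J(1)] by (auto simp: atLeast0LessThan)
  have hJ: "h n \<in> J" if "n < card J" for n using h that by (auto simp: bij_betw_def)
  have "(\<Sum>n<card J. \<mu> (B (h n)) ((1/c) *\<^sub>R x (h n))) \<in> disjoint_sums"
    unfolding disjoint_sums_def
  proof (rule CollectI, intro exI conjI allI impI)
    show "disjoint_family_on (\<lambda>n. B (h n)) {..<card J}"
      unfolding disjoint_family_on_def
    proof (intro ballI impI)
      fix m n assume "m \<in> {..<card J}" "n \<in> {..<card J}" "m \<noteq> n"
      then show "B (h m) \<inter> B (h n) = {}"
        using h by (intro disjoint_family_onD[OF J(3)]) (auto simp: bij_betw_def inj_on_def)
    qed
  qed (use hJ J(2) x c in auto)
  then have "norm (\<Sum>n<card J. \<mu> (B (h n)) ((1/c) *\<^sub>R x (h n))) \<le> S" by (rule S)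
  also have "(\<Sum>n<card J. \<mu> (B (h n)) ((1/c) *\<^sub>R x (h n))) = (\<Sum>i\<in>J. \<mu> (B i) ((1/c) *\<^sub>R x i))"
    by (rule sum.reindex_bij_betw[OF h])
  also have "\<dots> = (1/c) *\<^sub>R (\<Sum>i\<in>J. \<mu> (B i) (x i))"
    by (simp add: blinfun.scaleR_right scaleR_sum_right)
  finally show ?thesis using c by (simp add: field_simps)
qed

text \<open>The variation of a slice would give a bound with unknown dependence on v. Forming the
  finite sums in the dual of F before applying them to v gives a bound proportional to the norm of
  v.\<close>

lemma norm_integral_diff_le:
  assumes f: "f \<in> countably_valued Z \<MM>" and g: "g \<in> countably_valued Z \<MM>"
    and c: "c \<ge> 0" "\<And>y. y \<in> Z \<Longrightarrow> norm (f y - g y) \<le> c"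
  shows "norm (S.integral v f - S.integral v g) \<le> c * S * norm v"
proof (rule norm_has_sum_le[OF S.integral_diff_has_sum[OF f g]])
  fix F assume F: "finite F" "F \<subseteq> f ` Z \<times> g ` Z"
  let ?B = "\<lambda>p. f -` {fst p} \<inter> g -` {snd p} \<inter> Z"
  define F' where "F' = {p\<in>F. ?B p \<noteq> {}}"
  have M: "?B p \<in> \<MM>" for p
  proof -
    have "?B p = (f -` {fst p} \<inter> Z) \<inter> (g -` {snd p} \<inter> Z)" by auto
    then show ?thesis using f g by (auto simp: countably_valued_def)
  qed
  have "(\<Sum>p\<in>F. slice \<mu> v (?B p) (fst p - snd p)) = (\<Sum>p\<in>F'. slice \<mu> v (?B p) (fst p - snd p))"
  proof (rule sum.mono_neutral_right)
    show "\<forall>p\<in>F - F'. slice \<mu> v (?B p) (fst p - snd p) = 0"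
    proof
      fix p assume "p \<in> F - F'"
      then have "?B p = {}" by (auto simp: F'_def)
      then show "slice \<mu> v (?B p) (fst p - snd p) = 0" by (simp only: S.empty blinfun.zero_left)
    qed
  qed (use F in \<open>auto simp: F'_def\<close>)
  also have "\<dots> = (\<Sum>p\<in>F'. \<mu> (?B p) (fst p - snd p)) v"
    by (simp add: blinfun.sum_left slice_apply)
  finally have eq: "norm (\<Sum>p\<in>F. slice \<mu> v (?B p) (fst p - snd p)) =
    norm ((\<Sum>p\<in>F'. \<mu> (?B p) (fst p - snd p)) v)" by simp
  have "norm (\<Sum>p\<in>F'. \<mu> (?B p) (fst p - snd p)) \<le> c * S"
  proof (intro norm_sum_le M c)
    show "disjoint_family_on ?B F'"
      unfolding disjoint_family_on_def by (auto simp: prod_eq_iff)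
    fix p assume "p \<in> F'"
    then obtain y where "y \<in> Z" "f y = fst p" "g y = snd p" by (auto simp: F'_def)
    then show "norm (fst p - snd p) \<le> c" using c(2)[of y] by simp
  qed (use F in \<open>auto simp: F'_def\<close>)
  then show "norm (\<Sum>p\<in>F. slice \<mu> v (?B p) (fst p - snd p)) \<le> c * S * norm v"
    unfolding eq by (rule order_trans[OF norm_blinfun mult_right_mono]) simp
qed

lemma zero_countably_valued: "(\<lambda>_. 0 :: 'e) \<in> countably_valued Z \<MM>"
proof -
  have "(\<lambda>_. 0 :: 'e) ` Z \<subseteq> {0}" by auto
  then have "finite ((\<lambda>_. 0 :: 'e) ` Z)" using finite_subset by blast
  then show ?thesis
    by (auto simp: countably_valued_def vimage_def intro: countable_finite finite_imp_bounded)
qed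

lemma integral_zero: "S.integral v (\<lambda>_. 0) = 0"
  using S.integral_finite[of "{0::nat}" "\<lambda>_. Z" "\<lambda>_. 0" "\<lambda>_. 0" v] by (simp add: disjoint_family_on_def)

text \<open>This gives meaning to \<open>Blinfun\<close> in the definition of the weak* integral, as
  \<open>J_apply\<close> requires.\<close>

lemma bounded_linear_integral:
  assumes f: "f \<in> countably_valued Z \<MM>" shows "bounded_linear (\<lambda>v. S.integral v f)"
proof -
  obtain b where b: "\<And>y. y \<in> Z \<Longrightarrow> norm (f y) \<le> b"
    using f by (auto simp: countably_valued_def bounded_iff)
  have hs: "((\<lambda>e. \<mu> (f -` {e} \<inter> Z) e v) has_sum S.integral v f) (f ` Z)" for v
    using S.integral_has_sum_values[OF f, of v] by (simp add: slice_apply)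
  show ?thesis
  proof (rule bounded_linear_intro)
    fix v w
    have "((\<lambda>e. \<mu> (f -` {e} \<inter> Z) e (v + w)) has_sum S.integral v f + S.integral w f) (f ` Z)"
      using has_sum_add[OF hs hs] by (simp add: blinfun.add_right)
    then show "S.integral (v + w) f = S.integral v f + S.integral w f"
      using hs has_sum_unique by blast
  next
    fix r v
    have "((\<lambda>e. \<mu> (f -` {e} \<inter> Z) e (r *\<^sub>R v)) has_sum r *\<^sub>R S.integral v f) (f ` Z)"
      using has_sum_bounded_linear[OF bounded_linear_scaleR_right hs] by (simp add: blinfun.scaleR_right o_def)
    then show "S.integral (r *\<^sub>R v) f = r *\<^sub>R S.integral v f"
      using hs has_sum_unique by blast
  next
    fix v
    have "norm (S.integral v f - S.integral v (\<lambda>_. 0)) \<le> \<bar>b\<bar> * S * norm v"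
      using b by (intro norm_integral_diff_le f zero_countably_valued) force+
    then show "norm (S.integral v f) \<le> norm v * (\<bar>b\<bar> * S)"
      by (simp add: integral_zero mult.commute)
  qed
qed

abbreviation J :: "('a \<Rightarrow> 'e) \<Rightarrow> ('f \<Rightarrow>\<^sub>L 'k)" where
  "J f \<equiv> weak_star_integral_countable Z \<mu> f"

lemma J_apply: "f \<in> countably_valued Z \<MM> \<Longrightarrow> J f v = S.integral v f"
  unfolding weak_star_integral_countable_def
  using bounded_linear_integral
  by (simp add: bounded_linear_Blinfun_apply S.integral_def slice_apply)

lemma norm_J_diff_le:
  assumes "f \<in> countably_valued Z \<MM>" "g \<in> countably_valued Z \<MM>"
    "c \<ge> 0" "\<And>y. y \<in> Z \<Longrightarrow> norm (f y - g y) \<le> c"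
  shows "norm (J f - J g) \<le> c * S"
proof (rule norm_blinfun_bound)
  show "norm ((J f - J g) v) \<le> c * S * norm v" for v
    using norm_integral_diff_le[OF assms] by (simp add: blinfun.diff_left J_apply assms(1,2))
qed (use S_nonneg assms in simp)

text \<open>The indices of the two sequences are independent: t = s gives the Cauchy property, and m
  = n shows that the limit does not depend on the sequence.\<close>

lemma J_diff_small:
  assumes s: "\<And>n. s n \<in> countably_valued Z \<MM>" "uniform_limit Z s f sequentially"
    and t: "\<And>n. t n \<in> countably_valued Z \<MM>" "uniform_limit Z t f sequentially" and e: "e > 0"
  obtains N where "\<And>m n. m \<ge> N \<Longrightarrow> n \<ge> N \<Longrightarrow> norm (J (s m) - J (t n)) < e"
proof -
  define d where "d = e / (2 * (S + 1))"
  have d: "d > 0" using e S_nonneg by (simp add: d_def)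
  have "eventually (\<lambda>n. \<forall>y\<in>Z. dist (s n y) (f y) < d) sequentially"
    "eventually (\<lambda>n. \<forall>y\<in>Z. dist (t n y) (f y) < d) sequentially"
    using s(2) t(2) d by (auto simp: uniform_limit_iff)
  then obtain N1 N2 where N: "\<And>n y. n \<ge> N1 \<Longrightarrow> y \<in> Z \<Longrightarrow> dist (s n y) (f y) < d"
      "\<And>n y. n \<ge> N2 \<Longrightarrow> y \<in> Z \<Longrightarrow> dist (t n y) (f y) < d"
    unfolding eventually_sequentially by blast
  show thesis
  proof (rule that)
    fix m n assume mn: "m \<ge> max N1 N2" "n \<ge> max N1 N2"
    have "norm (J (s m) - J (t n)) \<le> (2 * d) * S"
    proof (rule norm_J_diff_le[OF s(1) t(1)])
      fix y assume "y \<in> Z"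
      then have "dist (s m y) (f y) < d" "dist (t n y) (f y) < d" using N mn by auto
      then show "norm (s m y - t n y) \<le> 2 * d"
        using dist_triangle2[of "s m y" "t n y" "f y"] by (simp add: dist_norm)
    qed (use d in simp)
    also have "\<dots> < (2 * d) * (S + 1)" using d by (intro mult_strict_left_mono) auto
    also have "\<dots> = e" using S_nonneg by (simp add: d_def field_simps add_nonneg_eq_0_iff)
    finally show "norm (J (s m) - J (t n)) < e" .
  qed
qed

lemma weak_star_integral_LIMSEQ:
  assumes s: "\<And>n. s n \<in> countably_valued Z \<MM>" "uniform_limit Z s f sequentially"
  shows "(\<lambda>n. J (s n)) \<longlonglongrightarrow> weak_star_integral Z \<MM> \<mu> f"
proof -
  have "Cauchy (\<lambda>n. J (s n))"
    unfolding Cauchy_def dist_norm using J_diff_small[OF s s] by metis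
  then obtain \<phi> where phi: "(\<lambda>n. J (s n)) \<longlonglongrightarrow> \<phi>"
    using Cauchy_convergent_iff convergent_def by blast
  have "weak_star_integral Z \<MM> \<mu> f = \<phi>"
    unfolding weak_star_integral_def
  proof (rule the_equality)
    fix \<psi> assume "\<exists>t. (\<forall>n. t n \<in> countably_valued Z \<MM>) \<and> uniform_limit Z t f sequentially \<and> (\<lambda>n. J (t n)) \<longlonglongrightarrow> \<psi>"
    then obtain t where t: "\<And>n. t n \<in> countably_valued Z \<MM>" "uniform_limit Z t f sequentially"
        "(\<lambda>n. J (t n)) \<longlonglongrightarrow> \<psi>" by blast
    have "(\<lambda>n. J (s n) - J (t n)) \<longlonglongrightarrow> 0"
    proof (rule LIMSEQ_I)
      fix r :: real assume "r > 0"
      then obtain N where "\<And>m n. m \<ge> N \<Longrightarrow> n \<ge> N \<Longrightarrow> norm (J (s m) - J (t n)) < r"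
        using J_diff_small[OF s t(1,2)] by blast
      then show "\<exists>no. \<forall>n\<ge>no. norm (J (s n) - J (t n) - 0) < r" by auto
    qed
    moreover have "(\<lambda>n. J (s n) - J (t n)) \<longlonglongrightarrow> \<phi> - \<psi>" by (intro tendsto_diff phi t(3))
    ultimately have "\<phi> - \<psi> = 0" using LIMSEQ_unique by blast
    then show "\<psi> = \<phi>" by simp
  qed (use s phi in blast)
  then show ?thesis using phi by simp
qed

lemma norm_weak_star_integral_le:
  assumes s: "\<And>n. s n \<in> countably_valued Z \<MM>" "uniform_limit Z s f sequentially"
    and f: "\<And>y. y \<in> Z \<Longrightarrow> norm (f y) \<le> b" and b: "b \<ge> 0"
  shows "norm (weak_star_integral Z \<MM> \<mu> f) \<le> b * S"
proof (rule field_le_epsilon)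
  fix e :: real assume e: "e > 0"
  define d where "d = e / (S + 1)"
  have d: "d > 0" using e S_nonneg by (simp add: d_def)
  have "eventually (\<lambda>n. \<forall>y\<in>Z. dist (s n y) (f y) < d) sequentially"
    using s(2) d by (auto simp: uniform_limit_iff)
  then have "eventually (\<lambda>n. norm (J (s n)) \<le> b * S + e) sequentially"
  proof eventually_elim
    fix n assume n: "\<forall>y\<in>Z. dist (s n y) (f y) < d"
    have "norm (J (s n) - J (\<lambda>_. 0)) \<le> (b + d) * S"
    proof (rule norm_J_diff_le[OF s(1) zero_countably_valued])
      fix y assume y: "y \<in> Z"
      have "norm (s n y) \<le> norm (f y) + norm (s n y - f y)" by (rule norm_triangle_sub)
      then show "norm (s n y - 0) \<le> b + d" using f[OF y] n y by (force simp: dist_norm)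
    qed (use b d in simp)
    moreover have "J (\<lambda>_. 0) = 0"
      by (rule blinfun_eqI) (simp add: J_apply zero_countably_valued integral_zero)
    moreover have "d * S \<le> d * (S + 1)" using d by (intro mult_left_mono) auto
    moreover have "d * (S + 1) = e" using S_nonneg by (simp add: d_def)
    ultimately show "norm (J (s n)) \<le> b * S + e" by (simp add: distrib_right)
  qed
  then show "norm (weak_star_integral Z \<MM> \<mu> f) \<le> b * S + e"
    by (rule tendsto_upperbound[OF tendsto_norm[OF weak_star_integral_LIMSEQ[OF s]]]) simp
qed

end

end

subsection \<open>The representation theorem\<close>

text \<open>Rounding f down to multiples of 1 / (n + 1) keeps the values 0 and 1 exact. In the
  uniqueness proof the staircase therefore agrees with a multiple of the indicator wherever f agrees
  with the indicator.\<close>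

lemma C0_staircase:
  fixes f :: "'a \<Rightarrow> real" and x :: "'e::real_normed_vector"
  assumes f: "f \<in> C0 X" "\<And>y. 0 \<le> f y" "\<And>y. f y \<le> 1"
  obtains s where "s \<in> countably_valued (topspace X) (borel_sets X)"
    "\<And>y. y \<in> topspace X \<Longrightarrow> \<exists>a. 0 \<le> a \<and> a \<le> 1 \<and> s y = a *\<^sub>R x \<and> \<bar>f y - a\<bar> \<le> 1 / Suc n \<and>
       (f y = 0 \<longrightarrow> a = 0) \<and> (f y = 1 \<longrightarrow> a = 1)"
proof -
  interpret B: sigma_algebra "topspace X" "borel_sets X" by (rule sigma_algebra_borel_sets)
  define N where "N = real (Suc n)"
  have N: "N > 0" by (simp add: N_def)
  define G where "G k = {y\<in>topspace X. real k / N \<le> f y}" for k :: nat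
  have GB: "G k \<in> borel_sets X" for k
    using borel_sets_closedin[OF closedin_norm_ge[OF C0_continuous[OF f(1)], of "real k / N"]] f(2)
    by (simp add: G_def)
  \<comment> \<open>On A k the product N * f has integer part k. As f is at most 1, the top cell k =
    n + 1 is exactly the set where f = 1.\<close>
  define A where "A k = G k - G (Suc k)" for k
  have A_iff: "y \<in> A k \<longleftrightarrow> y \<in> topspace X \<and> real k \<le> N * f y \<and> N * f y < real k + 1" for y k
    using N by (auto simp: A_def G_def field_simps)
  have "(\<Union>k\<le>Suc n. A k) = topspace X"
  proof (intro equalityI subsetI)
    fix y assume y: "y \<in> topspace X"
    define k where "k = nat \<lfloor>N * f y\<rfloor>"
    have Nf: "0 \<le> N * f y" "N * f y \<le> N" using N f(2,3)[of y] by (auto simp: mult_le_cancel_left1)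
    then have "real k \<le> N * f y" "N * f y < real k + 1" by (auto simp: k_def) 
    then have "y \<in> A k" using y by (simp add: A_iff)
    moreover have "real k \<le> N" using \<open>real k \<le> N * f y\<close> Nf(2) by linarith
    then have "k \<le> Suc n" unfolding N_def by (simp only: of_nat_le_iff)
    ultimately show "y \<in> (\<Union>k\<le>Suc n. A k)" by blast
  qed (auto simp: A_iff)
  moreover have "disjoint_family_on A {..Suc n}"
    unfolding disjoint_family_on_def
  proof (intro ballI impI equals0I)
    fix i j :: nat and y assume "i \<noteq> j" "y \<in> A i \<inter> A j"
    then have "real i < real (j + 1)" "real j < real (i + 1)" by (simp_all add: A_iff)
    then show False using \<open>i \<noteq> j\<close> unfolding of_nat_less_iff by linarith
  qed
  moreover have "A k \<in> borel_sets X" for k unfolding A_def by (intro B.Diff GB)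
  ultimately obtain s where s: "s \<in> countably_valued (topspace X) (borel_sets X)"
      "\<And>k y. k \<in> {..Suc n} \<Longrightarrow> y \<in> A k \<Longrightarrow> s y = (real k / N) *\<^sub>R x"
    by (rule_tac B.countably_valued_partition[of "{..Suc n}" A "\<lambda>k. (real k / N) *\<^sub>R x"]) auto
  show thesis
  proof (rule that[OF s(1)])
    fix y assume "y \<in> topspace X"
    then obtain k where k: "k \<le> Suc n" "y \<in> A k" using \<open>(\<Union>k\<le>Suc n. A k) = topspace X\<close> by blast
    then have fk: "real k \<le> N * f y" "N * f y < real k + 1" by (auto simp: A_iff)
    have "k = Suc n" if "f y = 1"
    proof -
      have "real (Suc n) < real (k + 1)" using fk(2) that by (simp add: N_def)
      then show ?thesis using k(1) by linarith
    qed
    then have 1: "f y = 1 \<longrightarrow> real k / N = 1" by (simp add: N_def)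
    have 0: "f y = 0 \<longrightarrow> real k / N = 0" using fk(1) by auto
    have "f y - real k / N = (N * f y - real k) / N" using N by (simp add: diff_divide_distrib)
    moreover have "\<bar>N * f y - real k\<bar> \<le> 1" using fk by linarith
    ultimately have near: "\<bar>f y - real k / N\<bar> \<le> 1 / Suc n"
      using N by (simp add: N_def divide_right_mono)
    have "real k / N \<le> 1" using k(1) by (simp add: N_def)
    moreover have "0 \<le> real k / N" using N by simp
    moreover have "s y = (real k / N) *\<^sub>R x" using s(2)[of k y] k by simp
    ultimately show "\<exists>a. 0 \<le> a \<and> a \<le> 1 \<and> s y = a *\<^sub>R x \<and> \<bar>f y - a\<bar> \<le> 1 / Suc n \<and>
       (f y = 0 \<longrightarrow> a = 0) \<and> (f y = 1 \<longrightarrow> a = 1)"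
      using 0 1 near by blast
  qed
qed

lemma uniform_limit_inverse_SucI:
  fixes s :: "nat \<Rightarrow> 'a \<Rightarrow> 'e::real_normed_vector"
  assumes "\<And>n y. y \<in> Z \<Longrightarrow> norm (f y - s n y) \<le> c / Suc n"
  shows "uniform_limit Z s f sequentially"
  unfolding uniform_limit_iff
proof (intro allI impI)
  fix e :: real assume e: "e > 0"
  have "(\<lambda>n. c / Suc n) \<longlonglongrightarrow> 0"
    using tendsto_mult_right_zero[OF LIMSEQ_inverse_real_of_nat, of c] by (simp add: divide_inverse)
  then have "eventually (\<lambda>n. c / Suc n < e) sequentially" using e by (rule order_tendstoD)
  then show "\<forall>\<^sub>F n in sequentially. \<forall>y\<in>Z. dist (s n y) (f y) < e"
    by eventually_elim (metis assms dist_norm norm_minus_commute le_less_trans)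
qed

lemma scale_dual_apply: "blinfun_apply (scale_dual c \<phi>) v = c * blinfun_apply \<phi> v"
  unfolding scale_dual_def
  by (simp add: bounded_linear_Blinfun_apply bounded_linear_const_mult blinfun.bounded_linear_right)

section \<open>The operator and its representing measure\<close>

locale C0_operator = E: banach_over sE + F: banach_over sF
  for sE :: "'k::real_or_complex \<Rightarrow> 'e::banach \<Rightarrow> 'e" and sF :: "'k \<Rightarrow> 'f::banach \<Rightarrow> 'f" +
  fixes X :: "'a topology" and T :: "('a \<Rightarrow> 'e) \<Rightarrow> ('f \<Rightarrow>\<^sub>L 'k)"
  assumes locally_compact: "locally_compact_space X" and Hausdorff: "Hausdorff_space X"
    and T: "continuous_linear_on_C0 sE sF X T"
begin

lemma T_dual: "u \<in> C0 X \<Longrightarrow> T u (sF c v) = c * T u v"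
  using T unfolding continuous_linear_on_C0_def dual_def Lin_def by blast

lemma T_add: "u \<in> C0 X \<Longrightarrow> w \<in> C0 X \<Longrightarrow> T (\<lambda>x. u x + w x) = T u + T w"
  using T unfolding continuous_linear_on_C0_def by blast

lemma T_scale: "u \<in> C0 X \<Longrightarrow> T (\<lambda>x. sE c (u x)) = scale_dual c (T u)"
  using T unfolding continuous_linear_on_C0_def by blast

lemma T_scaleR: "u \<in> C0 X \<Longrightarrow> T (\<lambda>x. r *\<^sub>R u x) = r *\<^sub>R T u"
  using T_scale[of u "of_real r"]
  by (intro blinfun_eqI) (simp add: E.scale_of_real scale_dual_apply blinfun.scaleR_left scaleR_conv_of_real)

lemma T_zero: "T (\<lambda>_. 0) = 0"
  using T_scaleR[OF C0_zero, of 0] by simp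

abbreviation K :: real where "K \<equiv> norm_on_C0 X T"

text \<open>Continuity at 0 is turned into boundedness by scaling. Without it the real
  \<open>Sup\<close> in \<open>norm_on_C0\<close> would carry no information.\<close>

lemma K_bdd: "bdd_above {norm (T u) | u. u \<in> C0 X \<and> sup_norm u \<le> 1}"
proof -
  have "\<forall>u\<in>C0 X. \<forall>\<epsilon>>0. \<exists>\<delta>>0. \<forall>w\<in>C0 X. sup_norm (\<lambda>x. w x - u x) < \<delta> \<longrightarrow> norm (T w - T u) < \<epsilon>"
    using T unfolding continuous_linear_on_C0_def by blast
  from this[rule_format, OF C0_zero zero_less_one]
  obtain \<delta> where d: "\<delta> > 0" "\<And>w. w \<in> C0 X \<Longrightarrow> sup_norm w < \<delta> \<Longrightarrow> norm (T w) < 1"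
    by (auto simp: T_zero)
  have "norm (T u) \<le> 2 / \<delta>" if u: "u \<in> C0 X" "sup_norm u \<le> 1" for u
  proof -
    have "norm ((\<delta>/2) *\<^sub>R u x) \<le> \<delta>/2" for x
      using norm_le_sup_norm[OF u(1), of x] u(2) d(1) by simp
    then have "sup_norm (\<lambda>x. (\<delta>/2) *\<^sub>R u x) \<le> \<delta>/2" by (rule sup_norm_le)
    also have "\<dots> < \<delta>" using d(1) by simp
    finally have "norm (T (\<lambda>x. (\<delta>/2) *\<^sub>R u x)) < 1" by (intro d(2) C0_scaleR u)
    then show ?thesis using d(1) by (simp add: T_scaleR u(1) field_simps)
  qed
  then show ?thesis by (auto intro!: bdd_aboveI)
qed

lemma norm_T_le:
  assumes u: "u \<in> C0 X" "\<And>x. norm (u x) \<le> b"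
  shows "norm (T u) \<le> K * b"
proof (cases "b = 0")
  case True
  then have "u = (\<lambda>_. 0)" using u(2) by auto
  then show ?thesis by (simp add: T_zero True)
next
  case False
  then have b: "b > 0" using u(2)[of undefined] norm_ge_zero[of "u undefined"] by linarith
  have "sup_norm (\<lambda>x. (1/b) *\<^sub>R u x) \<le> 1"
    using u(2) b by (intro sup_norm_le) (simp add: field_simps)
  then have "norm (T (\<lambda>x. (1/b) *\<^sub>R u x)) \<le> K"
    unfolding norm_on_C0_def using C0_scaleR[OF u(1)] by (intro cSup_upper K_bdd) auto
  then show ?thesis using b by (simp add: T_scaleR u(1) field_simps)
qed

lemma K_nonneg: "K \<ge> 0"
  using norm_T_le[OF C0_zero, of 1] by (simp add: T_zero)

sublocale P: C0_functional sE X "\<lambda>u. blinfun_apply (T u) v" "K * norm v" for v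
proof
  fix u :: "'a \<Rightarrow> 'e" and b assume "u \<in> C0 X" "\<And>x. norm (u x) \<le> b"
  then have "norm (T u v) \<le> (K * b) * norm v"
    by (intro order_trans[OF norm_blinfun] mult_right_mono norm_T_le) auto
  then show "norm (T u v) \<le> K * norm v * b" by (simp add: mult_ac)
qed (simp_all add: locally_compact Hausdorff T_add T_scale blinfun.add_left scale_dual_apply)

text \<open>The dominating measures of v, w and v + w differ, but the three limits run along the
  same filter.\<close>

lemma nu_functional_add:
  assumes "A \<in> borel_sets X" shows "P.nu (v + w) A x = P.nu v A x + P.nu w A x"
proof (rule P.nu_eqI[OF assms])
  show "((\<lambda>f. T (\<lambda>y. f y *\<^sub>R x) (v + w)) \<longlongrightarrow> P.nu v A x + P.nu w A x) (cutoff_filter X A)"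
    unfolding blinfun.add_right by (intro tendsto_add P.nu_tendsto assms)
qed

lemma nu_functional_scale:
  assumes "A \<in> borel_sets X" shows "P.nu (sF c v) A x = c * P.nu v A x"
proof (rule P.nu_eqI[OF assms])
  have "((\<lambda>f. c * T (\<lambda>y. f y *\<^sub>R x) v) \<longlongrightarrow> c * P.nu v A x) (cutoff_filter X A)"
    by (intro tendsto_intros P.nu_tendsto assms)
  then show "((\<lambda>f. T (\<lambda>y. f y *\<^sub>R x) (sF c v)) \<longlongrightarrow> c * P.nu v A x) (cutoff_filter X A)"
    by (rule Lim_transform_eventually)
      (use eventually_cutoff_C0 in eventually_elim, simp add: T_dual C0_scaleR_const)
qed

lemma norm_nu_functional_le:
  assumes "A \<in> borel_sets X" shows "norm (P.nu v A x) \<le> K * norm x * norm v"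
proof -
  have "norm (P.nu v A x) \<le> norm x * measure (P.dominating_measure v) A" by (rule P.norm_nu_le[OF assms])
  also have "\<dots> \<le> norm x * (K * norm v)" by (intro mult_left_mono P.measure_N_le assms) auto
  finally show ?thesis by (simp add: mult_ac)
qed

definition \<mu> :: "'a set \<Rightarrow> ('e \<Rightarrow>\<^sub>L ('f \<Rightarrow>\<^sub>L 'k))" where
  "\<mu> A = Blinfun (\<lambda>x. Blinfun (\<lambda>v. P.nu v A x))"

text \<open>Both levels of \<open>Blinfun\<close> need justification: boundedness in v for fixed x,
  then in x for the resulting functionals. Each comes from the mass bound K * norm v.\<close>

lemma \<mu>_apply:
  assumes A: "A \<in> borel_sets X" shows "\<mu> A x v = P.nu v A x"
proof -
  have "bounded_linear (\<lambda>v. P.nu v A x)" for x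
  proof (rule bounded_linear_intro)
    show "P.nu (r *\<^sub>R v) A x = r *\<^sub>R P.nu v A x" for r v
      using nu_functional_scale[OF A, of "of_real r" v x] by (simp add: F.scale_of_real scaleR_conv_of_real)
    show "norm (P.nu v A x) \<le> norm v * (K * norm x)" for v
      using norm_nu_functional_le[OF A, of v x] by (simp add: mult_ac)
  qed (rule nu_functional_add[OF A])
  then have *: "Blinfun (\<lambda>v. P.nu v A x) v = P.nu v A x" for x v
    by (simp add: bounded_linear_Blinfun_apply)
  have "bounded_linear (\<lambda>x. Blinfun (\<lambda>v. P.nu v A x))"
  proof (rule bounded_linear_intro)
    show "Blinfun (\<lambda>v. P.nu v A (x + y)) = Blinfun (\<lambda>v. P.nu v A x) + Blinfun (\<lambda>v. P.nu v A y)" for x y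
      by (rule blinfun_eqI, simp only: * blinfun.add_left) (rule P.nu_add[OF A])
    show "Blinfun (\<lambda>v. P.nu v A (r *\<^sub>R x)) = r *\<^sub>R Blinfun (\<lambda>v. P.nu v A x)" for r x
    proof (rule blinfun_eqI)
      fix v
      show "Blinfun (\<lambda>v. P.nu v A (r *\<^sub>R x)) v = (r *\<^sub>R Blinfun (\<lambda>v. P.nu v A x)) v"
        using P.nu_scale[OF A, of v "of_real r" x]
        by (simp add: * blinfun.scaleR_left E.scale_of_real scaleR_conv_of_real)
    qed
    show "norm (Blinfun (\<lambda>v. P.nu v A x)) \<le> norm x * K" for x
      using norm_nu_functional_le[OF A] K_nonneg
      by (intro norm_blinfun_bound) (auto simp: * mult.commute)
  qed
  then show ?thesis by (simp add: \<mu>_def bounded_linear_Blinfun_apply *)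
qed

lemma regular_weak_star_\<mu>: "regular_weak_star_i_measure sE sF X \<mu>"
proof -
  have reg: "regular_i_measure sE (*) X (slice \<mu> v)" for v
    by (rule P.regular_i_measure_nu) (simp add: slice_apply \<mu>_apply)
  have "dual_operator_valued sE sF (borel_sets X) \<mu>"
    unfolding dual_operator_valued_def Lin_def dual_def
    by (auto intro!: blinfun_eqI simp: \<mu>_apply scale_dual_apply P.nu_scale nu_functional_scale)
  with reg show ?thesis
    by (auto simp: regular_weak_star_i_measure_def weak_star_i_measure_def regular_i_measure_def)
qed

lemma weak_star_measureI:
  "regular_weak_star_i_measure sE sF X \<nu> \<Longrightarrow> weak_star_measure sE (topspace X) (borel_sets X) sF \<nu>"
  by (intro weak_star_measure.intro weak_star_measure_axioms.intro E.banach_over_axioms sigma_algebra_borel_sets)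
    (simp add: regular_weak_star_i_measure_def)

sublocale W: weak_star_measure sE "topspace X" "borel_sets X" sF \<mu>
  by (rule weak_star_measureI[OF regular_weak_star_\<mu>])

lemma disjoint_sums_le:
  assumes "\<phi> \<in> W.disjoint_sums" shows "norm \<phi> \<le> K"
proof -
  obtain N :: nat and A x where A: "\<phi> = (\<Sum>n<N. \<mu> (A n) (x n))"
      "\<forall>n<N. A n \<in> borel_sets X" "disjoint_family_on A {..<N}" "\<forall>n<N. norm (x n) \<le> 1"
    using assms unfolding W.disjoint_sums_def by blast
  show ?thesis
  proof (rule norm_blinfun_bound[OF K_nonneg])
    fix v
    have "\<phi> v = (\<Sum>n<N. P.nu v (A n) (x n))"
      using A(2) by (simp add: A(1) blinfun.sum_left \<mu>_apply)
    then show "norm (\<phi> v) \<le> K * norm v" using P.norm_sum_nu_le[of N A x v] A by simp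
  qed
qed

text \<open>One step function serves for both estimates: it is uniformly close to u, and the error
  of \<open>nu_approx\<close> is proportional to the norm of v, which makes the integrals close in
  the norm of the dual.\<close>

lemma C0_simple_approx:
  assumes u: "u \<in> C0 X" and e: "e > 0"
  obtains s where "s \<in> countably_valued (topspace X) (borel_sets X)"
    "\<And>y. y \<in> topspace X \<Longrightarrow> norm (u y - s y) \<le> e"
    "norm (T u - weak_star_integral_countable (topspace X) \<mu> s) \<le> e * K"
proof -
  obtain n :: nat and A c where A: "\<And>i. i \<le> n \<Longrightarrow> A i \<in> borel_sets X" "disjoint_family_on A {..n}"
    "(\<Union>i\<le>n. A i) = topspace X" "\<And>i y. i \<le> n \<Longrightarrow> y \<in> A i \<Longrightarrow> norm (u y - c i) \<le> e"
    using C0_partition[OF u e] by metis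
  obtain s where s: "s \<in> countably_valued (topspace X) (borel_sets X)"
      "\<And>i y. i \<in> {..n} \<Longrightarrow> y \<in> A i \<Longrightarrow> s y = c i"
    by (rule P.borel.countably_valued_partition[of "{..n}" A c]) (use A in auto)
  have us: "norm (u y - s y) \<le> e" if y: "y \<in> topspace X" for y
  proof -
    obtain i where "i \<le> n" "y \<in> A i" using y unfolding A(3)[symmetric] by auto
    then show ?thesis using A(4) s(2) by simp
  qed
  have s_eq: "(\<Sum>i\<in>{..n}. indicator (A i) y *\<^sub>R c i) = s y" if y: "y \<in> topspace X" for y
  proof -
    obtain j where j: "j \<le> n" "y \<in> A j" using y unfolding A(3)[symmetric] by auto
    have "indicator (A i) y *\<^sub>R c i = (if i = j then c j else 0)" if "i \<in> {..n}" for i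
      using disjoint_family_onD[OF A(2) that, of j] j by (auto simp: indicator_def)
    then have "(\<Sum>i\<in>{..n}. indicator (A i) y *\<^sub>R c i) = (\<Sum>i\<in>{..n}. if i = j then c j else 0)"
      by (rule sum.cong[OF refl])
    also have "\<dots> = s y" using j s(2)[of j y] by simp
    finally show ?thesis .
  qed
  have "norm (T u - weak_star_integral_countable (topspace X) \<mu> s) \<le> e * K"
  proof (rule norm_blinfun_bound)
    fix v
    have "weak_star_integral_countable (topspace X) \<mu> s v = W.S.integral v s"
      by (rule W.J_apply[OF disjoint_sums_le s(1)])
    also have "\<dots> = (\<Sum>i\<in>{..n}. slice \<mu> v (A i) (c i))"
      by (rule W.S.integral_finite) (use A s(2) in auto)
    also have "\<dots> = (\<Sum>i\<in>{..n}. P.nu v (A i) (c i))"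
      by (rule sum.cong) (use A(1) in \<open>auto simp: slice_apply \<mu>_apply\<close>)
    finally have eq: "weak_star_integral_countable (topspace X) \<mu> s v = (\<Sum>i\<in>{..n}. P.nu v (A i) (c i))" .
    have "norm (T u v - (\<Sum>i\<in>{..n}. P.nu v (A i) (c i))) \<le> e * (K * norm v)"
    proof (rule P.nu_approx)
      show "norm (u y - (\<Sum>i\<in>{..n}. indicator (A i) y *\<^sub>R c i)) \<le> e" if "y \<in> topspace X" for y
        unfolding s_eq[OF that] by (rule us[OF that])
    qed (use A u e in auto)
    then show "norm ((T u - weak_star_integral_countable (topspace X) \<mu> s) v) \<le> e * K * norm v"
      by (simp add: blinfun.diff_left eq mult.assoc)
  qed (use e K_nonneg in simp)
  with s(1) us show thesis by (rule that)
qed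

lemma C0_simple_sequence:
  assumes u: "u \<in> C0 X"
  obtains s where "\<And>n. s n \<in> countably_valued (topspace X) (borel_sets X)"
    "uniform_limit (topspace X) s u sequentially"
    "(\<lambda>n. weak_star_integral_countable (topspace X) \<mu> (s n)) \<longlonglongrightarrow> T u"
proof -
  have "\<exists>s. s \<in> countably_valued (topspace X) (borel_sets X) \<and>
      (\<forall>y\<in>topspace X. norm (u y - s y) \<le> 1 / Suc n) \<and>
      norm (T u - weak_star_integral_countable (topspace X) \<mu> s) \<le> 1 / Suc n * K" for n
    by (rule C0_simple_approx[OF u, of "1 / Suc n"]) auto
  then obtain s where s: "\<And>n. s n \<in> countably_valued (topspace X) (borel_sets X)"
      "\<And>n y. y \<in> topspace X \<Longrightarrow> norm (u y - s n y) \<le> 1 / Suc n"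
      "\<And>n. norm (T u - weak_star_integral_countable (topspace X) \<mu> (s n)) \<le> 1 / Suc n * K"
    by metis
  have "(\<lambda>n. weak_star_integral_countable (topspace X) \<mu> (s n) - T u) \<longlonglongrightarrow> 0"
  proof (rule Lim_null_comparison[OF always_eventually])
    show "\<forall>n. norm (weak_star_integral_countable (topspace X) \<mu> (s n) - T u) \<le> 1 / Suc n * K"
      using s(3) by (simp add: norm_minus_commute)
    show "(\<lambda>n. 1 / real (Suc n) * K) \<longlonglongrightarrow> 0"
      using tendsto_mult_left_zero[OF LIMSEQ_inverse_real_of_nat, of K] by (simp add: divide_inverse)
  qed
  then have "(\<lambda>n. weak_star_integral_countable (topspace X) \<mu> (s n)) \<longlonglongrightarrow> T u"
    by (simp add: LIM_zero_iff)
  moreover have "uniform_limit (topspace X) s u sequentially"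
    using s(2) by (rule uniform_limit_inverse_SucI)
  ultimately show thesis using that s(1) by blast
qed

lemma T_eq_weak_star_integral:
  assumes u: "u \<in> C0 X" shows "T u = weak_star_integral (topspace X) (borel_sets X) \<mu> u"
proof -
  obtain s where s: "\<And>n. s n \<in> countably_valued (topspace X) (borel_sets X)"
    "uniform_limit (topspace X) s u sequentially"
    "(\<lambda>n. weak_star_integral_countable (topspace X) \<mu> (s n)) \<longlonglongrightarrow> T u"
    using C0_simple_sequence[OF u] by blast
  show ?thesis
    using LIMSEQ_unique[OF s(3) W.weak_star_integral_LIMSEQ[OF disjoint_sums_le s(1,2)]] .
qed

text \<open>The mass bounds of the slices give one inequality and make the semivariation a real
  number S. This S is then a bound for the disjoint sums, so the integral estimate applies to T
  u.\<close>

lemma norm_eq_total_semivariation: "ennreal K = total_semivariation (borel_sets X) \<mu>"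
proof (rule antisym)
  show "total_semivariation (borel_sets X) \<mu> \<le> ennreal K"
    unfolding W.total_semivariation_eq by (intro SUP_least ennreal_leI disjoint_sums_le)
  then obtain S where S: "total_semivariation (borel_sets X) \<mu> = ennreal S" "S \<ge> 0"
    by (cases "total_semivariation (borel_sets X) \<mu>") (auto simp: top_unique)
  have le: "norm \<phi> \<le> S" if "\<phi> \<in> W.disjoint_sums" for \<phi>
  proof -
    have "ennreal (norm \<phi>) \<le> ennreal S"
      unfolding S(1)[symmetric] W.total_semivariation_eq using that by (rule SUP_upper)
    then show ?thesis using S(2) by simp
  qed
  have "K \<le> S"
    unfolding norm_on_C0_def
  proof (rule cSup_least)
    have "sup_norm (\<lambda>_::'a. 0::'e) \<le> 1" by (rule sup_norm_le) simp
    then show "{norm (T u) | u. u \<in> C0 X \<and> sup_norm u \<le> 1} \<noteq> {}" using C0_zero by blast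
    fix r assume "r \<in> {norm (T u) | u. u \<in> C0 X \<and> sup_norm u \<le> 1}"
    then obtain u where u: "r = norm (T u)" "u \<in> C0 X" "sup_norm u \<le> 1" by blast
    obtain s where s: "\<And>n. s n \<in> countably_valued (topspace X) (borel_sets X)"
      "uniform_limit (topspace X) s u sequentially"
      using C0_simple_sequence[OF u(2)] by blast
    have "norm (weak_star_integral (topspace X) (borel_sets X) \<mu> u) \<le> 1 * S"
      by (rule W.norm_weak_star_integral_le[OF le s])
        (use norm_le_sup_norm[OF u(2)] u(3) in \<open>auto intro: order_trans\<close>)
    then show "r \<le> S" by (simp add: u(1) T_eq_weak_star_integral[OF u(2), symmetric])
  qed
  then show "ennreal K \<le> total_semivariation (borel_sets X) \<mu>" by (simp add: S(1) ennreal_leI)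
qed

lemma \<mu>_unique:
  assumes reg: "regular_weak_star_i_measure sE sF X \<nu>"
    and rep: "\<And>u. u \<in> C0 X \<Longrightarrow> T u = weak_star_integral (topspace X) (borel_sets X) \<nu> u"
    and A: "A \<in> borel_sets X"
  shows "\<nu> A = \<mu> A"
proof (intro blinfun_eqI)
  fix x v
  interpret N: weak_star_measure sE "topspace X" "borel_sets X" sF \<nu>
    by (rule weak_star_measureI[OF reg])
  let ?V = "N.S.var_measure v"
  obtain S where S: "\<And>\<phi>. \<phi> \<in> N.disjoint_sums \<Longrightarrow> norm \<phi> \<le> S" using N.disjoint_sums_bounded by blast
  have radonV: "radon X ?V"
    using reg by (intro radon_var_measure[where sE = sE] E.banach_over_axioms)
      (simp add: regular_weak_star_i_measure_def)
  \<comment> \<open>T (f x) v is the limit of the integrals of staircases. Off B each staircase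
    equals the step function with value x on A and 0 elsewhere, and on B it differs from it by at
    most the norm of x.\<close>
  have close: "norm (T (\<lambda>y. f y *\<^sub>R x) v - \<nu> A x v) \<le> norm x * measure ?V B"
    if f: "f \<in> C0 X" "\<And>y. 0 \<le> f y" "\<And>y. f y \<le> 1" and B: "B \<in> borel_sets X"
      and fB: "\<And>y. y \<in> topspace X - B \<Longrightarrow> f y = indicator A y" for f :: "'a \<Rightarrow> real" and B
  proof -
    have "\<exists>s. s \<in> countably_valued (topspace X) (borel_sets X) \<and>
        (\<forall>y\<in>topspace X. \<exists>a. 0 \<le> a \<and> a \<le> 1 \<and> s y = a *\<^sub>R x \<and> \<bar>f y - a\<bar> \<le> 1 / Suc n \<and>
          (f y = 0 \<longrightarrow> a = 0) \<and> (f y = 1 \<longrightarrow> a = 1))" for n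
      by (rule C0_staircase[OF f, where x = x and n = n]) blast
    then obtain s where s: "\<And>n. s n \<in> countably_valued (topspace X) (borel_sets X)"
      and s_a: "\<And>n y. y \<in> topspace X \<Longrightarrow> \<exists>a. 0 \<le> a \<and> a \<le> 1 \<and> s n y = a *\<^sub>R x \<and> \<bar>f y - a\<bar> \<le> 1 / Suc n \<and>
          (f y = 0 \<longrightarrow> a = 0) \<and> (f y = 1 \<longrightarrow> a = 1)"
      by metis
    have "uniform_limit (topspace X) s (\<lambda>y. f y *\<^sub>R x) sequentially"
    proof (rule uniform_limit_inverse_SucI[where c = "norm x"])
      fix n y assume "y \<in> topspace X"
      then obtain a where a: "s n y = a *\<^sub>R x" "\<bar>f y - a\<bar> \<le> 1 / Suc n" using s_a by blast
      have "norm (f y *\<^sub>R x - s n y) = \<bar>f y - a\<bar> * norm x"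
        by (simp add: a(1) flip: scaleR_left_diff_distrib)
      also have "\<dots> \<le> 1 / Suc n * norm x" using a(2) by (rule mult_right_mono) simp
      finally show "norm (f y *\<^sub>R x - s n y) \<le> norm x / Suc n" by simp
    qed
    then have "(\<lambda>n. weak_star_integral_countable (topspace X) \<nu> (s n)) \<longlonglongrightarrow> T (\<lambda>y. f y *\<^sub>R x)"
      using N.weak_star_integral_LIMSEQ[OF S s] rep[OF C0_scaleR_const[OF f(1)]] by simp
    then have "(\<lambda>n. weak_star_integral_countable (topspace X) \<nu> (s n) v) \<longlonglongrightarrow> T (\<lambda>y. f y *\<^sub>R x) v"
      by (intro blinfun.tendsto tendsto_const)
    then have lim: "(\<lambda>n. N.S.integral v (s n)) \<longlonglongrightarrow> T (\<lambda>y. f y *\<^sub>R x) v"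
      by (simp add: N.J_apply[OF S s])
    let ?A = "\<lambda>b. if b then A else topspace X - A"
    \<comment> \<open>This is the step function in question; its integral is exactly \<nu> A x
      v.\<close>
    obtain t where t: "t \<in> countably_valued (topspace X) (borel_sets X)"
      "\<And>b y. b \<in> UNIV \<Longrightarrow> y \<in> ?A b \<Longrightarrow> t y = (if b then x else 0)"
      by (rule P.borel.countably_valued_partition[of UNIV ?A "\<lambda>b. if b then x else 0"])
        (use A borel_sets_subset[OF A] in \<open>auto simp: disjoint_family_on_def UNIV_bool\<close>)
    have tA: "t y = x" if "y \<in> A" for y using t(2)[of True y] that by simp
    have tA': "t y = 0" if "y \<in> topspace X - A" for y using t(2)[of False y] that by simp
    have "N.S.integral v t = (\<Sum>b\<in>UNIV. slice \<nu> v (?A b) (if b then x else 0))"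
      by (rule N.S.integral_finite)
        (use A borel_sets_subset[OF A] t(2) in \<open>auto simp: disjoint_family_on_def UNIV_bool\<close>)
    also have "\<dots> = \<nu> A x v" by (simp add: UNIV_bool slice_apply)
    finally have int_t: "N.S.integral v t = \<nu> A x v" .
    have "norm (N.S.integral v (s n) - N.S.integral v t) \<le> norm x * measure ?V B" for n
    proof (rule N.S.norm_integral_diff_le[OF s t(1) B])
      fix y assume y: "y \<in> topspace X - B"
      obtain a where "s n y = a *\<^sub>R x" "f y = 0 \<longrightarrow> a = 0" "f y = 1 \<longrightarrow> a = 1"
        using s_a[of y n] y by blast
      then show "s n y = t y" using fB[OF y] tA[of y] tA'[of y] y by (cases "y \<in> A") auto
    next
      fix y assume "y \<in> B"
      then have y: "y \<in> topspace X" using borel_sets_subset[OF B] by blast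
      then obtain a where a: "s n y = a *\<^sub>R x" "0 \<le> a" "a \<le> 1" using s_a[of y n] by blast
      show "norm (s n y - t y) \<le> norm x"
      proof (cases "y \<in> A")
        case True
        have "a *\<^sub>R x - x = (a - 1) *\<^sub>R x" by (simp add: scaleR_left_diff_distrib)
        then show ?thesis using a by (simp add: tA[OF True] mult_left_le_one_le)
      next
        case False
        then show ?thesis using a y by (simp add: tA' mult_left_le_one_le)
      qed
    qed simp
    then have "norm (T (\<lambda>y. f y *\<^sub>R x) v - N.S.integral v t) \<le> norm x * measure ?V B"
      by (intro tendsto_upperbound[OF tendsto_norm[OF tendsto_diff[OF lim tendsto_const]]]) auto
    then show ?thesis by (simp add: int_t)
  qed
  have "((\<lambda>f. T (\<lambda>y. f y *\<^sub>R x) v) \<longlongrightarrow> \<nu> A x v) (cutoff_filter X A)"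
  proof (rule tendstoI)
    fix e :: real assume e: "e > 0"
    define d where "d = e / (norm x + 1)"
    have d: "d > 0" using e by (simp add: d_def add_nonneg_pos)
    show "\<forall>\<^sub>F f in cutoff_filter X A. dist (T (\<lambda>y. f y *\<^sub>R x) v) (\<nu> A x v) < e"
      using eventually_cutoff_C0 eventually_cutoff_radon[OF radonV Hausdorff A d]
    proof eventually_elim
      fix f :: "'a \<Rightarrow> real" assume f: "f \<in> C0 X \<and> (\<forall>x. 0 \<le> f x \<and> f x \<le> 1)"
        and "\<exists>B\<in>borel_sets X. measure ?V B < d \<and> (\<forall>x\<in>topspace X - B. f x = indicator A x)"
      then obtain B where B: "B \<in> borel_sets X" "measure ?V B < d" "\<And>x. x \<in> topspace X - B \<Longrightarrow> f x = indicator A x"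
        by blast
      have "norm (T (\<lambda>y. f y *\<^sub>R x) v - \<nu> A x v) \<le> norm x * measure ?V B"
        using f B by (intro close) auto
      also have "\<dots> \<le> norm x * d" using B(2) by (intro mult_left_mono) auto
      also have "\<dots> < (norm x + 1) * d" using d by simp
      also have "\<dots> = e" by (simp add: d_def add_nonneg_eq_0_iff)
      finally show "dist (T (\<lambda>y. f y *\<^sub>R x) v) (\<nu> A x v) < e" by (simp add: dist_norm)
    qed
  qed
  then show "\<nu> A x v = \<mu> A x v" using P.nu_eqI[OF A] \<mu>_apply[OF A] by metis
qed

end

text \<open>Set functions are total here, so uniqueness means agreement on Borel sets; the final
  equation in \<open>ennreal\<close> includes finiteness of the semivariation.\<close>

theorem theorem6p14:
  fixes X :: "'a topology"
    and scaleE :: "'k::real_or_complex \<Rightarrow> 'e::banach \<Rightarrow> 'e"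
    and scaleF :: "'k \<Rightarrow> 'f::banach \<Rightarrow> 'f"
    and T :: "('a \<Rightarrow> 'e) \<Rightarrow> ('f \<Rightarrow>\<^sub>L 'k)"
  assumes "locally_compact_space X" and "Hausdorff_space X"
    and "banach_over scaleE" and "banach_over scaleF"
    and "continuous_linear_on_C0 scaleE scaleF X T"
  shows "\<exists>\<mu> :: 'a set \<Rightarrow> ('e \<Rightarrow>\<^sub>L ('f \<Rightarrow>\<^sub>L 'k)).
           regular_weak_star_i_measure scaleE scaleF X \<mu> \<and>
           (\<forall>u\<in>C0 X. T u = weak_star_integral (topspace X) (borel_sets X) \<mu> u) \<and>
           (\<forall>\<nu>. regular_weak_star_i_measure scaleE scaleF X \<nu> \<and>
                 (\<forall>u\<in>C0 X. T u = weak_star_integral (topspace X) (borel_sets X) \<nu> u) \<longrightarrow>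
                 (\<forall>A\<in>borel_sets X. \<nu> A = \<mu> A)) \<and>
           ennreal (norm_on_C0 X T) = total_semivariation (borel_sets X) \<mu>"
proof -
  interpret C0_operator scaleE scaleF X T
    using assms by (intro C0_operator.intro C0_operator_axioms.intro)
  show ?thesis
  proof (intro exI[of _ \<mu>] conjI allI impI ballI)
    fix \<nu> A
    assume "regular_weak_star_i_measure scaleE scaleF X \<nu> \<and>
        (\<forall>u\<in>C0 X. T u = weak_star_integral (topspace X) (borel_sets X) \<nu> u)"
      and "A \<in> borel_sets X"
    then show "\<nu> A = \<mu> A" by (intro \<mu>_unique) auto
  qed (rule regular_weak_star_\<mu> T_eq_weak_star_integral norm_eq_total_semivariation, assumption?)+
qed

end
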